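(* For $\alpha\in(0,\infty)$ let $E_\alpha\subset\mathbb{R}^2$ be given in polar coordinates $(r,\varphi)$ by $$E_\alpha := \left\{(r,\varphi): \ \frac1{(\varphi + \pi)^\alpha} \le r < \frac 1{\varphi^\alpha}, \ 2\pi \le \varphi < \infty\right\}.$$ Let $p \in [1,\infty)$, $q \in [1,\infty]$, $\tau \in [0,1/p)$, $s\in(0,1]$, and $\alpha\in(0,\infty)$. Then the following assertions hold. (i) (The interior of) $E_\alpha$ is a bounded thick domain. (ii) The function ${\bf 1}_{E_\alpha}$ does not belong to any space $F^{1/p,\tau}_{p,q} (\mathbb{R}^2)$. (iii) Let $0 < s < \min\{\frac 1p ,\, 2(\frac 1p - \tau)\}$. (a) Let $\alpha\in(0, 1)$. Then ${\bf 1}_{E_\alpha} \in F^{s,\tau}_{p,q} (\mathbb{R}^2)$ if and only if $2\tau + s\, \frac{\alpha + 1}{\alpha} \le \frac 2p$ and $s < \frac{2\alpha}{\alpha+1} \, \frac 1p$. (b) Let $\alpha =1$. Then ${\bf 1}_{E_\alpha} \in F^{s,\tau}_{p,q} (\mathbb{R}^2)$ if and only if $\tau + s \le \frac1p$ and $s < \frac 1p$. (c) Let $\alpha\in(1,\infty)$. Then ${\bf 1}_{E_\alpha} \in F^{s,\tau}_{p, q} (\mathbb{R}^2)$ if and only if $2\tau + s\, \frac{\alpha + 1}{\alpha} \le \frac 2p$ and $s < \frac 1p$.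
   Context: $(r,\varphi)$ stands for the point $(r\cos\varphi,r\sin\varphi)$, with $\varphi$ ranging over $[2\pi,\infty)$ (not reduced modulo $2\pi$). ${\bf 1}_{E_\alpha}$ is the characteristic function of $E_\alpha$. A domain is a non-empty open set; non-trivial means different from $\emptyset$ and $\mathbb{R}^n$. Dyadic cubes: for $j\in\mathbb{Z}$, $k\in\mathbb{Z}^n$ let $Q_{j,k}:=2^{-j}([0,1)^n+k)$ (here $n=2$); $\mathcal{Q}$ is the set of all of them; $\ell(P)$ is the edge length of a cube $P$ and $j_P:=-\log_2\ell(P)$. Triebel--Lizorkin-type spaces: fix $\varphi_0,\varphi\in\mathcal{S}(\mathbb{R}^n)$ with real-valued nonnegative Fourier transforms such that $\mathrm{supp}\,\mathcal{F}\varphi_0\subset\{|\xi|\le 2\}$, $|\mathcal{F}\varphi_0(\xi)|\ge C>0$ for $|\xi|\le 5/3$, $\mathrm{supp}\,\mathcal{F}\varphi\subset\{1/2\le|\xi|\le 2\}$, $|\mathcal{F}\varphi(\xi)|\ge C>0$ for $3/5\le|\xi|\le 5/3$; put $\varphi_j:=2^{jn}\varphi(2^j\cdot)$ for $j\ge 1$. For $s\in\mathbb{R}$, $\tau\in[0,\infty)$, $p\in(0,\infty)$, $q\in(0,\infty]$, $F^{s,\tau}_{p,q}(\mathbb{R}^n)$ is the set of all $f\in\mathcal{S}'(\mathbb{R}^n)$ with $$\|f\|_{F^{s,\tau}_{p,q}(\mathbb{R}^n)}:=\sup_{P\in\mathcal{Q}}\frac1{|P|^{\tau}}\Big\{\int_P\Big[\sum_{j=\max\{j_P,0\}}^\infty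 2^{js q}|\varphi_j\ast f(x)|^q\Big]^{p/q}dx\Big\}^{1/p}<\infty$$ (usual modification if $q=\infty$). Thick domains (cubes have edges parallel to the axes; $\sim$ means two-sided estimates with constants independent of $j$ and of the cubes): a non-trivial domain $E\subset\mathbb{R}^n$ is E-thick if for any cube $Q_i\subset E$ with $\ell(Q_i)\sim2^{-j}$ and $\mathrm{dist}(Q_i,\partial E)\sim2^{-j}$, $j\ge j_0\in\mathbb{N}$, there is a cube $Q_e\subset\mathbb{R}^n\setminus E$ with $\ell(Q_e)\sim2^{-j}$ and $\mathrm{dist}(Q_e,\partial E)\sim\mathrm{dist}(Q_i,Q_e)\sim2^{-j}$. It is I-thick if for any cube $Q^e\subset\mathbb{R}^n\setminus E$ with $\ell(Q^e)\sim2^{-j}$ and $\mathrm{dist}(Q^e,\partial E)\sim2^{-j}$, $j\ge j_0\in\mathbb{N}$, there is a cube $Q^i\subset E$ with $\ell(Q^i)\sim2^{-j}$ and $\mathrm{dist}(Q^i,\partial E)\sim\mathrm{dist}(Q^i,Q^e)\sim2^{-j}$. It is thick if it is both E-thick and I-thick. *)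

theory Defs
  imports "HOL-Analysis.Analysis"
begin

subsection \<open>Schwartz functions, Fourier transform, tempered distributions\<close>

definition partial_deriv :: "'n::finite \<Rightarrow> (real^'n \<Rightarrow> complex) \<Rightarrow> real^'n \<Rightarrow> complex" where
  "partial_deriv i f x = frechet_derivative f (at x) (axis i 1)"

text \<open>The multi-index \<open>\<beta>\<close> is written as a list of coordinate directions; its order is the
  length of the list.\<close>

abbreviation iterated_deriv :: "'n::finite list \<Rightarrow> (real^'n \<Rightarrow> complex) \<Rightarrow> real^'n \<Rightarrow> complex" where
  "iterated_deriv \<beta> f \<equiv> foldr partial_deriv \<beta> f"

definition schwartz :: "(real^'n::finite \<Rightarrow> complex) set" where
  "schwartz = {f. (\<forall>\<beta> x. iterated_deriv \<beta> f differentiable (at x)) \<and>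
                  (\<forall>\<beta> N::nat. bounded (range (\<lambda>x. (1 + norm x) ^ N *\<^sub>R iterated_deriv \<beta> f x)))}"

definition schwartz_norm :: "nat \<Rightarrow> (real^'n::finite \<Rightarrow> complex) \<Rightarrow> real" where
  "schwartz_norm N f =
     (SUP (\<beta>, x) \<in> {\<beta>. length \<beta> \<le> N} \<times> UNIV. (1 + norm x) ^ N * norm (iterated_deriv \<beta> f x))"

text \<open>Functionals are extensional (\<open>undefined\<close> off the Schwartz space), so that equality of
  distributions is HOL equality.\<close>

definition tempered_distributions :: "((real^'n::finite \<Rightarrow> complex) \<Rightarrow> complex) set" where
  "tempered_distributions = {T \<in> extensional schwartz.
     (\<forall>f\<in>schwartz. \<forall>g\<in>schwartz. T (\<lambda>x. f x + g x) = T f + T g) \<and>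
     (\<forall>c. \<forall>f\<in>schwartz. T (\<lambda>x. c * f x) = c * T f) \<and>
     (\<exists>C N. \<forall>f\<in>schwartz. norm (T f) \<le> C * schwartz_norm N f)}"

definition regular_distribution ::
    "(real^'n::finite \<Rightarrow> complex) \<Rightarrow> (real^'n \<Rightarrow> complex) \<Rightarrow> complex" where
  "regular_distribution g = (\<lambda>f\<in>schwartz. \<integral>x. g x * f x \<partial>lebesgue)"

definition convolution ::
    "(real^'n::finite \<Rightarrow> complex) \<Rightarrow> ((real^'n \<Rightarrow> complex) \<Rightarrow> complex) \<Rightarrow> real^'n \<Rightarrow> complex" where
  "convolution f T x = T (\<lambda>y. f (x - y))"

definition fourier :: "(real^'n::finite \<Rightarrow> complex) \<Rightarrow> real^'n \<Rightarrow> complex" where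
  "fourier f \<xi> = (2 * pi) powr (- real CARD('n) / 2) *\<^sub>R (\<integral>x. cis (- (x \<bullet> \<xi>)) * f x \<partial>lborel)"

definition supp :: "(real^'n::finite \<Rightarrow> complex) \<Rightarrow> (real^'n) set" where
  "supp f = closure {x. f x \<noteq> 0}"


subsection \<open>Triebel--Lizorkin-type spaces\<close>

definition admissible_pair :: "(real^'n::finite \<Rightarrow> complex) \<Rightarrow> (real^'n \<Rightarrow> complex) \<Rightarrow> bool" where
  "admissible_pair \<phi>\<^sub>0 \<phi> \<longleftrightarrow>
     \<phi>\<^sub>0 \<in> schwartz \<and> \<phi> \<in> schwartz \<and>
     (\<forall>\<xi>. fourier \<phi>\<^sub>0 \<xi> \<in> \<real>\<^sub>\<ge>\<^sub>0) \<and> (\<forall>\<xi>. fourier \<phi> \<xi> \<in> \<real>\<^sub>\<ge>\<^sub>0) \<and>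
     supp (fourier \<phi>\<^sub>0) \<subseteq> {\<xi>. norm \<xi> \<le> 2} \<and>
     (\<exists>C>0. \<forall>\<xi>. norm \<xi> \<le> 5/3 \<longrightarrow> norm (fourier \<phi>\<^sub>0 \<xi>) \<ge> C) \<and>
     supp (fourier \<phi>) \<subseteq> {\<xi>. 1/2 \<le> norm \<xi> \<and> norm \<xi> \<le> 2} \<and>
     (\<exists>C>0. \<forall>\<xi>. 3/5 \<le> norm \<xi> \<and> norm \<xi> \<le> 5/3 \<longrightarrow> norm (fourier \<phi> \<xi>) \<ge> C)"

definition resolution ::
    "(real^'n::finite \<Rightarrow> complex) \<Rightarrow> (real^'n \<Rightarrow> complex) \<Rightarrow> nat \<Rightarrow> real^'n \<Rightarrow> complex" where
  "resolution \<phi>\<^sub>0 \<phi> j x = (if j = 0 then \<phi>\<^sub>0 x else 2 ^ (j * CARD('n)) * \<phi> (2 ^ j *\<^sub>R x))"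

definition dyadic_cube :: "int \<Rightarrow> int^'n::finite \<Rightarrow> (real^'n) set" where
  "dyadic_cube m k = {2 powr (- real_of_int m) *\<^sub>R (y + (\<chi> i. real_of_int (k $ i))) | y.
     \<forall>i. 0 \<le> y $ i \<and> y $ i < 1}"

text \<open>Only used with positive exponents.\<close>

definition ennreal_powr :: "ennreal \<Rightarrow> real \<Rightarrow> ennreal" where
  "ennreal_powr x a = (if x = \<infinity> then \<infinity> else ennreal (enn2real x powr a))"

text \<open>The cube \<open>P = dyadic_cube m k\<close> has edge length \<open>2 powr (- m)\<close>, i.e. \<open>j\<^sub>P = m\<close>.\<close>

definition TL_norm ::
    "(real^'n::finite \<Rightarrow> complex) \<Rightarrow> (real^'n \<Rightarrow> complex) \<Rightarrow> real \<Rightarrow> real \<Rightarrow> real \<Rightarrow> ennreal \<Rightarrow>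
     ((real^'n \<Rightarrow> complex) \<Rightarrow> complex) \<Rightarrow> ennreal" where
  "TL_norm \<phi>\<^sub>0 \<phi> s \<tau> p q f =
     (SUP (m, k) \<in> UNIV. let P = dyadic_cube m k in
        ennreal (1 / measure lborel P powr \<tau>) *
        ennreal_powr
          (\<integral>\<^sup>+x\<in>P.
             (if q = \<infinity> then
                ennreal_powr
                  (SUP j \<in> {j::nat. max m 0 \<le> int j}.
                     ennreal (2 powr (real j * s) * norm (convolution (resolution \<phi>\<^sub>0 \<phi> j) f x))) p
              else
                ennreal_powr
                  (\<Sum>j::nat. if max m 0 \<le> int j then
                     ennreal (2 powr (real j * s * enn2real q) *
                              norm (convolution (resolution \<phi>\<^sub>0 \<phi> j) f x) powr enn2real q)
                     else 0) (p / enn2real q)) \<partial>lborel) (1 / p))"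

definition TL_space ::
    "(real^'n::finite \<Rightarrow> complex) \<Rightarrow> (real^'n \<Rightarrow> complex) \<Rightarrow> real \<Rightarrow> real \<Rightarrow> real \<Rightarrow> ennreal \<Rightarrow>
     ((real^'n \<Rightarrow> complex) \<Rightarrow> complex) set" where
  "TL_space \<phi>\<^sub>0 \<phi> s \<tau> p q = {f \<in> tempered_distributions. TL_norm \<phi>\<^sub>0 \<phi> s \<tau> p q f < \<infinity>}"


subsection \<open>Thick domains\<close>

definition nontrivial_domain :: "(real^'n::finite) set \<Rightarrow> bool" where
  "nontrivial_domain E \<longleftrightarrow> open E \<and> E \<noteq> {} \<and> E \<noteq> UNIV"

definition cube :: "real^'n::finite \<Rightarrow> real \<Rightarrow> (real^'n) set" where
  "cube a l = cbox a (a + l *\<^sub>R One)"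

definition comparable :: "real \<Rightarrow> real \<Rightarrow> real \<Rightarrow> bool" where
  "comparable C a b \<longleftrightarrow> b / C \<le> a \<and> a \<le> C * b"

text \<open>The constant \<open>c\<close> in the hypotheses on the given cube is arbitrary; the constant \<open>C\<close> for the
  cube to be found may depend on \<open>c\<close>, but not on \<open>j\<close> or on the cubes. Cubes are closed; since all
  of them have positive distance to the boundary, this is immaterial. Comparability with
  \<open>2 powr (- j)\<close> forces edge lengths to be positive.\<close>

definition E_thick :: "(real^'n::finite) set \<Rightarrow> bool" where
  "E_thick E \<longleftrightarrow> nontrivial_domain E \<and>
     (\<exists>j\<^sub>0::nat. \<forall>c\<ge>1. \<exists>C\<ge>1. \<forall>j\<ge>j\<^sub>0. \<forall>a l.
        cube a l \<subseteq> E \<and> comparable c l (2 powr (- real j)) \<and>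
        comparable c (setdist (cube a l) (frontier E)) (2 powr (- real j)) \<longrightarrow>
        (\<exists>b l'. cube b l' \<subseteq> - E \<and> comparable C l' (2 powr (- real j)) \<and>
           comparable C (setdist (cube b l') (frontier E)) (2 powr (- real j)) \<and>
           comparable C (setdist (cube a l) (cube b l')) (2 powr (- real j))))"

definition I_thick :: "(real^'n::finite) set \<Rightarrow> bool" where
  "I_thick E \<longleftrightarrow> nontrivial_domain E \<and>
     (\<exists>j\<^sub>0::nat. \<forall>c\<ge>1. \<exists>C\<ge>1. \<forall>j\<ge>j\<^sub>0. \<forall>a l.
        cube a l \<subseteq> - E \<and> comparable c l (2 powr (- real j)) \<and>
        comparable c (setdist (cube a l) (frontier E)) (2 powr (- real j)) \<longrightarrow>
        (\<exists>b l'. cube b l' \<subseteq> E \<and> comparable C l' (2 powr (- real j)) \<and>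
           comparable C (setdist (cube b l') (frontier E)) (2 powr (- real j)) \<and>
           comparable C (setdist (cube b l') (cube a l)) (2 powr (- real j))))"

definition thick :: "(real^'n::finite) set \<Rightarrow> bool" where
  "thick E \<longleftrightarrow> E_thick E \<and> I_thick E"


subsection \<open>The spiral sets\<close>

definition spiral :: "real \<Rightarrow> (real^2) set" where
  "spiral \<alpha> = {vector [r * cos \<theta>, r * sin \<theta>] | r \<theta>.
     1 / (\<theta> + pi) powr \<alpha> \<le> r \<and> r < 1 / \<theta> powr \<alpha> \<and> 2 * pi \<le> \<theta>}"

end

theory Submission
  imports Defs
begin

text \<open>In the coordinates \<open>u = r powr (- 1/\<alpha>)\<close> and \<open>\<phi>\<close> the spiral consists of the strips
  \<open>\<phi> < u \<le> \<phi> + \<pi>\<close>, and all geometric statements are read off there; at distance \<open>r\<close> from the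
  origin the coils have width \<open>w \<sim> r powr (1 + 1/\<alpha>)\<close>.

  Let \<open>d\<close> be the distance to the boundary. Since \<open>\<integral> \<phi> = 0\<close>, the convolution \<open>\<phi>\<^sub>j * 1\<^sub>E\<close> decays like
  \<open>(1 + 2\<^sup>j d)\<close> to any negative power, so the expression under the integral of the norm is bounded by
  \<open>d powr (- s p)\<close>. Averaging over a coil turns this into \<open>w powr (- s p)\<close>, whose integral over a cube
  of side \<open>R \<le> 1\<close> is at most of order \<open>R powr (2 - s p (1 + 1/\<alpha>))\<close>, the worst cubes being those at the
  origin. Conversely, near the first coordinate axis and at scales much smaller than \<open>w\<close> the set looks
  like a half-plane. The functions \<open>\<phi>\<^sub>j * 1\<^sub>E\<close> are therefore bounded below on sets of measure
  \<open>\<sim> r 2\<^sup>-\<^sup>j\<close> next to each coil, because the Fourier transform of \<open>\<phi>\<close> does not vanish at the first unit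
  vector. Summing over the scales \<open>j\<close> at one coil excludes \<open>s = 1/p\<close>, and summing over the coils at the
  scale of their width gives the remaining conditions.\<close>


subsection \<open>Averages against Schwartz functions\<close>

text \<open>All exponents come from one count. By r = u^(-\<alpha>), a turn at parameter u has width
  of order u^(-\<alpha>-1) and length of order u^(-\<alpha>). The k-th turn, tested at the scale of
  its own width, contributes a multiple of k^((\<alpha>+1)sp - 2\<alpha> - 1) to the p-th power of
  the norm. Convergence of this series is the strict condition on s; comparing its tail from K on
  with what |P|^\<tau> allows for a cube P at the origin of side about K^(-\<alpha>) is the
  condition with \<tau>. The kernel of level 0 has nonzero mean, so at that level the decay fails
  inside the spiral; far from the spiral an integrable tail takes the place of the power of d. The
  l^q norm over the levels is bounded above by an l^1 sum and below by a single level. Away from s =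
  1/p this loses only constants, because the levels fall off geometrically on both sides of a
  critical one. At s = 1/p all fine levels at one coil contribute equally, and a geometric sum lets
  the finest level present at a point pay for the coarser ones.\<close>

lemma schwartz_iterated_differentiable:
  "f \<in> schwartz \<Longrightarrow> iterated_deriv \<beta> f differentiable (at x)"
  by (simp add: schwartz_def)

lemma schwartz_continuous_on: "f \<in> schwartz \<Longrightarrow> continuous_on A f"
  using schwartz_iterated_differentiable[of f "[]"]
  by (auto intro!: continuous_at_imp_continuous_on differentiable_imp_continuous_within)

lemma schwartz_borel_measurable: "f \<in> schwartz \<Longrightarrow> f \<in> borel_measurable borel"
  by (intro borel_measurable_continuous_onI schwartz_continuous_on)

lemma schwartz_iterated_decay:
  assumes "f \<in> schwartz"
  obtains C where "C > 0" "\<And>x. (1 + norm x) ^ N * norm (iterated_deriv \<beta> f x) \<le> C"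
proof -
  have "bounded (range (\<lambda>x. (1 + norm x) ^ N *\<^sub>R iterated_deriv \<beta> f x))"
    using assms by (simp add: schwartz_def)
  then obtain C where "C > 0" "\<And>x. norm ((1 + norm x) ^ N *\<^sub>R iterated_deriv \<beta> f x) \<le> C"
    by (auto simp: bounded_pos)
  moreover have "norm ((1 + norm x) ^ N *\<^sub>R v) = (1 + norm x) ^ N * norm v" for x :: "real^'a" and v :: complex
    by (simp add: add_nonneg_nonneg)
  ultimately show ?thesis
    using that by metis
qed

lemma schwartz_decay:
  assumes "f \<in> schwartz"
  obtains C where "C > 0" "\<And>x. norm (f x) \<le> C / (1 + norm x) ^ N"
proof -
  obtain C where "C > 0" "\<And>x. (1 + norm x) ^ N * norm (iterated_deriv [] f x) \<le> C"
    using schwartz_iterated_decay[OF assms] by metis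
  moreover have "(1 + norm x) ^ N > 0" for x :: "real^'a"
    by (simp add: add_pos_nonneg)
  ultimately show ?thesis
    using that[of C] by (simp add: pos_le_divide_eq mult.commute)
qed

text \<open>The map y to c(a - y) contains both the reflection in \<open>f (x - y)\<close> and the
  dilation in \<open>resolution\<close>, so this one substitution suffices to see that convolutions
  evaluate the functional at Schwartz functions.\<close>

lemma partial_deriv_affine:
  fixes g :: "real^'n::finite \<Rightarrow> complex"
  assumes "g differentiable (at (c *\<^sub>R (a - x)))"
  shows "((\<lambda>y. K * g (c *\<^sub>R (a - y))) differentiable (at x))"
    and "partial_deriv i (\<lambda>y. K * g (c *\<^sub>R (a - y))) x
       = K * of_real (- c) * partial_deriv i g (c *\<^sub>R (a - x))"
proof -
  let ?g' = "frechet_derivative g (at (c *\<^sub>R (a - x)))"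
  have g: "(g has_derivative ?g') (at (c *\<^sub>R (a - x)))"
    using assms frechet_derivative_works by blast
  have "((\<lambda>y. c *\<^sub>R (a - y)) has_derivative (\<lambda>v. - c *\<^sub>R v)) (at x)"
    by (auto intro!: derivative_eq_intros)
  from has_derivative_compose[OF this g]
  have *: "((\<lambda>y. K * g (c *\<^sub>R (a - y))) has_derivative (\<lambda>v. K * ?g' (- c *\<^sub>R v))) (at x)"
    by (rule has_derivative_mult_right)
  then show "((\<lambda>y. K * g (c *\<^sub>R (a - y))) differentiable (at x))"
    by (rule differentiableI)
  have lin: "linear ?g'"
    using g has_derivative_linear by blast
  have "partial_deriv i (\<lambda>y. K * g (c *\<^sub>R (a - y))) x = K * ?g' (- c *\<^sub>R axis i 1)"
    unfolding partial_deriv_def using frechet_derivative_at[OF *] by metis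
  also have "\<dots> = K * of_real (- c) * partial_deriv i g (c *\<^sub>R (a - x))"
    unfolding partial_deriv_def using linear_scale[OF lin, of "- c"]
    by (simp add: scaleR_conv_of_real)
  finally show "partial_deriv i (\<lambda>y. K * g (c *\<^sub>R (a - y))) x
       = K * of_real (- c) * partial_deriv i g (c *\<^sub>R (a - x))" .
qed

lemma iterated_deriv_affine:
  assumes "f \<in> schwartz"
  shows "iterated_deriv \<beta> (\<lambda>y. K * f (c *\<^sub>R (a - y)))
    = (\<lambda>y. K * of_real (- c) ^ length \<beta> * iterated_deriv \<beta> f (c *\<^sub>R (a - y)))"
proof (induction \<beta>)
  case (Cons i \<beta>)
  show ?case
    using partial_deriv_affine(2)[OF schwartz_iterated_differentiable[OF assms, of \<beta>],
        where K = "K * of_real (- c) ^ length \<beta>"]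
    by (auto simp: Cons.IH fun_eq_iff)
qed simp

lemma schwartz_affine:
  assumes f: "f \<in> schwartz" and c: "c > 0"
  shows "(\<lambda>y. K * f (c *\<^sub>R (a - y))) \<in> schwartz"
  unfolding schwartz_def
proof (intro CollectI conjI allI)
  fix \<beta> x
  show "iterated_deriv \<beta> (\<lambda>y. K * f (c *\<^sub>R (a - y))) differentiable (at x)"
    unfolding iterated_deriv_affine[OF f]
    by (rule partial_deriv_affine(1)[OF schwartz_iterated_differentiable[OF f]])
next
  fix \<beta> N
  obtain C where C: "C > 0" "\<And>x. (1 + norm x) ^ N * norm (iterated_deriv \<beta> f x) \<le> C"
    using schwartz_iterated_decay[OF f] by metis
  \<comment> \<open>Chosen so that 1 + |y| is at most B(1 + |c(a - y)|); a polynomial weight in y is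
    thereby controlled by the same weight at the substituted point.\<close>
  define B where "B = 1 + norm a + 1 / c"
  have B: "B > 0" using c by (simp add: B_def add_pos_nonneg)
  let ?k = "K * of_real (- c) ^ length \<beta>"
  have "norm ((1 + norm y) ^ N *\<^sub>R iterated_deriv \<beta> (\<lambda>y. K * f (c *\<^sub>R (a - y))) y)
      \<le> norm ?k * B ^ N * C" for y
  proof -
    let ?z = "c *\<^sub>R (a - y)"
    have "norm y \<le> norm a + norm (a - y)"
      by (metis add.commute norm_minus_commute norm_triangle_sub)
    moreover have "norm ?z = c * norm (a - y)"
      using c by simp
    ultimately have "1 + norm y \<le> 1 + norm a + norm ?z / c"
      using c by simp
    also have "\<dots> \<le> B * (1 + norm ?z)"
      using c by (simp add: B_def algebra_simps)
    finally have "(1 + norm y) ^ N \<le> (B * (1 + norm ?z)) ^ N"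
      by (intro power_mono) auto
    then have "(1 + norm y) ^ N * norm (iterated_deriv \<beta> f ?z)
        \<le> (B * (1 + norm ?z)) ^ N * norm (iterated_deriv \<beta> f ?z)"
      by (intro mult_right_mono) auto
    also have "\<dots> = B ^ N * ((1 + norm ?z) ^ N * norm (iterated_deriv \<beta> f ?z))"
      by (simp add: power_mult_distrib mult_ac)
    also have "\<dots> \<le> B ^ N * C"
      using B by (intro mult_left_mono C(2)) auto
    finally have "norm ?k * ((1 + norm y) ^ N * norm (iterated_deriv \<beta> f ?z)) \<le> norm ?k * (B ^ N * C)"
      by (intro mult_left_mono) auto
    moreover have "norm ((1 + norm y) ^ N *\<^sub>R iterated_deriv \<beta> (\<lambda>y. K * f (c *\<^sub>R (a - y))) y)
       = norm ?k * ((1 + norm y) ^ N * norm (iterated_deriv \<beta> f ?z))"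
      unfolding iterated_deriv_affine[OF f] by (simp add: norm_mult)
    ultimately show ?thesis by (simp only: mult.assoc)
  qed
  then show "bounded (range (\<lambda>x. (1 + norm x) ^ N *\<^sub>R iterated_deriv \<beta> (\<lambda>y. K * f (c *\<^sub>R (a - y))) x))"
    unfolding bounded_iff by blast
qed

text \<open>Dyadic shells: where 1 + |x| lies between 2^(i-1) and 2^i, the integrand is at most
  2^(n+1) 2^(-i(n+1)), while the ball of radius 2^i has volume of order 2^(in). The i-th shell
  contributes a multiple of 2^(-i).\<close>

lemma nn_integral_decay_finite:
  "(\<integral>\<^sup>+(x::'a::euclidean_space). ennreal (1 / (1 + norm x) ^ Suc DIM('a)) \<partial>lborel) < \<infinity>"
proof -
  define n where "n = DIM('a)"
  define V where "V = unit_ball_vol (real n)"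
  have V: "V \<ge> 0" by (simp add: V_def)
  define f where "f i x = ennreal (2 ^ Suc n / (2 ^ Suc n) ^ i) * indicator (ball (0::'a) (2 ^ i)) x"
    for i :: nat and x
  have le: "ennreal (1 / (1 + norm x) ^ Suc n) \<le> (\<Sum>i. f i x)" for x :: 'a
  proof -
    obtain m where m: "1 + norm x < 2 ^ m"
      using real_arch_pow[of 2 "1 + norm x"] by auto
    define i where "i = (LEAST m. 1 + norm x < 2 ^ m)"
    have i: "1 + norm x < 2 ^ i" unfolding i_def using m by (rule LeastI)
    have "i \<noteq> 0"
    proof
      assume "i = 0" then have "1 + norm x < 1" using i by simp
      then show False by simp
    qed
    then obtain k where k: "i = Suc k" by (cases i) auto
    have "\<not> 1 + norm x < 2 ^ k"
      using not_less_Least[of k "\<lambda>m. 1 + norm x < 2 ^ m"] k i_def by auto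
    then have "2 ^ i \<le> 2 * (1 + norm x)" using k by simp
    then have "(2 ^ i) ^ Suc n \<le> (2 * (1 + norm x)) ^ Suc n"
      by (intro power_mono) auto
    then have *: "(2 ^ i) ^ Suc n \<le> 2 ^ Suc n * (1 + norm x) ^ Suc n"
      unfolding power_mult_distrib .
    have "(2 ^ i) ^ Suc n = ((2 ^ Suc n) ^ i :: real)"
      by (metis mult.commute power_mult)
    then have "1 / (1 + norm x) ^ Suc n \<le> 2 ^ Suc n / (2 ^ Suc n) ^ i"
      using * by (subst frac_le_eq) (auto simp: divide_le_0_iff add_nonneg_eq_0_iff simp del: power_Suc)
    then have "ennreal (1 / (1 + norm x) ^ Suc n) \<le> ennreal (2 ^ Suc n / (2 ^ Suc n) ^ i)"
      by (rule ennreal_leI)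
    also have "\<dots> = f i x"
      using i by (simp add: f_def del: power_Suc)
    also have "\<dots> \<le> (\<Sum>i. f i x)"
      using sum_le_suminf[of "\<lambda>i. f i x" "{i}"] by simp
    finally show ?thesis .
  qed
  have "(\<integral>\<^sup>+(x::'a). ennreal (1 / (1 + norm x) ^ Suc n) \<partial>lborel) \<le> (\<integral>\<^sup>+x. (\<Sum>i. f i x) \<partial>lborel)"
    by (intro nn_integral_mono le)
  also have "\<dots> = (\<Sum>i. \<integral>\<^sup>+x. f i x \<partial>lborel)"
    unfolding f_def
    by (intro nn_integral_suminf borel_measurable_times_ennreal borel_measurable_const
        borel_measurable_indicator) auto
  also have "\<dots> = (\<Sum>i. ennreal (2 ^ Suc n * V * (1 / 2) ^ i))"
  proof (intro suminf_cong)
    fix i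
    have "(\<integral>\<^sup>+x. f i x \<partial>lborel) = ennreal (2 ^ Suc n / (2 ^ Suc n) ^ i) * ennreal (V * (2 ^ i) ^ n)"
      unfolding f_def by (simp add: nn_integral_cmult_indicator emeasure_ball n_def V_def)
    also have "\<dots> = ennreal (2 ^ Suc n / (2 ^ Suc n) ^ i * (V * (2 ^ i) ^ n))"
      using V by (intro ennreal_mult[symmetric]) auto
    also have "2 ^ Suc n / (2 ^ Suc n) ^ i * (V * (2 ^ i) ^ n) = 2 ^ Suc n * V * (1 / 2) ^ i"
    proof -
      have "(2 ^ Suc n) ^ i = (2 ^ i * (2 ^ i) ^ n :: real)"
        by (metis mult.commute power_Suc power_mult)
      then show ?thesis by (simp add: power_one_over del: power_Suc)
    qed
    finally show "(\<integral>\<^sup>+x. f i x \<partial>lborel) = ennreal (2 ^ Suc n * V * (1 / 2) ^ i)" .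
  qed
  also have "\<dots> = ennreal (\<Sum>i. 2 ^ Suc n * V * (1 / 2) ^ i)"
    using V by (intro suminf_ennreal2) (auto intro!: summable_mult)
  finally show ?thesis
    unfolding n_def by (simp add: order_le_less_trans)
qed

lemma schwartz_moment_integrable:
  fixes f :: "real^'n::finite \<Rightarrow> complex"
  assumes f: "f \<in> schwartz"
  shows "integrable lborel (\<lambda>z. (1 + norm z) ^ N * norm (f z))"
proof -
  define n where "n = Suc DIM(real^'n)"
  obtain C where C: "C > 0" "\<And>x. norm (f x) \<le> C / (1 + norm x) ^ (N + n)"
    using schwartz_decay[OF f] by metis
  have "integrable lborel (\<lambda>z::real^'n. C * (1 / (1 + norm z) ^ n))"
  proof (intro integrable_mult_right integrableI_bounded)
    have "(\<integral>\<^sup>+(x::real^'n). ennreal (norm (1 / (1 + norm x) ^ n)) \<partial>lborel)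
        = (\<integral>\<^sup>+(x::real^'n). ennreal (1 / (1 + norm x) ^ Suc DIM(real^'n)) \<partial>lborel)"
      by (intro nn_integral_cong) (auto simp: n_def simp del: power_Suc)
    then show "(\<integral>\<^sup>+(x::real^'n). ennreal (norm (1 / (1 + norm x) ^ n)) \<partial>lborel) < \<infinity>"
      using nn_integral_decay_finite[where 'a="real^'n"] by simp
  qed measurable
  then show ?thesis
  proof (rule Bochner_Integration.integrable_bound)
    show "(\<lambda>z. (1 + norm z) ^ N * norm (f z)) \<in> borel_measurable lborel"
      using schwartz_borel_measurable[OF f] by measurable
    show "AE z in lborel. norm ((1 + norm z) ^ N * norm (f z)) \<le> norm (C * (1 / (1 + norm z) ^ n))"
    proof (intro AE_I2)
      fix z :: "real^'n"
      have pos: "(1 + norm z) ^ k > 0" for k by (simp add: add_pos_nonneg)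
      have nz: "1 + norm z \<noteq> 0" using norm_ge_zero[of z] by linarith
      have "(1 + norm z) ^ N * norm (f z) \<le> (1 + norm z) ^ N * (C / (1 + norm z) ^ (N + n))"
        using pos[of N] C by (intro mult_left_mono) auto
      also have "\<dots> = C * (1 / (1 + norm z) ^ n)"
        using nz by (simp add: power_add)
      finally show "norm ((1 + norm z) ^ N * norm (f z)) \<le> norm (C * (1 / (1 + norm z) ^ n))"
        using pos[of N] C(1) by (simp add: abs_mult)
    qed
  qed
qed

lemma schwartz_integrable: "f \<in> schwartz \<Longrightarrow> integrable lborel f"
  using schwartz_moment_integrable[of f 0] schwartz_borel_measurable[of f]
  by (auto simp: integrable_norm_iff)

lemma resolution_schwartz:
  assumes "\<phi>\<^sub>0 \<in> schwartz" "\<phi> \<in> schwartz"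
  shows "(\<lambda>y. resolution \<phi>\<^sub>0 \<phi> j (x - y)) \<in> schwartz"
proof (cases "j = 0")
  case True
  then show ?thesis
    using schwartz_affine[OF assms(1), of 1 1 x] by (simp add: resolution_def)
next
  case False
  then show ?thesis
    using schwartz_affine[OF assms(2), of "2 ^ j"] by (simp add: resolution_def)
qed

section \<open>Convolutions of indicator functions as averages over a rescaled set\<close>

lemma lborel_integral_affine:
  fixes f :: "'a::euclidean_space \<Rightarrow> 'b::{banach, second_countable_topology}"
  assumes "c \<noteq> 0" "f \<in> borel_measurable borel"
  shows "(\<integral>x. f x \<partial>lborel) = \<bar>c\<bar> ^ DIM('a) *\<^sub>R (\<integral>x. f (t + c *\<^sub>R x) \<partial>lborel)"
  using assms(2)
  by (subst lborel_affine[OF assms(1), of t]) (simp add: integral_density integral_distr)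

text \<open>This is the convolution of h^(-n) \<psi>(./h) with the indicator of S after substituting
  y = x - hz. The kernel stays fixed and only the set is rescaled, which makes constants uniform in
  the scale h.\<close>

definition kernel_avg :: "('a::euclidean_space \<Rightarrow> complex) \<Rightarrow> real \<Rightarrow> 'a set \<Rightarrow> 'a \<Rightarrow> complex" where
  "kernel_avg \<psi> h S x = (\<integral>z. indicator S (x - h *\<^sub>R z) * \<psi> z \<partial>lborel)"

text \<open>The substitution y = x - 2^(-j) z cancels the factor 2^(jn) of the dilated kernel. Level
  0 has scale 1, so both kernels fit the same formula.\<close>

lemma convolution_regular_indicator:
  fixes \<phi>\<^sub>0 \<phi> :: "real^'n::finite \<Rightarrow> complex"
  assumes "\<phi>\<^sub>0 \<in> schwartz" "\<phi> \<in> schwartz" and S: "S \<in> sets borel"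
  shows "convolution (resolution \<phi>\<^sub>0 \<phi> j) (regular_distribution (indicator S)) x
    = kernel_avg (if j = 0 then \<phi>\<^sub>0 else \<phi>) (1 / 2 ^ j) S x"
proof -
  define \<psi> where "\<psi> = (if j = 0 then \<phi>\<^sub>0 else \<phi>)"
  have \<psi>[measurable]: "\<psi> \<in> borel_measurable borel"
    using assms schwartz_borel_measurable by (auto simp: \<psi>_def)
  have S'[measurable]: "S \<in> sets borel" by fact
  have r: "resolution \<phi>\<^sub>0 \<phi> j y = 2 ^ (j * CARD('n)) * \<psi> (2 ^ j *\<^sub>R y)" for y
    by (simp add: resolution_def \<psi>_def)
  let ?f = "\<lambda>y. indicator S y * (2 ^ (j * CARD('n)) * \<psi> (2 ^ j *\<^sub>R (x - y))) :: complex"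
  have "convolution (resolution \<phi>\<^sub>0 \<phi> j) (regular_distribution (indicator S)) x = (\<integral>y. ?f y \<partial>lebesgue)"
    unfolding convolution_def regular_distribution_def
    using resolution_schwartz[OF assms(1,2), of j x] by (simp add: r)
  also have "\<dots> = (\<integral>y. ?f y \<partial>lborel)"
    by (intro integral_completion) measurable
  also have "\<dots> = \<bar>- (1 / 2 ^ j)\<bar> ^ DIM(real^'n) *\<^sub>R (\<integral>z. ?f (x + (- (1 / 2 ^ j)) *\<^sub>R z) \<partial>lborel)"
    by (intro lborel_integral_affine) auto
  also have "\<dots> = (1 / 2 ^ j) ^ CARD('n) *\<^sub>R (\<integral>z. 2 ^ (j * CARD('n)) * (indicator S (x - (1 / 2 ^ j) *\<^sub>R z) * \<psi> z) \<partial>lborel)"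
    by (simp add: mult_ac)
  also have "\<dots> = (\<integral>z. indicator S (x - (1 / 2 ^ j) *\<^sub>R z) * \<psi> z \<partial>lborel)"
    by (simp add: scaleR_conv_of_real power_mult power_one_over)
  finally show ?thesis by (simp add: kernel_avg_def \<psi>_def)
qed

lemma kernel_avg_integrable:
  fixes \<psi> :: "'a::euclidean_space \<Rightarrow> complex"
  assumes "integrable lborel \<psi>" and [measurable]: "S \<in> sets borel"
  shows "integrable lborel (\<lambda>z. indicator S (x - h *\<^sub>R z) * \<psi> z)"
  using assms(1)
proof (rule Bochner_Integration.integrable_bound)
  have [measurable]: "\<psi> \<in> borel_measurable borel"
    using assms(1) by auto
  show "(\<lambda>z. indicator S (x - h *\<^sub>R z) * \<psi> z) \<in> borel_measurable lborel"
    by measurable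
qed (auto simp: indicator_def)

text \<open>A kernel of mean zero annihilates constants, and the two indicators add up to 1. This
  transfers the decay from points outside a set to points inside it.\<close>

lemma kernel_avg_Compl:
  assumes \<psi>: "integrable lborel \<psi>" and S: "S \<in> sets borel" and 0: "(\<integral>z. \<psi> z \<partial>lborel) = 0"
  shows "kernel_avg \<psi> h (- S) x = - kernel_avg \<psi> h S x"
proof -
  have "kernel_avg \<psi> h (- S) x = (\<integral>z. \<psi> z - indicator S (x - h *\<^sub>R z) * \<psi> z \<partial>lborel)"
    unfolding kernel_avg_def by (intro Bochner_Integration.integral_cong) (auto simp: indicator_def)
  also have "\<dots> = (\<integral>z. \<psi> z \<partial>lborel) - kernel_avg \<psi> h S x"
    unfolding kernel_avg_def
    by (intro Bochner_Integration.integral_diff \<psi> kernel_avg_integrable S)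
  finally show ?thesis using 0 by simp
qed

text \<open>A Chebyshev estimate: only z with |z| \<ge> d/h meet the set, and there the weight (1 +
  |z|)^N / (1 + d/h)^N is at least 1.\<close>

lemma kernel_avg_bound_disjoint:
  fixes \<psi> :: "real^'n::finite \<Rightarrow> complex"
  assumes \<psi>: "\<psi> \<in> schwartz" and S: "S \<in> sets borel" and h: "h > 0" and d: "d \<ge> 0"
    and disj: "ball x d \<inter> S = {}"
  shows "norm (kernel_avg \<psi> h S x) \<le> (\<integral>z. (1 + norm z) ^ N * norm (\<psi> z) \<partial>lborel) / (1 + d / h) ^ N"
proof -
  have "norm (kernel_avg \<psi> h S x) \<le> (\<integral>z. norm (indicator S (x - h *\<^sub>R z) * \<psi> z) \<partial>lborel)"
    unfolding kernel_avg_def by (rule integral_norm_bound)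
  also have "\<dots> \<le> (\<integral>z. (1 + norm z) ^ N * norm (\<psi> z) / (1 + d / h) ^ N \<partial>lborel)"
  proof (intro integral_mono)
    show "integrable lborel (\<lambda>z. norm (indicator S (x - h *\<^sub>R z) * \<psi> z))"
      by (intro integrable_norm kernel_avg_integrable S schwartz_integrable \<psi>)
    show "integrable lborel (\<lambda>z. (1 + norm z) ^ N * norm (\<psi> z) / (1 + d / h) ^ N)"
      by (intro integrable_divide schwartz_moment_integrable \<psi>)
    fix z
    have pos: "1 + d / h > 0" using d h by (simp add: add_pos_nonneg)
    show "norm (indicator S (x - h *\<^sub>R z) * \<psi> z) \<le> (1 + norm z) ^ N * norm (\<psi> z) / (1 + d / h) ^ N"
    proof (cases "x - h *\<^sub>R z \<in> S")
      case True
      then have "d \<le> dist x (x - h *\<^sub>R z)"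
        using disj by (meson disjoint_iff mem_ball not_less)
      then have "d / h \<le> norm z"
        using h by (simp add: dist_norm pos_divide_le_eq mult.commute)
      then have "(1 + d / h) ^ N \<le> (1 + norm z) ^ N"
        using pos by (intro power_mono) auto
      then have "norm (\<psi> z) * (1 + d / h) ^ N \<le> (1 + norm z) ^ N * norm (\<psi> z)"
        by (subst mult.commute) (intro mult_right_mono, auto)
      then show ?thesis
        using True pos by (simp add: pos_le_divide_eq)
    next
      case False
      then show ?thesis using pos by (simp add: add_nonneg_nonneg less_imp_le)
    qed
  qed
  finally show ?thesis by simp
qed

lemma kernel_avg_bound_subset:
  fixes \<psi> :: "real^'n::finite \<Rightarrow> complex"
  assumes \<psi>: "\<psi> \<in> schwartz" and S: "S \<in> sets borel" and h: "h > 0" and d: "d \<ge> 0"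
    and 0: "(\<integral>z. \<psi> z \<partial>lborel) = 0" and sub: "ball x d \<subseteq> S"
  shows "norm (kernel_avg \<psi> h S x) \<le> (\<integral>z. (1 + norm z) ^ N * norm (\<psi> z) \<partial>lborel) / (1 + d / h) ^ N"
proof -
  have "norm (kernel_avg \<psi> h (- S) x) \<le> (\<integral>z. (1 + norm z) ^ N * norm (\<psi> z) \<partial>lborel) / (1 + d / h) ^ N"
    using sub S by (intro kernel_avg_bound_disjoint \<psi> h d) auto
  then show ?thesis
    using kernel_avg_Compl[OF schwartz_integrable[OF \<psi>] S 0] by simp
qed

text \<open>The case d = 0: the ball is empty and the denominator is 1. The moment of order N is
  kept on the right so that the constant is the same as in the decay estimates.\<close>

lemma kernel_avg_bound:
  fixes \<psi> :: "real^'n::finite \<Rightarrow> complex"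
  assumes "\<psi> \<in> schwartz" "S \<in> sets borel" "h > 0"
  shows "norm (kernel_avg \<psi> h S x) \<le> (\<integral>z. (1 + norm z) ^ N * norm (\<psi> z) \<partial>lborel)"
proof -
  have "ball x 0 \<inter> S = {}" by simp
  from kernel_avg_bound_disjoint[OF assms order_refl this, of N] show ?thesis
    by (simp only: div_0 add_0_right power_one div_by_1)
qed

section \<open>Two consequences of the Fourier conditions: vanishing mean and a half-space that the
  kernel detects\<close>

lemma fourier_zero_integral:
  fixes \<phi> :: "real^'n::finite \<Rightarrow> complex"
  assumes "supp (fourier \<phi>) \<subseteq> {\<xi>. 1 / 2 \<le> norm \<xi> \<and> norm \<xi> \<le> 2}"
  shows "(\<integral>z. \<phi> z \<partial>lborel) = 0"
proof -
  have "fourier \<phi> 0 = 0"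
  proof (rule ccontr)
    assume "fourier \<phi> 0 \<noteq> 0"
    then have "0 \<in> supp (fourier \<phi>)"
      unfolding supp_def using closure_subset[of "{x. fourier \<phi> x \<noteq> 0}"] by (auto simp del: mem_Collect_eq simp: subset_iff)
    then show False using subsetD[OF assms, of 0] by simp
  qed
  then show ?thesis by (simp add: fourier_def)
qed

text \<open>If all half-space integrals vanish, so do the integrals over slabs; approximating the
  character by functions that are constant on thin slabs then shows that the Fourier transform
  vanishes at \<open>axis i 1\<close>.\<close>

lemma exists_halfspace_integral_nonzero:
  fixes \<phi> :: "real^'n::finite \<Rightarrow> complex"
  assumes int: "integrable lborel \<phi>" and F: "fourier \<phi> (axis i 1) \<noteq> 0"
  shows "\<exists>t. (\<integral>z. indicator {z. z $ i > t} z * \<phi> z \<partial>lborel) \<noteq> 0"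
proof (rule ccontr)
  assume "\<not> ?thesis"
  then have half: "(\<integral>z. indicator {z. z $ i > t} z * \<phi> z \<partial>lborel) = 0" for t
    by blast
  have [measurable]: "\<phi> \<in> borel_measurable borel"
    using int by auto
  have int': "integrable lborel (\<lambda>z. indicator {z. P z} z * \<phi> z)"
    if [measurable]: "Measurable.pred borel P" for P
    by (rule Bochner_Integration.integrable_bound[OF int]) (auto simp: indicator_def)
  have slab: "(\<integral>z. indicator {z. a < z $ i \<and> z $ i \<le> b} z * \<phi> z \<partial>lborel) = 0" if "a \<le> b" for a b
  proof -
    have "(\<integral>z. indicator {z. a < z $ i \<and> z $ i \<le> b} z * \<phi> z \<partial>lborel)
        = (\<integral>z. indicator {z. z $ i > a} z * \<phi> z - indicator {z. z $ i > b} z * \<phi> z \<partial>lborel)"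
      using that by (intro Bochner_Integration.integral_cong) (auto simp: indicator_def)
    also have "\<dots> = 0"
      by (subst Bochner_Integration.integral_diff) (auto intro!: int' simp: half)
    finally show ?thesis .
  qed
  \<comment> \<open>The slabs of thickness 1/n cover -n < z_i \<le> n, hence 2n^2 of them; on each
    the character is frozen at the value of the lower edge.\<close>
  define step where "step n z = (\<Sum>k\<in>{- int (n * n)..<int (n * n)}.
      cis (- (real_of_int k / n)) * indicator {z. real_of_int k / n < z $ i \<and> z $ i \<le> (real_of_int k + 1) / n} z)"
    for n :: nat and z :: "real^'n"
  have step_eq: "step n z = cis (- (real_of_int (\<lceil>n * z $ i\<rceil> - 1) / n))"
    if n: "n > 0" "\<bar>z $ i\<bar> < n" for n z
  proof -
    \<comment> \<open>Slabs are open below and closed above, so the one containing z has the index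
      of the ceiling minus one, also when n z_i is an integer.\<close>
    let ?k = "\<lceil>n * z $ i\<rceil> - 1"
    have *: "(real_of_int k / n < z $ i \<and> z $ i \<le> (real_of_int k + 1) / n) \<longleftrightarrow> k = ?k" for k
    proof -
      have "(real_of_int k / n < z $ i \<and> z $ i \<le> (real_of_int k + 1) / n)
          \<longleftrightarrow> (real_of_int k < n * z $ i \<and> n * z $ i \<le> real_of_int k + 1)"
        using n by (simp add: pos_divide_less_eq pos_le_divide_eq mult.commute)
      also have "\<dots> \<longleftrightarrow> k = ?k" by linarith
      finally show ?thesis .
    qed
    have "\<bar>n * z $ i\<bar> < real n * real n"
      using n by (simp add: abs_mult)
    then have "- int (n * n) < \<lceil>n * z $ i\<rceil>" "\<lceil>n * z $ i\<rceil> \<le> int (n * n)"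
      unfolding less_ceiling_iff ceiling_le_iff by (auto simp: abs_less_iff)
    then have k: "?k \<in> {- int (n * n)..<int (n * n)}"
      unfolding atLeastLessThan_iff by linarith
    then have "step n z = (\<Sum>k\<in>{- int (n * n)..<int (n * n)}. if k = ?k then cis (- (real_of_int k / n)) else 0)"
      unfolding step_def by (intro sum.cong) (auto simp: indicator_def *)
    also have "\<dots> = cis (- (real_of_int ?k / n))"
      using k by simp
    finally show ?thesis .
  qed
  have step_norm: "norm (step n z) \<le> 1" for n z
  proof (cases "n > 0 \<and> \<bar>z $ i\<bar> < n")
    case True
    then show ?thesis by (simp add: step_eq)
  next
    case False
    \<comment> \<open>The edge z_i = n still belongs to the last slab. Domination is wanted at every
      z, so here the bound is read off from the slabs being disjoint.\<close>
    show ?thesis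
    proof (cases "\<exists>k\<in>{- int (n * n)..<int (n * n)}. real_of_int k / n < z $ i \<and> z $ i \<le> (real_of_int k + 1) / n")
      case True
      then obtain k where k: "k\<in>{- int (n * n)..<int (n * n)}"
        "real_of_int k / n < z $ i" "z $ i \<le> (real_of_int k + 1) / n" by blast
      then have n: "n > 0" by (cases n) auto
      have u: "k' = k" if "real_of_int k' / n < z $ i" "z $ i \<le> (real_of_int k' + 1) / n" for k'
      proof -
        have "real_of_int k' < real_of_int k + 1" "real_of_int k < real_of_int k' + 1"
          using less_le_trans[OF that(1) k(3)] less_le_trans[OF k(2) that(2)] n
          by (simp_all add: divide_less_cancel)
        then show ?thesis by linarith
      qed
      have "step n z = (\<Sum>k'\<in>{- int (n * n)..<int (n * n)}. if k' = k then cis (- (real_of_int k' / n)) else 0)"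
        unfolding step_def
      proof (intro sum.cong refl)
        fix k'
        show "cis (- (real_of_int k' / n)) * indicator {z. real_of_int k' / n < z $ i \<and> z $ i \<le> (real_of_int k' + 1) / n} z
          = (if k' = k then cis (- (real_of_int k' / n)) else 0)"
          using u[of k'] k by (cases "k' = k") (auto simp: indicator_def)
      qed
      also have "norm \<dots> \<le> 1" using k by simp
      finally show ?thesis .
    next
      case False
      then have "step n z = 0"
        unfolding step_def by (intro sum.neutral) (auto simp: indicator_def)
      then show ?thesis by simp
    qed
  qed
  have [measurable]: "step n \<in> borel_measurable borel" for n
    unfolding step_def by measurable
  have step_int: "(\<integral>z. step n z * \<phi> z \<partial>lborel) = 0" for n
  proof -
    have "(\<integral>z. step n z * \<phi> z \<partial>lborel)
      = (\<integral>z. (\<Sum>k\<in>{- int (n * n)..<int (n * n)}. cis (- (real_of_int k / n)) *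
          (indicator {z. real_of_int k / n < z $ i \<and> z $ i \<le> (real_of_int k + 1) / n} z * \<phi> z)) \<partial>lborel)"
      by (simp only: step_def sum_distrib_right mult.assoc)
    also have "\<dots> = (\<Sum>k\<in>{- int (n * n)..<int (n * n)}. cis (- (real_of_int k / n)) *
          (\<integral>z. indicator {z. real_of_int k / n < z $ i \<and> z $ i \<le> (real_of_int k + 1) / n} z * \<phi> z \<partial>lborel))"
      by (subst Bochner_Integration.integral_sum) (auto intro!: int')
    also have "\<dots> = 0"
      by (intro sum.neutral) (auto intro!: slab divide_right_mono)
    finally show ?thesis .
  qed
  have "(\<lambda>n. \<integral>z. step n z * \<phi> z \<partial>lborel) \<longlonglongrightarrow> (\<integral>z. cis (- (z $ i)) * \<phi> z \<partial>lborel)"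
  proof (rule integral_dominated_convergence[where w="\<lambda>z. norm (\<phi> z)"])
    show "integrable lborel (\<lambda>z. norm (\<phi> z))" using int by simp
    show "AE z in lborel. norm (step n z * \<phi> z) \<le> norm (\<phi> z)" for n
      by (intro AE_I2) (auto simp: norm_mult intro!: mult_left_le_one_le step_norm)
    show "AE z in lborel. (\<lambda>n. step n z * \<phi> z) \<longlonglongrightarrow> cis (- (z $ i)) * \<phi> z"
    proof (intro AE_I2 tendsto_mult tendsto_const)
      fix z :: "real^'n"
      obtain N :: nat where N: "\<bar>z $ i\<bar> < N" using reals_Archimedean2 by blast
      have ev: "\<forall>\<^sub>F n in sequentially. cis (- (real_of_int (\<lceil>n * z $ i\<rceil> - 1) / n)) = step n z"
        using eventually_gt_at_top[of N]
        by eventually_elim (use N in \<open>simp add: step_eq\<close>)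
      have "(\<lambda>n::nat. real_of_int (\<lceil>n * z $ i\<rceil> - 1) / n - z $ i) \<longlonglongrightarrow> 0"
      proof (rule tendsto_rabs_zero_cancel, rule tendsto_sandwich[OF _ _ tendsto_const lim_inverse_n])
        show "\<forall>\<^sub>F n in sequentially. \<bar>real_of_int (\<lceil>real n * z $ i\<rceil> - 1) / real n - z $ i\<bar> \<le> inverse (real n)"
          using eventually_gt_at_top[of 0]
        proof eventually_elim
          case (elim n)
          have "\<bar>real_of_int (\<lceil>real n * z $ i\<rceil> - 1) / real n - z $ i\<bar>
              = \<bar>real_of_int (\<lceil>real n * z $ i\<rceil> - 1) - n * z $ i\<bar> / n"
            using elim by (simp add: field_simps abs_divide)
          also have "\<dots> \<le> 1 / n"
            using elim by (intro divide_right_mono) (linarith, simp)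
          finally show ?case by (simp add: inverse_eq_divide)
        qed
      qed auto
      then have "(\<lambda>n::nat. real_of_int (\<lceil>n * z $ i\<rceil> - 1) / n) \<longlonglongrightarrow> z $ i"
        by (rule LIM_zero_cancel)
      then have "(\<lambda>n::nat. cis (- (real_of_int (\<lceil>n * z $ i\<rceil> - 1) / n))) \<longlonglongrightarrow> cis (- (z $ i))"
        by (intro tendsto_cis tendsto_minus)
      then show "(\<lambda>n. step n z) \<longlonglongrightarrow> cis (- (z $ i))"
        by (rule Lim_transform_eventually[OF _ ev])
    qed
    have [measurable]: "(\<lambda>z. cis (- z $ i)) \<in> borel_measurable borel"
      by (intro borel_measurable_continuous_onI continuous_intros)
    show "(\<lambda>z. cis (- z $ i) * \<phi> z) \<in> borel_measurable lborel"
      by simp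
    show "(\<lambda>z. step n z * \<phi> z) \<in> borel_measurable lborel" for n
      by simp
  qed
  then have "(\<integral>z. cis (- (z $ i)) * \<phi> z \<partial>lborel) = 0"
    unfolding step_int using LIMSEQ_unique tendsto_const by blast
  then show False
    using F by (simp add: fourier_def inner_axis)
qed

lemma AE_lborel_nth_neq: "AE z in (lborel :: (real^'n::finite) measure). z $ i \<noteq> t"
proof -
  have "negligible {z::real^'n. axis i 1 \<bullet> z = t}"
    by (rule negligible_hyperplane) (auto simp: axis_eq_0_iff)
  moreover have "{z::real^'n. axis i 1 \<bullet> z = t} = {z. z $ i = t}"
    by (simp add: inner_axis')
  moreover have "{z::real^'n. z $ i = t} \<in> sets borel" by measurable
  ultimately have "{z::real^'n. z $ i = t} \<in> null_sets lborel"
    by (simp add: negligible_iff_null_sets null_sets_completion_iff)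
  then show ?thesis
    by (rule AE_I') auto
qed

text \<open>A perturbation argument: if S, seen from x at scale h, agrees with the half-space z_i >
  t outside a thin slab and inside a large ball, the average differs from the half-space integral by
  at most the mass of |\<phi>| on the discrepancy, which is below half of its modulus. The offset t
  is only known to exist, so the points x that satisfy the premises sit at distance about h|t| from
  the boundary.\<close>

lemma kernel_avg_halfspace_lower:
  fixes \<phi> :: "real^'n::finite \<Rightarrow> complex"
  assumes int: "integrable lborel \<phi>" and F: "fourier \<phi> (axis i 1) \<noteq> 0"
  obtains t \<epsilon> M c where "\<epsilon> > 0" "M > 0" "c > 0"
    "\<And>S h x. \<lbrakk>S \<in> sets borel;
       \<And>z. norm z \<le> M \<Longrightarrow> z $ i > t + \<epsilon> \<Longrightarrow> x - h *\<^sub>R z \<in> S;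
       \<And>z. norm z \<le> M \<Longrightarrow> z $ i < t - \<epsilon> \<Longrightarrow> x - h *\<^sub>R z \<notin> S\<rbrakk>
     \<Longrightarrow> norm (kernel_avg \<phi> h S x) \<ge> c"
proof -
  have [measurable]: "\<phi> \<in> borel_measurable borel"
    using int by auto
  have int': "integrable lborel (\<lambda>z. indicator {z. P z} z * \<phi> z)"
    if [measurable]: "Measurable.pred borel P" for P
    by (rule Bochner_Integration.integrable_bound[OF int]) (auto simp: indicator_def)
  obtain t where t: "(\<integral>z. indicator {z. z $ i > t} z * \<phi> z \<partial>lborel) \<noteq> 0"
    using exists_halfspace_integral_nonzero[OF int F] by blast
  define c where "c = norm (\<integral>z. indicator {z. z $ i > t} z * \<phi> z \<partial>lborel) / 2"
  have c: "c > 0" using t by (simp add: c_def)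
  \<comment> \<open>Every z off the hyperplane z_i = t eventually leaves these sets, and the
    hyperplane is null; hence the mass of |\<phi>| on them tends to zero.\<close>
  define bad where "bad n = {z. \<bar>z $ i - t\<bar> \<le> 1 / real n \<or> norm z > n}" for n :: nat
  have [measurable]: "bad n \<in> sets borel" for n
    unfolding bad_def by measurable
  have "(\<lambda>n. \<integral>z. indicator (bad n) z * norm (\<phi> z) \<partial>lborel) \<longlonglongrightarrow> (\<integral>z. 0 \<partial>(lborel :: (real^'n) measure))"
  proof (rule integral_dominated_convergence[where w="\<lambda>z. norm (\<phi> z)"])
    show "AE z in lborel. (\<lambda>n. indicator (bad n) z * norm (\<phi> z)) \<longlonglongrightarrow> 0"
      using AE_lborel_nth_neq[of i t]
    proof eventually_elim
      case (elim z)
      then obtain N1 :: nat where N1: "N1 > 0" "1 / N1 < \<bar>z $ i - t\<bar>"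
        using real_arch_inverse[of "\<bar>z $ i - t\<bar>"] by (auto simp: inverse_eq_divide)
      obtain N2 :: nat where N2: "norm z < N2" using reals_Archimedean2 by blast
      have "\<forall>\<^sub>F n in sequentially. 0 = indicator (bad n) z * norm (\<phi> z)"
        using eventually_ge_at_top[of "max N1 N2"]
      proof eventually_elim
        case (elim n)
        then have "1 / real n \<le> 1 / N1" using N1 by (intro divide_left_mono) auto
        then have "z \<notin> bad n" using N1 N2 elim by (auto simp: bad_def)
        then show ?case by simp
      qed
      then show ?case by (rule Lim_transform_eventually[OF tendsto_const])
    qed
    show "AE z in lborel. norm (indicator (bad n) z * norm (\<phi> z)) \<le> norm (\<phi> z)" for n
      by (intro AE_I2) (auto simp: indicator_def)
  qed (use int in auto)
  then have "(\<lambda>n. \<integral>z. indicator (bad n) z * norm (\<phi> z) \<partial>lborel) \<longlonglongrightarrow> 0" by simp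
  then have "\<forall>\<^sub>F n in sequentially. (\<integral>z. indicator (bad n) z * norm (\<phi> z) \<partial>lborel) < c"
    using c by (rule order_tendstoD)
  then obtain n where n: "n > 0" "(\<integral>z. indicator (bad n) z * norm (\<phi> z) \<partial>lborel) < c"
    using eventually_gt_at_top[of 0]
    by (metis (mono_tags, lifting) eventually_conj eventually_happens' sequentially_bot)
  show thesis
  proof (rule that[of "1 / n" n c t])
    fix S :: "(real^'n) set" and h :: real and x
    assume [measurable]: "S \<in> sets borel"
      and 1: "\<And>z. norm z \<le> n \<Longrightarrow> z $ i > t + 1 / n \<Longrightarrow> x - h *\<^sub>R z \<in> S"
      and 2: "\<And>z. norm z \<le> n \<Longrightarrow> z $ i < t - 1 / n \<Longrightarrow> x - h *\<^sub>R z \<notin> S"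
    let ?H = "\<integral>z. indicator {z. z $ i > t} z * \<phi> z \<partial>lborel"
    have "kernel_avg \<phi> h S x - ?H
      = (\<integral>z. indicator S (x - h *\<^sub>R z) * \<phi> z - indicator {z. z $ i > t} z * \<phi> z \<partial>lborel)"
      unfolding kernel_avg_def
      by (intro Bochner_Integration.integral_diff[symmetric] int' kernel_avg_integrable[OF int]) auto
    also have "norm \<dots> \<le> (\<integral>z. norm (indicator S (x - h *\<^sub>R z) * \<phi> z - indicator {z. z $ i > t} z * \<phi> z) \<partial>lborel)"
      by (rule integral_norm_bound)
    also have "\<dots> \<le> (\<integral>z. indicator (bad n) z * norm (\<phi> z) \<partial>lborel)"
    proof (intro integral_mono)
      show "integrable lborel (\<lambda>z. norm (indicator S (x - h *\<^sub>R z) * \<phi> z - indicator {z. z $ i > t} z * \<phi> z))"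
        by (intro integrable_norm Bochner_Integration.integrable_diff int' kernel_avg_integrable[OF int]) auto
      show "integrable lborel (\<lambda>z. indicator (bad n) z * norm (\<phi> z))"
        by (rule Bochner_Integration.integrable_bound[OF int]) (auto simp: indicator_def)
      fix z
      show "norm (indicator S (x - h *\<^sub>R z) * \<phi> z - indicator {z. z $ i > t} z * \<phi> z) \<le> indicator (bad n) z * norm (\<phi> z)"
        using 1[of z] 2[of z] by (auto simp: indicator_def bad_def)
    qed
    also have "\<dots> < c" by fact
    finally show "norm (kernel_avg \<phi> h S x) \<ge> c"
      using norm_triangle_ineq3[of "kernel_avg \<phi> h S x" ?H] by (simp add: c_def)
  qed (use n c in auto)
qed

text \<open>A bounded set has finite measure, so the pairing with f is at most |S| sup |f|; the
  seminorm of order zero already gives continuity.\<close>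

lemma regular_distribution_indicator_tempered:
  fixes S :: "(real^'n::finite) set"
  assumes [measurable]: "S \<in> sets borel" and "bounded S"
  shows "regular_distribution (indicator S) \<in> tempered_distributions"
proof -
  let ?T = "regular_distribution (indicator S)"
  have fin: "emeasure lborel S < \<infinity>"
    using assms emeasure_bounded_finite by (metis infinity_ennreal_def)
  have T: "?T f = (\<integral>x. indicator S x * f x \<partial>lborel)" if "f \<in> schwartz" for f
    unfolding regular_distribution_def using that schwartz_borel_measurable[OF that]
    by (simp add: integral_completion)
  have int: "integrable lborel (\<lambda>x. indicator S x * f x)" if "f \<in> schwartz" for f :: "real^'n \<Rightarrow> complex"
    using kernel_avg_integrable[OF schwartz_integrable[OF that] assms(1), of 0 "- 1"] by simp
  have add: "(\<lambda>x. f x + g x) \<in> schwartz" if "f \<in> schwartz" "g \<in> schwartz" for f g :: "real^'n \<Rightarrow> complex"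
  proof -
    have it: "iterated_deriv \<beta> (\<lambda>x. f x + g x) = (\<lambda>x. iterated_deriv \<beta> f x + iterated_deriv \<beta> g x)" for \<beta>
    proof (induction \<beta>)
      case (Cons i \<beta>)
      have pd: "partial_deriv i (\<lambda>x. iterated_deriv \<beta> f x + iterated_deriv \<beta> g x) x
        = partial_deriv i (iterated_deriv \<beta> f) x + partial_deriv i (iterated_deriv \<beta> g) x" for x
      proof -
        have "(iterated_deriv \<beta> f has_derivative frechet_derivative (iterated_deriv \<beta> f) (at x)) (at x)"
          "(iterated_deriv \<beta> g has_derivative frechet_derivative (iterated_deriv \<beta> g) (at x)) (at x)"
          using schwartz_iterated_differentiable[OF that(1), of \<beta> x]
            schwartz_iterated_differentiable[OF that(2), of \<beta> x]
          unfolding frechet_derivative_works by this+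
        from fun_cong[OF frechet_derivative_at[OF has_derivative_add[OF this]], of "axis i 1"]
        show ?thesis unfolding partial_deriv_def by (rule sym)
      qed
      show ?case
        unfolding foldr_Cons o_apply Cons.IH by (rule ext) (rule pd)
    qed simp
    show ?thesis
      unfolding schwartz_def
    proof (intro CollectI conjI allI)
      show "iterated_deriv \<beta> (\<lambda>x. f x + g x) differentiable (at x)" for \<beta> x
        unfolding it using that by (intro differentiable_add schwartz_iterated_differentiable)
      show "bounded (range (\<lambda>x. (1 + norm x) ^ N *\<^sub>R iterated_deriv \<beta> (\<lambda>x. f x + g x) x))"
        for \<beta> N
        unfolding it scaleR_add_right using that unfolding schwartz_def
        by (intro bounded_plus_comp) blast+
    qed
  qed
  have scale: "(\<lambda>x. c * f x) \<in> schwartz" if "f \<in> schwartz" for c and f :: "real^'n \<Rightarrow> complex"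
  proof -
    \<comment> \<open>The available substitution always contains a reflection; applied twice about 0
      it leaves only the factor c.\<close>
    have "(\<lambda>x. f (0 - x)) \<in> schwartz"
      using schwartz_affine[OF that, of 1 1 0] by simp
    from schwartz_affine[OF this, of 1 c 0] show ?thesis by simp
  qed
  have bnd: "norm (?T f) \<le> measure lborel S * schwartz_norm 0 f" if f: "f \<in> schwartz" for f
  proof -
    obtain C where "\<And>x. norm (f x) \<le> C / (1 + norm x) ^ 0"
      using schwartz_decay[OF f, of 0] by metis
    then have C: "norm (f x) \<le> C" for x by simp
    have le: "norm (f x) \<le> schwartz_norm 0 f" for x
    proof -
      have "bdd_above ((\<lambda>(\<beta>, x). (1 + norm x) ^ 0 * norm (iterated_deriv \<beta> f x)) ` ({\<beta>. length \<beta> \<le> 0} \<times> UNIV))"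
        using C by (intro bdd_aboveI2[where M=C]) auto
      then have "(\<lambda>(\<beta>, x). (1 + norm x) ^ 0 * norm (iterated_deriv \<beta> f x)) ([], x) \<le> schwartz_norm 0 f"
        unfolding schwartz_norm_def by (intro cSUP_upper) auto
      then show ?thesis by simp
    qed
    have "norm (?T f) \<le> (\<integral>x. norm (indicator S x * f x) \<partial>lborel)"
      unfolding T[OF that] by (rule integral_norm_bound)
    also have "\<dots> \<le> (\<integral>x. schwartz_norm 0 f * indicator S x \<partial>lborel)"
      by (intro integral_mono integrable_norm int that integrable_mult_right integrable_real_indicator)
         (use le fin in \<open>auto simp: norm_mult split: split_indicator\<close>)
    also have "\<dots> = measure lborel S * schwartz_norm 0 f" by simp
    finally show ?thesis .
  qed
  show ?thesis
    unfolding tempered_distributions_def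
  proof (intro CollectI conjI ballI allI)
    show "?T \<in> extensional schwartz" by (simp add: regular_distribution_def)
    show "?T (\<lambda>x. f x + g x) = ?T f + ?T g" if "f \<in> schwartz" "g \<in> schwartz" for f g
      using int that by (simp add: T add distrib_left)
    show "?T (\<lambda>x. c * f x) = c * ?T f" if "f \<in> schwartz" for c f
      using that by (simp add: T scale mult.left_commute)
    show "\<exists>C N. \<forall>f\<in>schwartz. norm (?T f) \<le> C * schwartz_norm N f"
      using bnd by blast
  qed
qed


subsection \<open>The Triebel--Lizorkin-type norm\<close>

lemma ennreal_powr_le:
  assumes "x \<le> ennreal y" "0 \<le> y" "0 \<le> a"
  shows "ennreal_powr x a \<le> ennreal (y powr a)"
proof -
  have "x < top" using assms(1) by (simp add: le_less_trans)
  moreover from this have "enn2real x \<le> y"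
    using assms by (simp add: enn2real_leI)
  ultimately show ?thesis
    using assms by (auto simp: ennreal_powr_def intro!: ennreal_leI powr_mono2)
qed

lemma ennreal_powr_ge:
  assumes "ennreal y \<le> x" "0 \<le> y" "0 \<le> a"
  shows "ennreal (y powr a) \<le> ennreal_powr x a"
proof (cases x)
  case (real r)
  then have "y \<le> r" using assms by simp
  then show ?thesis
    using real assms by (auto simp: ennreal_powr_def intro!: ennreal_leI powr_mono2)
qed (simp add: ennreal_powr_def)

lemma ennreal_powr_top [simp]: "ennreal_powr top a = top"
  by (simp add: ennreal_powr_def)

text \<open>The expression under the integral in the definition of \<open>TL_norm\<close>, as a function of the
  sequence \<open>a\<close> of the values \<open>norm (\<phi>\<^sub>j * f (x))\<close>.\<close>

definition TL_density :: "ennreal \<Rightarrow> real \<Rightarrow> real \<Rightarrow> int \<Rightarrow> (nat \<Rightarrow> real) \<Rightarrow> ennreal" where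
  "TL_density q p s m a =
    (if q = \<infinity> then
       ennreal_powr (SUP j \<in> {j::nat. max m 0 \<le> int j}. ennreal (2 powr (real j * s) * a j)) p
     else
       ennreal_powr (\<Sum>j::nat. if max m 0 \<le> int j then
           ennreal (2 powr (real j * s * enn2real q) * a j powr enn2real q) else 0) (p / enn2real q))"

lemma enn2real_ge_1: "1 \<le> q \<Longrightarrow> q \<noteq> \<infinity> \<Longrightarrow> 1 \<le> enn2real q" for q :: ennreal
  using enn2real_mono[of 1 q] by (simp add: less_top)

text \<open>The embedding of l^1 into l^q for q \<ge> 1: since every term b_j is at most A, its r-th
  power is at most A^(r-1) b_j. A bound on the l^1 sums thus serves all q at once, the supremum
  included.\<close>

lemma TL_density_le:
  assumes q: "1 \<le> q" and p: "0 < p" and a: "\<And>j. 0 \<le> a j"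
    and A: "0 \<le> A" "\<And>n. (\<Sum>j<n. 2 powr (real j * s) * a j) \<le> A"
  shows "TL_density q p s m a \<le> ennreal (A powr p)"
proof -
  define b where "b j = 2 powr (real j * s) * a j" for j
  have b0: "0 \<le> b j" for j using a by (simp add: b_def)
  have bA: "b j \<le> A" for j
  proof -
    have "b j \<le> (\<Sum>i<Suc j. b i)"
      by (rule member_le_sum) (auto simp: b0)
    then show ?thesis using A(2)[of "Suc j"] by (simp add: b_def)
  qed
  show ?thesis
  proof (cases "q = \<infinity>")
    case True
    have "(SUP j \<in> {j::nat. max m 0 \<le> int j}. ennreal (2 powr (real j * s) * a j)) \<le> ennreal A"
      using bA by (intro SUP_least ennreal_leI) (simp add: b_def)
    then show ?thesis
      using True p A by (simp add: TL_density_def ennreal_powr_le)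
  next
    case False
    define r where "r = enn2real q"
    have r: "r \<ge> 1" using enn2real_ge_1[OF q False] by (simp add: r_def)
    have br: "2 powr (real j * s * r) * a j powr r = b j powr r" for j
      using a r by (simp add: b_def powr_mult powr_powr)
    have bA2: "b j powr r \<le> A powr (r - 1) * b j" for j
    proof (cases "b j = 0")
      case True then show ?thesis using r by simp
    next
      case False
      then have "b j powr r = b j powr (r - 1) * b j powr 1"
        by (simp only: powr_add[symmetric] diff_add_cancel)
      also have "\<dots> \<le> A powr (r - 1) * b j"
        using r b0[of j] bA[of j] False by (auto intro!: mult_right_mono powr_mono2)
      finally show ?thesis .
    qed
    have "(\<Sum>j<n. if max m 0 \<le> int j then ennreal (2 powr (real j * s * r) * a j powr r) else 0) \<le> ennreal (A powr r)"
      for n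
    proof -
      have "(\<Sum>j<n. if max m 0 \<le> int j then ennreal (2 powr (real j * s * r) * a j powr r) else 0)
          \<le> (\<Sum>j<n. ennreal (A powr (r - 1) * b j))"
        using bA2 by (intro sum_mono) (auto simp: br intro!: ennreal_leI)
      also have "\<dots> = ennreal (A powr (r - 1) * (\<Sum>j<n. b j))"
        using b0 by (subst sum_ennreal) (auto simp: sum_distrib_left)
      also have "\<dots> \<le> ennreal (A powr (r - 1) * A)"
        using A(2)[of n] by (intro ennreal_leI mult_left_mono) (auto simp: b_def)
      also have "A powr (r - 1) * A = A powr r"
      proof (cases "A = 0")
        case False
        then have "A powr (r - 1) * A powr 1 = A powr r"
          by (simp only: powr_add[symmetric] diff_add_cancel)
        then show ?thesis using A by simp
      qed (use r in simp)
      finally show ?thesis .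
    qed
    then have "(\<Sum>j. if max m 0 \<le> int j then ennreal (2 powr (real j * s * r) * a j powr r) else 0) \<le> ennreal (A powr r)"
      unfolding suminf_eq_SUP by (rule SUP_least)
    then have "TL_density q p s m a \<le> ennreal ((A powr r) powr (p / r))"
      using False p r unfolding TL_density_def r_def[symmetric] by (simp add: ennreal_powr_le)
    then show ?thesis using r by (simp add: powr_powr)
  qed
qed

text \<open>One level bounds the l^q norm over the levels from below for every q. The condition on j
  is that the level be counted in a cube of side 2^(-m).\<close>

lemma TL_density_ge:
  assumes q: "1 \<le> q" and p: "0 < p" and a: "0 \<le> a j" and j: "max m 0 \<le> int j"
  shows "ennreal ((2 powr (real j * s) * a j) powr p) \<le> TL_density q p s m a"
proof (cases "q = \<infinity>")
  case True
  have "ennreal (2 powr (real j * s) * a j)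
      \<le> (SUP j \<in> {j::nat. max m 0 \<le> int j}. ennreal (2 powr (real j * s) * a j))"
    using j by (intro SUP_upper) auto
  then show ?thesis
    using True p a by (simp add: TL_density_def ennreal_powr_ge)
next
  case False
  define r where "r = enn2real q"
  have r: "r \<ge> 1" using enn2real_ge_1[OF q False] by (simp add: r_def)
  let ?f = "\<lambda>j. if max m 0 \<le> int j then ennreal (2 powr (real j * s * r) * a j powr r) else 0"
  have "ennreal (2 powr (real j * s * r) * a j powr r) = ?f j"
    using j by simp
  also have "\<dots> \<le> (\<Sum>j. ?f j)"
    using sum_le_suminf[of ?f "{j}"] by simp
  finally have "ennreal ((2 powr (real j * s * r) * a j powr r) powr (p / r)) \<le> TL_density q p s m a"
    using False p r unfolding TL_density_def r_def[symmetric] by (simp add: ennreal_powr_ge)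
  moreover have "(2 powr (real j * s * r) * a j powr r) powr (p / r) = (2 powr (real j * s) * a j) powr p"
    using r a by (simp add: powr_mult powr_powr mult.assoc)
  ultimately show ?thesis by simp
qed

lemma dyadic_cube_eq:
  "dyadic_cube m k = {x::real^'n::finite. \<forall>i. 2 powr (- real_of_int m) * real_of_int (k $ i) \<le> x $ i \<and>
     x $ i < 2 powr (- real_of_int m) * (real_of_int (k $ i) + 1)}" (is "_ = ?R")
proof (intro set_eqI iffI)
  let ?r = "2 powr (- real_of_int m)"
  fix x :: "real^'n"
  {
    assume "x \<in> dyadic_cube m k"
    then obtain y :: "real^'n" where y: "x = ?r *\<^sub>R (y + (\<chi> i. real_of_int (k $ i)))"
      "\<forall>i. 0 \<le> y $ i \<and> y $ i < 1"
      by (auto simp: dyadic_cube_def)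
    then show "x \<in> ?R" by simp
  next
    assume x: "x \<in> ?R"
    define y where "y = (1 / ?r) *\<^sub>R x - (\<chi> i. real_of_int (k $ i))"
    have "x = ?r *\<^sub>R (y + (\<chi> i. real_of_int (k $ i)))"
      by (simp add: y_def)
    moreover have "0 \<le> y $ i \<and> y $ i < 1" for i
      using x by (simp add: y_def pos_le_divide_eq pos_divide_less_eq diff_less_eq mult.commute add.commute)
    ultimately show "x \<in> dyadic_cube m k"
      unfolding dyadic_cube_def by blast
  }
qed

lemma dyadic_cube_borel [measurable]: "dyadic_cube m k \<in> sets borel"
  unfolding dyadic_cube_eq by measurable

lemma One_nth: "(One :: real^'n) $ i = 1"
proof -
  have "(\<Sum>b\<in>Basis. 1 *\<^sub>R b) \<bullet> (axis i 1 :: real^'n) = 1"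
    by (rule inner_sum_left_Basis) (simp add: axis_in_Basis_iff)
  then show ?thesis by (simp only: scaleR_one cart_eq_inner_axis)
qed

text \<open>The half-open cube lies between the open and the closed box with the same corners, which
  have equal measure.\<close>

lemma emeasure_dyadic_cube:
  "emeasure lborel (dyadic_cube m k :: (real^'n::finite) set) = ennreal ((2 powr (- real_of_int m)) ^ CARD('n))"
proof -
  let ?r = "2 powr (- real_of_int m)"
  define a :: "real^'n" where "a = (\<chi> i. ?r * real_of_int (k $ i))"
  let ?b = "a + ?r *\<^sub>R One"
  have bi: "?b $ i = ?r * (real_of_int (k $ i) + 1)" for i
    by (simp only: a_def vector_add_component vector_scaleR_component One_nth vec_lambda_beta)
       (simp add: distrib_left)
  have "box a ?b \<subseteq> dyadic_cube m k"
    unfolding dyadic_cube_eq mem_box_cart subset_iff bi by (auto simp: a_def less_imp_le)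
  then have "emeasure lborel (box a ?b) \<le> emeasure lborel (dyadic_cube m k :: (real^'n) set)"
    by (intro emeasure_mono) auto
  moreover have "(dyadic_cube m k :: (real^'n) set) \<subseteq> cbox a ?b"
    unfolding dyadic_cube_eq mem_box_cart subset_iff bi by (auto simp: a_def less_imp_le)
  then have "emeasure lborel (dyadic_cube m k :: (real^'n) set) \<le> emeasure lborel (cbox a ?b)"
    by (intro emeasure_mono) auto
  moreover have "emeasure lborel (box a ?b) = ennreal (?r ^ CARD('n))"
    by (subst emeasure_lborel_box) (auto simp: inner_add_left)
  moreover have "emeasure lborel (cbox a ?b) = ennreal (?r ^ CARD('n))"
    by (subst emeasure_lborel_cbox) (auto simp: inner_add_left)
  ultimately show ?thesis by (metis antisym)
qed

lemma measure_dyadic_cube_powr: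
  "measure lborel (dyadic_cube m k :: (real^'n::finite) set) powr \<tau> = 2 powr (- real_of_int m * real CARD('n) * \<tau>)"
proof -
  have "measure lborel (dyadic_cube m k :: (real^'n) set) = (2 powr (- real_of_int m)) ^ CARD('n)"
    unfolding measure_def emeasure_dyadic_cube by (rule enn2real_ennreal) simp
  also have "\<dots> = 2 powr (- real_of_int m * real CARD('n))"
    by (simp only: powr_powr[symmetric]) (simp add: powr_realpow)
  finally show ?thesis by (simp only: powr_powr)
qed

text \<open>Raising to the power p removes the outer root and turns |P|^\<tau> into 2^(-mn\<tau>p).
  Both directions of the main result then become estimates of plain integrals over cubes.\<close>

lemma TL_norm_finite_iff:
  fixes \<phi>\<^sub>0 \<phi> :: "real^'n::finite \<Rightarrow> complex"
  assumes p: "0 < p"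
  shows "TL_norm \<phi>\<^sub>0 \<phi> s \<tau> p q f < \<infinity> \<longleftrightarrow> (\<exists>B\<ge>0. \<forall>m k.
    (\<integral>\<^sup>+x\<in>dyadic_cube m k. TL_density q p s m (\<lambda>j. norm (convolution (resolution \<phi>\<^sub>0 \<phi> j) f x)) \<partial>lborel)
      \<le> ennreal (B * 2 powr (- real_of_int m * real CARD('n) * \<tau> * p)))" (is "_ \<longleftrightarrow> ?R")
proof -
  define G where "G m k = (\<integral>\<^sup>+x\<in>dyadic_cube m k.
    TL_density q p s m (\<lambda>j. norm (convolution (resolution \<phi>\<^sub>0 \<phi> j) f x)) \<partial>lborel)" for m k
  define e where "e m = 2 powr (- real_of_int m * real CARD('n) * \<tau>)" for m
  have e: "e m > 0" for m by (simp add: e_def)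
  have e2: "2 powr (- real_of_int m * real CARD('n) * \<tau> * p) = e m powr p" for m
    by (simp add: e_def powr_powr)
  have TL: "TL_norm \<phi>\<^sub>0 \<phi> s \<tau> p q f = (SUP (m, k) \<in> UNIV. ennreal (1 / e m) * ennreal_powr (G m k) (1 / p))"
    unfolding TL_norm_def Let_def G_def e_def TL_density_def measure_dyadic_cube_powr by simp
  show ?thesis
  proof
    assume fin: "TL_norm \<phi>\<^sub>0 \<phi> s \<tau> p q f < \<infinity>"
    define N where "N = enn2real (TL_norm \<phi>\<^sub>0 \<phi> s \<tau> p q f)"
    have N: "TL_norm \<phi>\<^sub>0 \<phi> s \<tau> p q f = ennreal N" "N \<ge> 0"
      using fin by (auto simp: N_def)
    have "G m k \<le> ennreal (N powr p * e m powr p)" for m k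
    proof -
      have le: "ennreal (1 / e m) * ennreal_powr (G m k) (1 / p) \<le> ennreal N"
        unfolding N(1)[symmetric] TL by (rule SUP_upper2[of "(m, k)"]) auto
      have "G m k \<noteq> top"
      proof
        assume "G m k = top"
        then have "ennreal (1 / e m) * ennreal_powr (G m k) (1 / p) = top"
          using e[of m] by (simp add: ennreal_mult_top)
        then show False using le by (simp add: top_unique)
      qed
      then obtain g where g: "G m k = ennreal g" "g \<ge> 0" by (cases "G m k") auto
      have "ennreal (1 / e m) * ennreal (g powr (1 / p)) \<le> ennreal N"
        using le g by (simp add: ennreal_powr_def)
      then have "ennreal (1 / e m * g powr (1 / p)) \<le> ennreal N"
        using e[of m] by (simp add: ennreal_mult[symmetric])
      then have "1 / e m * g powr (1 / p) \<le> N"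
        using N(2) by (simp add: ennreal_le_iff)
      then have "g powr (1 / p) \<le> N * e m"
        using e[of m] by (simp add: pos_divide_le_eq)
      then have "(g powr (1 / p)) powr p \<le> (N * e m) powr p"
        using p by (intro powr_mono2) auto
      then show ?thesis
        using g p N(2) e[of m] by (simp add: powr_powr powr_mult ennreal_leI)
    qed
    then show ?R
      unfolding e2 G_def by (intro exI[of _ "N powr p"]) auto
  next
    assume ?R
    then obtain B where B: "B \<ge> 0" "\<And>m k. G m k \<le> ennreal (B * e m powr p)"
      unfolding e2 G_def by blast
    have "ennreal (1 / e m) * ennreal_powr (G m k) (1 / p) \<le> ennreal (B powr (1 / p))" for m k
    proof -
      have "ennreal_powr (G m k) (1 / p) \<le> ennreal ((B * e m powr p) powr (1 / p))"
        using B p by (intro ennreal_powr_le) auto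
      also have "(B * e m powr p) powr (1 / p) = B powr (1 / p) * e m"
        using B p e[of m] by (simp add: powr_mult powr_powr)
      finally have "ennreal (1 / e m) * ennreal_powr (G m k) (1 / p)
          \<le> ennreal (1 / e m) * ennreal (B powr (1 / p) * e m)"
        by (rule mult_left_mono) simp
      also have "\<dots> = ennreal (B powr (1 / p))"
        using e[of m] by (simp add: ennreal_mult[symmetric])
      finally show ?thesis .
    qed
    then have "TL_norm \<phi>\<^sub>0 \<phi> s \<tau> p q f \<le> ennreal (B powr (1 / p))"
      unfolding TL by (auto intro!: SUP_least)
    then show "TL_norm \<phi>\<^sub>0 \<phi> s \<tau> p q f < \<infinity>"
      by (simp add: le_less_trans)
  qed
qed


subsection \<open>The spiral in polar coordinates\<close>

definition ray :: "real \<Rightarrow> real^2" where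
  "ray t = vector [cos t, sin t]"

lemma ray_nth [simp]: "ray t $ 1 = cos t" "ray t $ 2 = sin t"
  by (simp_all add: ray_def)

lemma inner_ray: "ray a \<bullet> ray b = cos (a - b)"
  by (simp add: inner_vec_def sum_2 cos_diff)

lemma norm_ray [simp]: "norm (ray t) = 1"
  by (simp add: norm_eq_sqrt_inner inner_ray)

lemma ray_add_2pi: "ray (t + 2 * pi * of_int k) = ray t"
proof -
  have "sin (t + 2 * pi * of_int k) = sin t \<and> cos (t + 2 * pi * of_int k) = cos t"
    unfolding sin_cos_eq_iff by blast
  then show ?thesis by (simp add: ray_def)
qed

lemma ray_eq_iff: "ray a = ray b \<longleftrightarrow> (\<exists>k::int. a = b + 2 * pi * of_int k)"
proof
  assume "ray a = ray b"
  then have "ray a $ 1 = ray b $ 1" "ray a $ 2 = ray b $ 2" by simp_all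
  then have "sin a = sin b \<and> cos a = cos b" by simp
  then obtain k :: int where "a = b + 2 * pi * of_int k"
    unfolding sin_cos_eq_iff by auto
  then show "\<exists>k::int. a = b + 2 * pi * of_int k" by blast
qed (auto simp: ray_add_2pi)

lemma ex_polar: "\<exists>t. x = norm x *\<^sub>R ray t"
proof (cases "x = 0")
  case False
  define r where "r = norm x"
  have r: "r > 0" using False by (simp add: r_def)
  have "r\<^sup>2 = x $ 1 * x $ 1 + x $ 2 * x $ 2"
    unfolding r_def by (simp only: power2_norm_eq_inner inner_vec_def sum_2 inner_real_def)
  then have "(x $ 1)\<^sup>2 + (x $ 2)\<^sup>2 = r\<^sup>2"
    by (simp add: power2_eq_square)
  then have "(x $ 1 / r)\<^sup>2 + (x $ 2 / r)\<^sup>2 = 1"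
    using r by (simp add: power_divide add_divide_distrib[symmetric])
  then obtain t where "x $ 1 / r = cos t" "x $ 2 / r = sin t"
    by (rule sincos_total_2pi)
  then have "x = r *\<^sub>R ray t"
    using r by (auto simp: vec_eq_iff forall_2 field_simps)
  then show ?thesis unfolding r_def by blast
qed simp

text \<open>The angle is free modulo 2\<pi>, so rounding brings it within half a period of any
  prescribed unreduced angle. Unreduced angles matter because the spiral distinguishes its
  turns.\<close>

lemma ex_polar_near: "\<exists>t. x = norm x *\<^sub>R ray t \<and> \<bar>t - t0\<bar> \<le> pi"
proof -
  obtain t where t: "x = norm x *\<^sub>R ray t" using ex_polar by blast
  define k where "k = round ((t0 - t) / (2 * pi))"
  have "\<bar>of_int k - (t0 - t) / (2 * pi)\<bar> \<le> 1 / 2"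
    unfolding k_def by (rule of_int_round_abs_le)
  then have "2 * pi * \<bar>of_int k - (t0 - t) / (2 * pi)\<bar> \<le> 2 * pi * (1 / 2)"
    by (intro mult_left_mono) auto
  also have "2 * pi * \<bar>of_int k - (t0 - t) / (2 * pi)\<bar> = \<bar>2 * pi * (of_int k - (t0 - t) / (2 * pi))\<bar>"
    by (simp add: abs_mult)
  also have "2 * pi * (of_int k - (t0 - t) / (2 * pi)) = t + 2 * pi * of_int k - t0"
    by (simp add: field_simps)
  finally show ?thesis
    using t by (intro exI[of _ "t + 2 * pi * of_int k"]) (simp add: ray_add_2pi)
qed

lemma norm_polar_diff:
  "(norm (s *\<^sub>R ray a - r *\<^sub>R ray b))\<^sup>2 = s\<^sup>2 + r\<^sup>2 - 2 * s * r * cos (a - b)"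
proof -
  have "cos (b - a) = cos (a - b)" by (metis cos_minus minus_diff_eq)
  then show ?thesis
    unfolding power2_norm_eq_inner inner_diff_left inner_diff_right inner_scaleR_left inner_scaleR_right inner_ray
    by (simp add: power2_eq_square right_diff_distrib)
qed

text \<open>The left-hand side is the distance from the point r \<open>ray b\<close> to the line
  spanned by \<open>ray a\<close>; algebraically, the difference of the squares is (s - r cos(a -
  b))^2.\<close>

lemma norm_polar_diff_ge_sin: "\<bar>r\<bar> * \<bar>sin (a - b)\<bar> \<le> norm (s *\<^sub>R ray a - r *\<^sub>R ray b)"
proof -
  have "(r * sin (a - b))\<^sup>2 = r\<^sup>2 - (r * cos (a - b))\<^sup>2"
    by (simp add: power_mult_distrib sin_squared_eq algebra_simps)
  also have "\<dots> \<le> (norm (s *\<^sub>R ray a - r *\<^sub>R ray b))\<^sup>2"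
    using zero_le_power2[of "s - r * cos (a - b)"]
    by (simp add: norm_polar_diff power2_diff algebra_simps)
  finally have "\<bar>r * sin (a - b)\<bar> \<le> norm (s *\<^sub>R ray a - r *\<^sub>R ray b)"
    by (rule abs_le_square_iff[THEN iffD2, of "r * sin (a - b)" "norm (s *\<^sub>R ray a - r *\<^sub>R ray b)", simplified])
  then show ?thesis by (simp add: abs_mult)
qed

text \<open>The function sin x - x/2 has derivative cos x - 1/2, which is nonnegative up to |t|
  because the cosine decreases there.\<close>

lemma abs_sin_ge_half:
  assumes "\<bar>t\<bar> \<le> pi" "cos t \<ge> 1 / 2"
  shows "\<bar>t\<bar> / 2 \<le> \<bar>sin t\<bar>"
proof -
  have "sin 0 - 0 / 2 \<le> sin \<bar>t\<bar> - \<bar>t\<bar> / 2"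
  proof (rule DERIV_nonneg_imp_nondecreasing[of 0 "\<bar>t\<bar>" "\<lambda>x. sin x - x / 2"])
    fix x assume x: "0 \<le> x" "x \<le> \<bar>t\<bar>"
    then have "cos \<bar>t\<bar> \<le> cos x"
      using assms by (intro cos_monotone_0_pi_le) auto
    then have "cos x - 1 / 2 \<ge> 0" using assms by simp
    moreover have "((\<lambda>x. sin x - x / 2) has_real_derivative (cos x - 1 / 2)) (at x)"
      by (auto intro!: derivative_eq_intros)
    ultimately show "\<exists>y. ((\<lambda>x. sin x - x / 2) has_real_derivative y) (at x) \<and> 0 \<le> y" by blast
  qed auto
  then show ?thesis by (cases "t \<ge> 0") auto
qed

text \<open>If the cosine of the angle difference is at least 1/2, the sine controls the angle.
  Otherwise the distance is at least (\<surd>3/2) r, and the bound \<pi> < 4 on the angle is enough;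
  5 is a round number above 8/\<surd>3.\<close>

lemma polar_angle_near:
  assumes "r > 0"
  obtains t' where "z = norm z *\<^sub>R ray t'" "\<bar>t' - t\<bar> \<le> 5 * norm (z - r *\<^sub>R ray t) / r"
proof -
  obtain t' where t': "z = norm z *\<^sub>R ray t'" "\<bar>t' - t\<bar> \<le> pi" using ex_polar_near by blast
  define D where "D = norm (z - r *\<^sub>R ray t)"
  have D0: "D \<ge> 0" by (simp add: D_def)
  have D: "D = norm (norm z *\<^sub>R ray t' - r *\<^sub>R ray t)"
    using t'(1) by (simp add: D_def)
  have "\<bar>t' - t\<bar> * r \<le> 5 * D"
  proof (cases "cos (t' - t) \<ge> 1 / 2")
    case True
    then have "\<bar>t' - t\<bar> / 2 \<le> \<bar>sin (t' - t)\<bar>"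
      using t' by (intro abs_sin_ge_half) auto
    then have "r * (\<bar>t' - t\<bar> / 2) \<le> \<bar>r\<bar> * \<bar>sin (t' - t)\<bar>"
      using assms by (simp add: mult_left_mono)
    also have "\<dots> \<le> D" unfolding D by (rule norm_polar_diff_ge_sin)
    finally show ?thesis using D0 by (simp add: mult.commute)
  next
    case False
    then have "2 * norm z * r * cos (t' - t) \<le> 2 * norm z * r * (1 / 2)"
      using assms by (intro mult_left_mono) auto
    then have "D\<^sup>2 \<ge> (norm z)\<^sup>2 + r\<^sup>2 - norm z * r"
      unfolding D norm_polar_diff by simp
    moreover have "(norm z)\<^sup>2 + r\<^sup>2 - norm z * r = (norm z - r / 2)\<^sup>2 + 3 / 4 * r\<^sup>2"
      by (simp add: power2_eq_square field_simps)
    ultimately have "3 / 4 * r\<^sup>2 \<le> D\<^sup>2"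
      using zero_le_power2[of "norm z - r / 2"] by linarith
    then have "16 * r\<^sup>2 \<le> 25 * D\<^sup>2"
      using zero_le_power2[of r] by linarith
    then have "(4 * r)\<^sup>2 \<le> (5 * D)\<^sup>2"
      unfolding power_mult_distrib by simp
    then have "4 * r \<le> 5 * D"
      using D0 by (intro power2_le_imp_le[of "4 * r"]) auto
    moreover have "\<bar>t' - t\<bar> * r \<le> 4 * r"
      using t'(2) pi_less_4 assms by (intro mult_right_mono) auto
    ultimately show ?thesis by linarith
  qed
  then have "\<bar>t' - t\<bar> \<le> 5 * norm (z - r *\<^sub>R ray t) / r"
    using assms by (simp add: pos_le_divide_eq D_def)
  then show thesis using that t'(1) by blast
qed

lemma norm_ray_diff: "norm (ray a - ray b) \<le> \<bar>a - b\<bar>"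
proof -
  have "(norm (ray a - ray b))\<^sup>2 = 2 - 2 * cos (a - b)"
    using norm_polar_diff[of 1 a 1 b] by simp
  also have "\<dots> = (2 * sin ((a - b) / 2))\<^sup>2"
  proof -
    have "2 * ((a - b) / 2) = a - b" by simp
    then have "cos (a - b) = 1 - 2 * (sin ((a - b) / 2))\<^sup>2"
      using cos_double_sin[of "(a - b) / 2"] by metis
    then show ?thesis by (simp add: power_mult_distrib)
  qed
  also have "\<dots> \<le> (a - b)\<^sup>2"
    using abs_sin_x_le_abs_x[of "(a - b) / 2"]
    by (intro abs_le_square_iff[THEN iffD1]) (simp add: abs_mult)
  finally show ?thesis
    using abs_le_square_iff[of "norm (ray a - ray b)" "a - b"] by simp
qed

text \<open>After taking logarithms the hypotheses say that |ln(x/w)| \<le> ln \<kappa>, which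
  treats exponents b of either sign alike; this is where |b| comes from.\<close>

lemma powr_between:
  fixes b w \<kappa> x :: real
  assumes "w > 0" "\<kappa> \<ge> 1" "w / \<kappa> \<le> x" "x \<le> \<kappa> * w"
  shows "x powr b \<le> \<kappa> powr \<bar>b\<bar> * w powr b" "\<kappa> powr - \<bar>b\<bar> * w powr b \<le> x powr b"
proof -
  define y where "y = x / w"
  have y: "1 / \<kappa> \<le> y" "y \<le> \<kappa>" "y > 0"
    using assms by (auto simp: y_def field_simps intro: less_le_trans[of 0 "w / \<kappa>"])
  have x: "x powr b = y powr b * w powr b"
    using y assms by (simp add: y_def powr_divide)
  have ln: "\<bar>ln y\<bar> \<le> ln \<kappa>"
  proof -
    have "ln (1 / \<kappa>) \<le> ln y" "ln y \<le> ln \<kappa>"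
      using y assms by (auto simp: ln_le_cancel_iff)
    then show ?thesis using assms by (simp add: ln_div abs_le_iff)
  qed
  have "\<bar>b * ln y\<bar> \<le> \<bar>b\<bar> * ln \<kappa>"
    using ln by (simp add: abs_mult mult_left_mono)
  then have "y powr b \<le> \<kappa> powr \<bar>b\<bar>" "\<kappa> powr - \<bar>b\<bar> \<le> y powr b"
    using y assms by (auto simp: powr_def)
  then show "x powr b \<le> \<kappa> powr \<bar>b\<bar> * w powr b" "\<kappa> powr - \<bar>b\<bar> * w powr b \<le> x powr b"
    unfolding x by (auto intro: mult_right_mono)
qed

lemma powr_mvt:
  fixes b x y :: real
  assumes "0 < x" "x < y"
  obtains z where "x < z" "z < y" "y powr b - x powr b = (y - x) * (b * z powr (b - 1))"
proof -
  have "\<exists>z. x < z \<and> z < y \<and> y powr b - x powr b = (y - x) * (b * z powr (b - 1))"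
    using assms by (intro MVT2) (auto intro!: derivative_eq_intros)
  then show thesis using that by blast
qed

text \<open>Mean value theorem: between x and y the derivative b z^(b-1) is comparable to w^(b-1).
  It converts radial distances into differences of u and back, with b = -1/\<alpha> and b =
  -\<alpha>.\<close>

lemma powr_diff_bounds:
  fixes b w \<kappa> x y :: real
  assumes "w > 0" "\<kappa> \<ge> 1" "w / \<kappa> \<le> x" "x \<le> \<kappa> * w" "w / \<kappa> \<le> y" "y \<le> \<kappa> * w"
  shows "\<bar>x powr b - y powr b\<bar> \<le> \<bar>b\<bar> * \<kappa> powr \<bar>b - 1\<bar> * w powr (b - 1) * \<bar>x - y\<bar>"
    and "\<bar>b\<bar> * \<kappa> powr - \<bar>b - 1\<bar> * w powr (b - 1) * \<bar>x - y\<bar> \<le> \<bar>x powr b - y powr b\<bar>"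
proof -
  have main: "\<bar>y powr b - x powr b\<bar> \<le> \<bar>b\<bar> * \<kappa> powr \<bar>b - 1\<bar> * w powr (b - 1) * \<bar>y - x\<bar> \<and>
     \<bar>b\<bar> * \<kappa> powr - \<bar>b - 1\<bar> * w powr (b - 1) * \<bar>y - x\<bar> \<le> \<bar>y powr b - x powr b\<bar>"
    if "x < y" and x: "w / \<kappa> \<le> x" and y: "y \<le> \<kappa> * w" for x y
  proof -
    have "0 < w / \<kappa>" using assms by simp
    then have "0 < x" using x by linarith
    then obtain z where z: "x < z" "z < y" "y powr b - x powr b = (y - x) * (b * z powr (b - 1))"
      using powr_mvt[of x y b] \<open>x < y\<close> by blast
    have "z powr (b - 1) \<le> \<kappa> powr \<bar>b - 1\<bar> * w powr (b - 1)"
      "\<kappa> powr - \<bar>b - 1\<bar> * w powr (b - 1) \<le> z powr (b - 1)"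
      using z x y assms by (auto intro!: powr_between)
    then have "(\<bar>y - x\<bar> * \<bar>b\<bar>) * z powr (b - 1) \<le> (\<bar>y - x\<bar> * \<bar>b\<bar>) * (\<kappa> powr \<bar>b - 1\<bar> * w powr (b - 1))"
      "(\<bar>y - x\<bar> * \<bar>b\<bar>) * (\<kappa> powr - \<bar>b - 1\<bar> * w powr (b - 1)) \<le> (\<bar>y - x\<bar> * \<bar>b\<bar>) * z powr (b - 1)"
      by (auto intro!: mult_left_mono)
    moreover have "\<bar>y powr b - x powr b\<bar> = (\<bar>y - x\<bar> * \<bar>b\<bar>) * z powr (b - 1)"
      unfolding z(3) by (simp add: abs_mult)
    ultimately show ?thesis by (simp only: mult_ac)
  qed
  have "\<bar>x powr b - y powr b\<bar> \<le> \<bar>b\<bar> * \<kappa> powr \<bar>b - 1\<bar> * w powr (b - 1) * \<bar>x - y\<bar> \<and>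
     \<bar>b\<bar> * \<kappa> powr - \<bar>b - 1\<bar> * w powr (b - 1) * \<bar>x - y\<bar> \<le> \<bar>x powr b - y powr b\<bar>"
    using main[of x y] main[of y x] assms
    by (cases x y rule: linorder_cases) (simp_all add: abs_minus_commute)
  then show "\<bar>x powr b - y powr b\<bar> \<le> \<bar>b\<bar> * \<kappa> powr \<bar>b - 1\<bar> * w powr (b - 1) * \<bar>x - y\<bar>"
    "\<bar>b\<bar> * \<kappa> powr - \<bar>b - 1\<bar> * w powr (b - 1) * \<bar>x - y\<bar> \<le> \<bar>x powr b - y powr b\<bar>"
    by auto
qed

text \<open>In the coordinates \<open>(u, t)\<close> the spiral becomes the union of the strips
  \<open>t + 2\<pi>k < u \<le> t + 2\<pi>k + \<pi>\<close>.\<close>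

definition polar_pt :: "real \<Rightarrow> real \<Rightarrow> real \<Rightarrow> real^2" where
  "polar_pt \<alpha> u t = u powr - \<alpha> *\<^sub>R ray t"

lemma norm_polar_pt [simp]: "norm (polar_pt \<alpha> u t) = u powr - \<alpha>"
  by (simp add: polar_pt_def)

lemma polar_pt_add_2pi: "polar_pt \<alpha> u (t + 2 * pi * of_int k) = polar_pt \<alpha> u t"
  by (simp add: polar_pt_def ray_add_2pi)

lemma powr_minus_inverse: "0 < \<alpha> \<Longrightarrow> 0 < r \<Longrightarrow> (r powr - (1 / \<alpha>)) powr - \<alpha> = (r::real)"
  by (simp add: powr_powr)

lemma ex_polar_pt:
  assumes "0 < \<alpha>" "x \<noteq> 0"
  obtains u t where "u = norm x powr (- 1 / \<alpha>)" "u > 0" "x = polar_pt \<alpha> u t"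
proof -
  obtain t where "x = norm x *\<^sub>R ray t" using ex_polar by blast
  moreover have "(norm x powr (- 1 / \<alpha>)) powr - \<alpha> = norm x"
    using assms by (simp add: powr_minus_inverse)
  ultimately have "x = polar_pt \<alpha> (norm x powr (- 1 / \<alpha>)) t"
    by (simp only: polar_pt_def)
  then show thesis using assms by (intro that[OF refl]) auto
qed

text \<open>Since u^(-\<alpha>) decreases in u, the closed inner bound becomes u \<le> t + \<pi> and
  the strict outer bound becomes t < u.\<close>

lemma spiral_eq:
  assumes "0 < \<alpha>"
  shows "spiral \<alpha> = {polar_pt \<alpha> u t | u t. 2 * pi \<le> t \<and> t < u \<and> u \<le> t + pi}"
proof (intro set_eqI iffI)
  fix x
  assume "x \<in> spiral \<alpha>"
  then obtain r \<theta> where x: "x = vector [r * cos \<theta>, r * sin \<theta>]" and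
    r: "1 / (\<theta> + pi) powr \<alpha> \<le> r" "r < 1 / \<theta> powr \<alpha>" "2 * pi \<le> \<theta>"
    by (auto simp: spiral_def)
  have th: "\<theta> > 0" using r(3) pi_gt_zero by linarith
  then have "\<theta> + pi > 0" using pi_gt_zero by linarith
  then have "0 < 1 / (\<theta> + pi) powr \<alpha>" by simp
  then have r0: "r > 0" using r(1) by linarith
  define u where "u = r powr (- 1 / \<alpha>)"
  have u: "u > 0" "u powr - \<alpha> = r"
    using r0 assms by (auto simp: u_def powr_minus_inverse)
  have "u \<le> \<theta> + pi"
  proof (rule ccontr)
    assume "\<not> ?thesis"
    then have "u powr - \<alpha> < (\<theta> + pi) powr - \<alpha>"
      using th assms \<open>\<theta> + pi > 0\<close> by (intro powr_less_mono2_neg) auto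
    then show False using r(1) u by (simp add: powr_minus divide_inverse)
  qed
  moreover have "\<theta> < u"
  proof (rule ccontr)
    assume "\<not> ?thesis"
    then have "\<theta> powr - \<alpha> \<le> u powr - \<alpha>"
      using u assms by (intro powr_mono2') auto
    then show False using r(2) u by (simp add: powr_minus divide_inverse)
  qed
  moreover have "x = polar_pt \<alpha> u \<theta>"
    unfolding x polar_pt_def u(2) by (simp add: vec_eq_iff forall_2)
  ultimately show "x \<in> {polar_pt \<alpha> u t | u t. 2 * pi \<le> t \<and> t < u \<and> u \<le> t + pi}"
    using r(3) by blast
next
  fix x
  assume "x \<in> {polar_pt \<alpha> u t | u t. 2 * pi \<le> t \<and> t < u \<and> u \<le> t + pi}"
  then obtain u t where x: "x = polar_pt \<alpha> u t" and t: "2 * pi \<le> t" "t < u" "u \<le> t + pi"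
    by blast
  have t0: "t > 0" using t(1) pi_gt_zero by linarith
  have "(t + pi) powr - \<alpha> \<le> u powr - \<alpha>"
    using t t0 assms by (intro powr_mono2') auto
  moreover have "u powr - \<alpha> < t powr - \<alpha>"
    using t t0 assms by (intro powr_less_mono2_neg) auto
  ultimately show "x \<in> spiral \<alpha>"
    unfolding spiral_def
    using t(1) x by (intro CollectI exI[of _ "u powr - \<alpha>"] exI[of _ t])
       (auto simp: polar_pt_def powr_minus divide_inverse vec_eq_iff forall_2)
qed

text \<open>A nonzero point determines u, but its angle only up to full turns; membership asks that
  some representative t + 2\<pi>k satisfy the strip conditions.\<close>

lemma polar_pt_in_spiral_iff:
  assumes "0 < \<alpha>" "0 < u"
  shows "polar_pt \<alpha> u t \<in> spiral \<alpha> \<longleftrightarrow>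
    (\<exists>k::int. 2 * pi \<le> t + 2 * pi * of_int k \<and> t + 2 * pi * of_int k < u \<and> u \<le> t + 2 * pi * of_int k + pi)"
    (is "_ \<longleftrightarrow> ?R")
proof
  assume "polar_pt \<alpha> u t \<in> spiral \<alpha>"
  then obtain u' t' where eq: "polar_pt \<alpha> u t = polar_pt \<alpha> u' t'" and t': "2 * pi \<le> t'" "t' < u'" "u' \<le> t' + pi"
    unfolding spiral_eq[OF assms(1)] by blast
  have u': "u' > 0" using t' pi_gt_zero by linarith
  have "u powr - \<alpha> = u' powr - \<alpha>"
    using arg_cong[OF eq, of norm] by simp
  then have "(u powr - \<alpha>) powr (- 1 / \<alpha>) = (u' powr - \<alpha>) powr (- 1 / \<alpha>)" by simp
  then have uu: "u = u'" using assms u' by (simp add: powr_powr)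
  then have "ray t' = ray t" using eq u' by (simp add: polar_pt_def)
  then obtain k :: int where "t' = t + 2 * pi * of_int k" unfolding ray_eq_iff by blast
  then show ?R using t' uu by blast
next
  assume ?R
  then obtain k :: int where k: "2 * pi \<le> t + 2 * pi * of_int k" "t + 2 * pi * of_int k < u"
    "u \<le> t + 2 * pi * of_int k + pi" by blast
  have "polar_pt \<alpha> u t = polar_pt \<alpha> u (t + 2 * pi * of_int k)" by (simp add: polar_pt_add_2pi)
  then show "polar_pt \<alpha> u t \<in> spiral \<alpha>"
    unfolding spiral_eq[OF assms(1)] using k by blast
qed

lemma polar_pt_in_spiral:
  "0 < \<alpha> \<Longrightarrow> 2 * pi \<le> t \<Longrightarrow> t < u \<Longrightarrow> u \<le> t + pi \<Longrightarrow> polar_pt \<alpha> u t \<in> spiral \<alpha>"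
  using spiral_eq by blast

text \<open>Applied with c = 2\<pi>: a different turn of the same angle is at least one whole period
  away, which leaves only linear inequalities in the membership questions below.\<close>

lemma int_mult_cases:
  fixes k :: int and c :: real
  assumes "c > 0"
  obtains "c * of_int k = 0" | "c * of_int k \<ge> c" | "c * of_int k \<le> - c"
proof -
  consider "k = 0" | "k \<ge> 1" | "k \<le> -1" by linarith
  then show thesis
  proof cases
    case 2
    then have "c * 1 \<le> c * of_int k" using assms by (intro mult_left_mono) auto
    then show thesis using that by simp
  next
    case 3
    then have "c * of_int k \<le> c * of_int (-1)" using assms by (intro mult_left_mono) (auto simp flip: of_int_le_iff[where 'a=real])
    then show thesis using that by simp
  qed (use that in simp)
qed

lemma polar_pt_notin_spiral:
  assumes "0 < \<alpha>" "0 < u" "t - pi < u" "u \<le> t"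
  shows "polar_pt \<alpha> u t \<notin> spiral \<alpha>"
proof
  assume "polar_pt \<alpha> u t \<in> spiral \<alpha>"
  then obtain k :: int where k: "t + 2 * pi * of_int k < u" "u \<le> t + 2 * pi * of_int k + pi"
    unfolding polar_pt_in_spiral_iff[OF assms(1,2)] by blast
  have "2 * pi > 0" by simp
  then show False
    by (rule int_mult_cases[of "2 * pi" k]) (use k assms in linarith)+
qed

lemma polar_pt_notin_spiral_gap:
  assumes "0 < \<alpha>" "0 < u" "t + pi < u" "u \<le> t + 2 * pi"
  shows "polar_pt \<alpha> u t \<notin> spiral \<alpha>"
  using polar_pt_notin_spiral[of \<alpha> u "t + 2 * pi"] polar_pt_add_2pi[of \<alpha> u t 1] assms by simp

text \<open>Representatives t + 2\<pi>k with k \<le> 0 lie before the initial angle 2\<pi>, and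
  those with k \<ge> 1 are not below u.\<close>

lemma polar_pt_notin_spiral_outside:
  assumes "0 < \<alpha>" "0 < u" "t < 2 * pi" "u \<le> t + 2 * pi"
  shows "polar_pt \<alpha> u t \<notin> spiral \<alpha>"
proof
  assume "polar_pt \<alpha> u t \<in> spiral \<alpha>"
  then obtain k :: int where k: "2 * pi \<le> t + 2 * pi * of_int k" "t + 2 * pi * of_int k < u"
    "u \<le> t + 2 * pi * of_int k + pi"
    unfolding polar_pt_in_spiral_iff[OF assms(1,2)] by blast
  have "2 * pi > 0" by simp
  then show False
    by (rule int_mult_cases[of "2 * pi" k]) (use k assms pi_gt_zero in linarith)+
qed

section \<open>Size and measurability of the spiral\<close>

lemma norm_spiral_less:
  assumes "0 < \<alpha>" "x \<in> spiral \<alpha>"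
  shows "norm x < (2 * pi) powr - \<alpha>"
proof -
  obtain u t where x: "x = polar_pt \<alpha> u t" "2 * pi \<le> t" "t < u"
    using assms spiral_eq by blast
  then show ?thesis
    using assms by (auto intro!: powr_less_mono2_neg)
qed

lemma two_pi_gt: "2 * pi > 6" "pi > 3" "pi < 4"
  using pi_gt3 pi_less_4 by auto

lemma powr_two_pi_less_1: "0 < \<alpha> \<Longrightarrow> (2 * pi) powr - \<alpha> < 1"
  using powr_less_mono2_neg[of "- \<alpha>" 1 "2 * pi"] two_pi_gt by simp

text \<open>The half-open strip t < u \<le> t + \<pi> is exhausted by the compact sets t + 1/(n+1)
  \<le> u \<le> t + \<pi> with 2\<pi> \<le> t \<le> n; their continuous images are compact, and the
  spiral is the union of these.\<close>

lemma spiral_borel: 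
  assumes "0 < \<alpha>"
  shows "spiral \<alpha> \<in> sets borel"
proof -
  define f where "f = (\<lambda>(u, t). polar_pt \<alpha> u t)"
  define K where "K n = {z::real \<times> real. 2 * pi \<le> snd z \<and> snd z \<le> real n \<and>
      snd z + 1 / (real n + 1) \<le> fst z \<and> fst z \<le> snd z + pi}" for n
  have "compact (K n)" for n
  proof -
    have "closed (K n)"
      unfolding K_def by (intro closed_Collect_conj closed_Collect_le continuous_intros)
    moreover have "K n \<subseteq> {0..real n + pi} \<times> {0..real n}"
    proof
      fix z assume "z \<in> K n"
      then have z: "2 * pi \<le> snd z" "snd z \<le> real n" "snd z + 1 / (real n + 1) \<le> fst z" "fst z \<le> snd z + pi"
        by (auto simp: K_def)
      have "0 \<le> 1 / (real n + 1)" by simp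
      then have "snd z \<le> fst z" using z by linarith
      then show "z \<in> {0..real n + pi} \<times> {0..real n}"
        using two_pi_gt z by (cases z) auto
    qed
    ultimately show ?thesis
      using bounded_subset[OF bounded_Times[OF bounded_closed_interval bounded_closed_interval]]
      unfolding compact_eq_bounded_closed by blast
  qed
  moreover have "continuous_on (K n) f" for n
  proof -
    have "fst z > 0" if "z \<in> K n" for z
    proof -
      have "2 * pi \<le> snd z" "snd z + 1 / (real n + 1) \<le> fst z" using that by (auto simp: K_def)
      moreover have "0 \<le> 1 / (real n + 1)" by simp
      ultimately show ?thesis using two_pi_gt by linarith
    qed
    then have ne: "\<forall>z\<in>K n. fst z \<noteq> 0" by fastforce
    have cs: "continuous_on (K n) (\<lambda>z. if i = 1 then cos (snd z) else sin (snd z))" for i :: 2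
      by (cases "i = 1") (auto intro!: continuous_intros)
    have "continuous_on (K n) (\<lambda>z. fst z powr - \<alpha> *\<^sub>R (\<chi> i. if i = 1 then cos (snd z) else sin (snd z)) :: real^2)"
      by (intro continuous_on_scaleR continuous_on_powr continuous_on_vec_lambda cs ne) (intro continuous_intros)+
    moreover have "f z = fst z powr - \<alpha> *\<^sub>R (\<chi> i. if i = 1 then cos (snd z) else sin (snd z))" for z
      by (cases z) (simp add: f_def polar_pt_def vec_eq_iff forall_2)
    ultimately show ?thesis by simp
  qed
  ultimately have "compact (f ` K n)" for n
    by (intro compact_continuous_image)
  then have "(\<Union>n. f ` K n) \<in> sets borel"
    by (intro sets.countable_UN) (auto intro: borel_closed compact_imp_closed)
  moreover have "spiral \<alpha> = (\<Union>n. f ` K n)"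
  proof (intro set_eqI iffI)
    fix x assume "x \<in> spiral \<alpha>"
    then obtain u t where x: "x = polar_pt \<alpha> u t" "2 * pi \<le> t" "t < u" "u \<le> t + pi"
      using assms spiral_eq by blast
    obtain n1 :: nat where n1: "t \<le> n1" using real_arch_simple by blast
    obtain n2 :: nat where n2: "n2 > 0" "1 / n2 < u - t"
      using real_arch_inverse[of "u - t"] x(3) by (auto simp: inverse_eq_divide)
    define n where "n = max n1 n2"
    have "1 / (real n + 1) \<le> 1 / n2"
      using n2 by (intro divide_left_mono) (auto simp: n_def)
    then have "(u, t) \<in> K n" using x n1 n2 by (auto simp: K_def n_def)
    then show "x \<in> (\<Union>n. f ` K n)" using x(1) by (force simp: f_def)
  next
    fix x assume "x \<in> (\<Union>n. f ` K n)"
    then obtain n u t where x: "x = polar_pt \<alpha> u t" "(u, t) \<in> K n" by (auto simp: f_def)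
    have "0 < 1 / (real n + 1)" by simp
    moreover have "2 * pi \<le> t" "t + 1 / (real n + 1) \<le> u" "u \<le> t + pi"
      using x(2) by (auto simp: K_def)
    ultimately show "x \<in> spiral \<alpha>"
      unfolding x(1) using assms by (intro polar_pt_in_spiral) linarith+
  qed
  ultimately show ?thesis by simp
qed

text \<open>A displacement D at radius r = u^(-\<alpha>) changes u by at most a multiple of (u/r) D
  and the angle by at most 5D/r. The length r/u = u^(-\<alpha>-1) thus corresponds to a unit change
  of u, but only to a change of order 1/u of the angle.\<close>

lemma polar_pt_near:
  assumes \<alpha>: "0 < \<alpha>"
  obtains C where "C \<ge> 1" "\<And>u t a y. \<lbrakk>1 \<le> u; 0 < a; a \<le> 1; norm (y - polar_pt \<alpha> u t) \<le> a * u powr (- \<alpha> - 1) / C\<rbrakk>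
     \<Longrightarrow> \<exists>u' t'. u' > 0 \<and> y = polar_pt \<alpha> u' t' \<and> \<bar>u' - u\<bar> \<le> a / 8 \<and> \<bar>t' - t\<bar> \<le> a / (8 * u)"
proof -
  define K where "K = \<bar>- 1 / \<alpha>\<bar> * 2 powr \<bar>- 1 / \<alpha> - 1\<bar>"
  have K: "K \<ge> 0" by (simp add: K_def)
  \<comment> \<open>40 = 8 * 5 pays for the angle with the factor 5 of the angle estimate, 8K for u;
    both are to stay within an eighth.\<close>
  define C where "C = 40 + 8 * K"
  have C: "C \<ge> 40" "C \<ge> 8 * K" "C > 0" using K by (auto simp: C_def)
  show thesis
  proof (rule that[of C])
    show "C \<ge> 1" using C by simp
    fix u t a y
    assume u: "1 \<le> u" and a: "0 < a" "a \<le> 1" and y: "norm (y - polar_pt \<alpha> u t) \<le> a * u powr (- \<alpha> - 1) / C"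
    define r where "r = u powr - \<alpha>"
    have r: "r > 0" using u by (simp add: r_def)
    have ur: "u powr (- \<alpha> - 1) = r / u"
      using u by (simp add: r_def powr_diff)
    have x: "norm (polar_pt \<alpha> u t) = r" by (simp add: r_def)
    define D where "D = norm (y - polar_pt \<alpha> u t)"
    have "D \<le> a * (r / u) / C" using y by (simp only: D_def ur)
    then have "D * C \<le> a * (r / u)" using C(3) by (simp only: pos_le_divide_eq)
    then have DC: "D * C \<le> a * r / u" by simp
    have "a * r / u \<le> r"
      using a u r by (simp add: pos_divide_le_eq mult_mono mult.commute)
    then have "D * C \<le> r" using DC by linarith
    moreover have "D * 40 \<le> D * C" using C by (intro mult_left_mono) (auto simp: D_def)
    ultimately have D2: "D \<le> r / 2" using r by simp
    have ny: "\<bar>norm y - r\<bar> \<le> D"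
      using norm_triangle_ineq3[of y "polar_pt \<alpha> u t"] x by (simp add: D_def)
    then have ny2: "norm y \<ge> r / 2" "norm y \<le> 2 * r" using D2 r by auto
    obtain t' where t': "y = norm y *\<^sub>R ray t'" "\<bar>t' - t\<bar> \<le> 5 * D / r"
      using polar_angle_near[OF r, of y t] by (auto simp: D_def r_def polar_pt_def)
    define u' where "u' = norm y powr (- 1 / \<alpha>)"
    have ny0: "norm y > 0" using ny2 r by linarith
    then have "u' > 0" by (simp add: u'_def)
    moreover have "y = polar_pt \<alpha> u' t'"
      using t'(1) \<alpha> ny0 by (simp add: polar_pt_def u'_def powr_minus_inverse)
    moreover have "\<bar>u' - u\<bar> \<le> a / 8"
    proof -
      have "u = r powr (- 1 / \<alpha>)" using u \<alpha> by (simp add: r_def powr_powr)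
      then have "\<bar>u' - u\<bar> \<le> K * r powr (- 1 / \<alpha> - 1) * \<bar>norm y - r\<bar>"
        unfolding u'_def K_def using powr_diff_bounds(1)[of r 2 "norm y" r "- 1 / \<alpha>"] ny2 r by simp
      also have "\<dots> \<le> K * r powr (- 1 / \<alpha> - 1) * D"
        using ny K by (intro mult_left_mono) auto
      also have "r powr (- 1 / \<alpha> - 1) = u / r"
        using r \<open>u = _\<close> by (simp only: powr_diff powr_one order.strict_implies_order)
      also have "K * (u / r) * D * 8 \<le> D * C * (u / r)"
        using mult_right_mono[OF C(2), of "D * (u / r)"] u r by (simp add: D_def mult_ac)
      then have "K * (u / r) * D \<le> D * C * (u / r) / 8"
        by (simp only: pos_le_divide_eq zero_less_numeral)
      also have "D * C * (u / r) / 8 \<le> a * r / u * (u / r) / 8"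
        using DC u r by (intro divide_right_mono mult_right_mono) auto
      also have "\<dots> = a / 8" using u r by simp
      finally show ?thesis .
    qed
    moreover have "\<bar>t' - t\<bar> \<le> a / (8 * u)"
    proof -
      have "D * 40 \<le> a * r / u" using DC \<open>D * 40 \<le> D * C\<close> by linarith
      then have "5 * D / r \<le> a / (8 * u)"
        using u r by (simp add: field_simps)
      then show ?thesis using t'(2) by linarith
    qed
    ultimately show "\<exists>u' t'. u' > 0 \<and> y = polar_pt \<alpha> u' t' \<and> \<bar>u' - u\<bar> \<le> a / 8 \<and> \<bar>t' - t\<bar> \<le> a / (8 * u)"
      by blast
  qed
qed

text \<open>The intermediate point with coordinates (u, t') splits the difference into a radial
  part, estimated by the mean value theorem, and a chord, which is at most the arc.\<close>

lemma polar_pt_dist_le: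
  assumes \<alpha>: "0 < \<alpha>"
  obtains C where "C \<ge> 1" "\<And>u v t t'. \<lbrakk>0 < u; u / 2 \<le> v; v \<le> 2 * u\<rbrakk> \<Longrightarrow>
     norm (polar_pt \<alpha> u t - polar_pt \<alpha> v t') \<le> C * u powr (- \<alpha> - 1) * \<bar>u - v\<bar> + u powr - \<alpha> * \<bar>t - t'\<bar>"
proof -
  define K where "K = \<bar>- \<alpha>\<bar> * 2 powr \<bar>- \<alpha> - 1\<bar>"
  have K: "K \<ge> 0" by (simp add: K_def)
  show thesis
  proof (rule that[of "K + 1"])
    fix u v t t' :: real
    assume uv: "0 < u" "u / 2 \<le> v" "v \<le> 2 * u"
    have "polar_pt \<alpha> u t - polar_pt \<alpha> v t'
        = (u powr - \<alpha> - v powr - \<alpha>) *\<^sub>R ray t' + u powr - \<alpha> *\<^sub>R (ray t - ray t')"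
      by (simp add: polar_pt_def algebra_simps)
    also have "norm \<dots> \<le> \<bar>u powr - \<alpha> - v powr - \<alpha>\<bar> + u powr - \<alpha> * norm (ray t - ray t')"
      by (rule order_trans[OF norm_triangle_ineq]) simp
    also have "\<dots> \<le> K * u powr (- \<alpha> - 1) * \<bar>u - v\<bar> + u powr - \<alpha> * \<bar>t - t'\<bar>"
      unfolding K_def using uv
      by (intro add_mono powr_diff_bounds(1) mult_left_mono norm_ray_diff) auto
    also have "\<dots> \<le> (K + 1) * u powr (- \<alpha> - 1) * \<bar>u - v\<bar> + u powr - \<alpha> * \<bar>t - t'\<bar>"
      by (intro add_right_mono mult_right_mono) auto
    finally show "norm (polar_pt \<alpha> u t - polar_pt \<alpha> v t')
      \<le> (K + 1) * u powr (- \<alpha> - 1) * \<bar>u - v\<bar> + u powr - \<alpha> * \<bar>t - t'\<bar>" .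
  qed (use K in simp)
qed

text \<open>In this order: the point where the coils accumulate, the outer curve u = t, the inner
  curve u = t + \<pi>, and the segment at the initial angle that closes the first coil. Explicit
  curves permit counting and moving along the boundary, which the topological frontier does
  not.\<close>

definition spiral_boundary :: "real \<Rightarrow> (real^2) set" where
  "spiral_boundary \<alpha> = {0} \<union> {polar_pt \<alpha> t t | t. 2 * pi \<le> t} \<union> {polar_pt \<alpha> (t + pi) t | t. 2 * pi \<le> t}
     \<union> {polar_pt \<alpha> u (2 * pi) | u. 2 * pi \<le> u \<and> u \<le> 3 * pi}"

text \<open>Off the listed curves all inequalities that decide membership are strict. With a the
  smallest margin, a ball of radius a u^(-\<alpha>-1)/C changes u and t by at most a/8 and hence
  stays on one side.\<close>

lemma frontier_spiral_subset:
  assumes \<alpha>: "0 < \<alpha>"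
  shows "frontier (spiral \<alpha>) \<subseteq> spiral_boundary \<alpha>"
proof
  fix x assume fr: "x \<in> frontier (spiral \<alpha>)"
  show "x \<in> spiral_boundary \<alpha>"
  proof (rule ccontr)
    assume nb: "x \<notin> spiral_boundary \<alpha>"
    have notin: "x \<notin> interior (spiral \<alpha>)" "x \<notin> interior (- spiral \<alpha>)"
      using fr by (auto simp: frontier_def interior_complement)
    obtain C where C: "C \<ge> 1" "\<And>u t a y. \<lbrakk>1 \<le> u; 0 < a; a \<le> 1; norm (y - polar_pt \<alpha> u t) \<le> a * u powr (- \<alpha> - 1) / C\<rbrakk>
     \<Longrightarrow> \<exists>u' t'. u' > 0 \<and> y = polar_pt \<alpha> u' t' \<and> \<bar>u' - u\<bar> \<le> a / 8 \<and> \<bar>t' - t\<bar> \<le> a / (8 * u)"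
      using polar_pt_near[OF \<alpha>] by metis
    have "x \<noteq> 0" using nb by (auto simp: spiral_boundary_def)
    then obtain u t0 where u: "u > 0" and x0: "x = polar_pt \<alpha> u t0"
      using ex_polar_pt[OF \<alpha>] by metis
    have u2: "u \<ge> 2 * pi"
    proof (rule ccontr)
      assume "\<not> ?thesis"
      then have "norm x > (2 * pi) powr - \<alpha>"
        unfolding x0 norm_polar_pt using u \<alpha> by (intro powr_less_mono2_neg) auto
      then have "x \<in> {y. (2 * pi) powr - \<alpha> < norm y}" by simp
      moreover have "open {y::real^2. (2 * pi) powr - \<alpha> < norm y}"
        by (intro open_Collect_less continuous_intros)
      moreover have "{y. (2 * pi) powr - \<alpha> < norm y} \<subseteq> - spiral \<alpha>"
        using norm_spiral_less[OF \<alpha>] by fastforce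
      ultimately show False using notin(2) interiorI by blast
    qed
    \<comment> \<open>This turn gives the representative with t < u \<le> t + 2\<pi>; one period of
      u contains one strip of the spiral and one gap.\<close>
    define k where "k = \<lceil>(u - t0) / (2 * pi)\<rceil> - 1"
    define t where "t = t0 + 2 * pi * of_int k"
    have x: "x = polar_pt \<alpha> u t" by (simp add: x0 t_def polar_pt_add_2pi)
    have "of_int k < (u - t0) / (2 * pi)" "(u - t0) / (2 * pi) \<le> of_int k + 1"
      unfolding k_def by linarith+
    then have tu: "t < u" "u \<le> t + 2 * pi"
      by (auto simp: t_def field_simps)
    have t0: "t \<ge> 0" using tu u2 by linarith
    have u1: "1 \<le> u" using u2 two_pi_gt by linarith
    have near: "\<exists>u' t'. u' > 0 \<and> y = polar_pt \<alpha> u' t' \<and> \<bar>u' - u\<bar> \<le> a / 8 \<and> \<bar>t' - t\<bar> \<le> a / 8"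
      if a: "0 < a" "a \<le> 1" and y: "y \<in> ball x (a * u powr (- \<alpha> - 1) / C)" for a y
    proof -
      have "norm (y - polar_pt \<alpha> u t) \<le> a * u powr (- \<alpha> - 1) / C"
        using y by (simp add: x dist_norm norm_minus_commute)
      from C(2)[OF u1 a this] obtain u' t' where *: "u' > 0" "y = polar_pt \<alpha> u' t'" "\<bar>u' - u\<bar> \<le> a / 8"
        "\<bar>t' - t\<bar> \<le> a / (8 * u)" by blast
      have "a / (8 * u) \<le> a / 8" using a u1 by (intro divide_left_mono) auto
      then show ?thesis using * by force
    qed
    have rad: "a * u powr (- \<alpha> - 1) / C > 0" if "a > 0" for a
      using that C u1 by simp
    have int: "x \<in> interior T" if "ball x (a * u powr (- \<alpha> - 1) / C) \<subseteq> T" "a > 0" for a T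
      using that rad[of a] by (meson centre_in_ball interiorI open_ball)
    \<comment> \<open>Equality would put the point on the outer curve of the next turn.\<close>
    have u_ne: "u \<noteq> t + 2 * pi"
    proof
      assume "u = t + 2 * pi"
      then have "x = polar_pt \<alpha> u u" using polar_pt_add_2pi[of \<alpha> u t 1] x by simp
      then show False using nb u2 by (auto simp: spiral_boundary_def)
    qed
    show False
    proof (cases "t \<ge> 2 * pi")
      case t2: True
      have u_ne2: "u \<noteq> t + pi" using nb x t2 by (auto simp: spiral_boundary_def)
      show ?thesis
      proof (cases "u < t + pi")
        case True
        have "t \<noteq> 2 * pi"
        proof
          assume "t = 2 * pi"
          then have "2 * pi \<le> u" "u \<le> 3 * pi" "x = polar_pt \<alpha> u (2 * pi)"
            using tu True x by auto
          then show False using nb by (auto simp: spiral_boundary_def)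
        qed
        define a where "a = Min {1, t - 2 * pi, u - t, t + pi - u}"
        have a: "a > 0" "a \<le> 1" "a \<le> t - 2 * pi" "a \<le> u - t" "a \<le> t + pi - u"
          using True tu t2 \<open>t \<noteq> 2 * pi\<close> by (auto simp: a_def)
        have "ball x (a * u powr (- \<alpha> - 1) / C) \<subseteq> spiral \<alpha>"
        proof
          fix y assume "y \<in> ball x (a * u powr (- \<alpha> - 1) / C)"
          from near[OF a(1,2) this] obtain u' t' where y: "u' > 0" "y = polar_pt \<alpha> u' t'"
            "\<bar>u' - u\<bar> \<le> a / 8" "\<bar>t' - t\<bar> \<le> a / 8" by blast
          show "y \<in> spiral \<alpha>"
            unfolding y(2) using y(3,4) a by (intro polar_pt_in_spiral[OF \<alpha>]) linarith+
        qed
        then show False using int a(1) notin by blast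
      next
        case False
        define a where "a = Min {1, u - (t + pi), t + 2 * pi - u}"
        have a: "a > 0" "a \<le> 1" "a \<le> u - (t + pi)" "a \<le> t + 2 * pi - u"
          using False tu u_ne u_ne2 by (auto simp: a_def)
        have "ball x (a * u powr (- \<alpha> - 1) / C) \<subseteq> - spiral \<alpha>"
        proof
          fix y assume "y \<in> ball x (a * u powr (- \<alpha> - 1) / C)"
          from near[OF a(1,2) this] obtain u' t' where y: "u' > 0" "y = polar_pt \<alpha> u' t'"
            "\<bar>u' - u\<bar> \<le> a / 8" "\<bar>t' - t\<bar> \<le> a / 8" by blast
          have "y \<notin> spiral \<alpha>"
            unfolding y(2) using y(3,4) a by (intro polar_pt_notin_spiral_gap[OF \<alpha> y(1)]) linarith+
          then show "y \<in> - spiral \<alpha>" by simp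
        qed
        then show False using int a(1) notin by blast
      qed
    next
      case False
      define a where "a = Min {1, 2 * pi - t, t + 2 * pi - u}"
      have a: "a > 0" "a \<le> 1" "a \<le> 2 * pi - t" "a \<le> t + 2 * pi - u"
        using False tu u_ne by (auto simp: a_def)
      have "ball x (a * u powr (- \<alpha> - 1) / C) \<subseteq> - spiral \<alpha>"
      proof
        fix y assume "y \<in> ball x (a * u powr (- \<alpha> - 1) / C)"
        from near[OF a(1,2) this] obtain u' t' where y: "u' > 0" "y = polar_pt \<alpha> u' t'"
          "\<bar>u' - u\<bar> \<le> a / 8" "\<bar>t' - t\<bar> \<le> a / 8" by blast
        have "y \<notin> spiral \<alpha>"
          unfolding y(2) using y(3,4) a by (intro polar_pt_notin_spiral_outside[OF \<alpha> y(1)]) linarith+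
        then show "y \<in> - spiral \<alpha>" by simp
      qed
      then show False using int a(1) notin by blast
    qed
  qed
qed

lemma spiral_boundary_cases:
  assumes \<alpha>: "0 < \<alpha>" and "z \<in> spiral_boundary \<alpha>" "z \<noteq> 0"
  obtains (outer) t where "2 * pi \<le> t" "z = polar_pt \<alpha> t t"
  | (inner) t where "2 * pi \<le> t" "z = polar_pt \<alpha> (t + pi) t"
  | (segment) u where "2 * pi \<le> u" "u \<le> 3 * pi" "z = polar_pt \<alpha> u (2 * pi)"
proof -
  have "(\<exists>t. 2 * pi \<le> t \<and> z = polar_pt \<alpha> t t) \<or> (\<exists>t. 2 * pi \<le> t \<and> z = polar_pt \<alpha> (t + pi) t) \<or>
    (\<exists>u. 2 * pi \<le> u \<and> u \<le> 3 * pi \<and> z = polar_pt \<alpha> u (2 * pi))"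
    using assms by (auto simp: spiral_boundary_def)
  then show thesis using outer inner segment by blast
qed

lemma norm_spiral_boundary:
  assumes \<alpha>: "0 < \<alpha>" and z: "z \<in> spiral_boundary \<alpha>"
  shows "norm z \<le> (2 * pi) powr - \<alpha>"
proof (cases "z = 0")
  case False
  have "u powr - \<alpha> \<le> (2 * pi) powr - \<alpha>" if "2 * pi \<le> u" for u
    using that \<alpha> by (intro powr_mono2') auto
  moreover obtain u t where "2 * pi \<le> u" "z = polar_pt \<alpha> u t"
    using spiral_boundary_cases[OF \<alpha> z False] by (metis add_increasing2 pi_ge_zero)
  ultimately show ?thesis by simp
qed simp

text \<open>The ball is connected and open, so it contains no point of the boundary and cannot meet
  both the spiral and its complement.\<close>

lemma ball_infdist_boundary:
  assumes \<alpha>: "0 < \<alpha>"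
  shows "ball x (infdist x (spiral_boundary \<alpha>)) \<subseteq> spiral \<alpha> \<or>
    ball x (infdist x (spiral_boundary \<alpha>)) \<inter> spiral \<alpha> = {}"
proof (rule ccontr)
  let ?B = "ball x (infdist x (spiral_boundary \<alpha>))"
  assume "\<not> ?thesis"
  then have "?B \<inter> spiral \<alpha> \<noteq> {}" "?B - spiral \<alpha> \<noteq> {}" by auto
  then have "?B \<inter> frontier (spiral \<alpha>) \<noteq> {}"
    by (intro connected_Int_frontier) auto
  then obtain z where "z \<in> ?B" "z \<in> spiral_boundary \<alpha>"
    using frontier_spiral_subset[OF \<alpha>] by blast
  then show False using infdist_le[of z "spiral_boundary \<alpha>" x] by simp
qed


subsection \<open>Thickness\<close>

lemma norm_polar_pt_powr:
  assumes "0 < \<alpha>"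
  shows "norm (polar_pt \<alpha> u t) powr (1 + 1 / \<alpha>) = u powr (- \<alpha> - 1)"
proof -
  have "- \<alpha> * (1 + 1 / \<alpha>) = - \<alpha> - 1" using assms by (simp add: distrib_left)
  then show ?thesis by (simp only: norm_polar_pt powr_powr)
qed

text \<open>At a nonzero boundary point the coil has width comparable to w = |z|^(1+1/\<alpha>).
  Changing the coordinates by multiples of a = h/w, with the angular change divided by u where
  necessary, leads to either side at distance of order h; the bound h \<le> c0 w keeps the next
  boundary curve out of reach.\<close>

lemma two_sided_balls:
  assumes \<alpha>: "0 < \<alpha>"
  obtains C c0 where "C \<ge> 1" "0 < c0" "c0 \<le> 1"
    "\<And>z h. \<lbrakk>z \<in> spiral_boundary \<alpha>; z \<noteq> 0; 0 < h; h \<le> c0 * norm z powr (1 + 1 / \<alpha>)\<rbrakk> \<Longrightarrow>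
       (\<exists>y. dist y z \<le> C * h \<and> ball y (h / C) \<subseteq> spiral \<alpha>) \<and>
       (\<exists>y. dist y z \<le> C * h \<and> ball y (h / C) \<subseteq> - spiral \<alpha>)"
proof -
  obtain C1 where C1: "C1 \<ge> 1" "\<And>u t a y. \<lbrakk>1 \<le> u; 0 < a; a \<le> 1; norm (y - polar_pt \<alpha> u t) \<le> a * u powr (- \<alpha> - 1) / C1\<rbrakk>
     \<Longrightarrow> \<exists>u' t'. u' > 0 \<and> y = polar_pt \<alpha> u' t' \<and> \<bar>u' - u\<bar> \<le> a / 8 \<and> \<bar>t' - t\<bar> \<le> a / (8 * u)"
    using polar_pt_near[OF \<alpha>] by metis
  obtain C2 where C2: "C2 \<ge> 1" "\<And>u v t t'. \<lbrakk>0 < u; u / 2 \<le> v; v \<le> 2 * u\<rbrakk> \<Longrightarrow>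
     norm (polar_pt \<alpha> u t - polar_pt \<alpha> v t') \<le> C2 * u powr (- \<alpha> - 1) * \<bar>u - v\<bar> + u powr - \<alpha> * \<bar>t - t'\<bar>"
    using polar_pt_dist_le[OF \<alpha>] by metis
  define C where "C = C1 * 2 powr (\<alpha> + 1) + 2 * C2 + 24"
  have pw: "2 powr (\<alpha> + 1) \<ge> 1" using \<alpha> by (intro ge_one_powr_ge_zero) auto
  then have "C1 * 2 powr (\<alpha> + 1) \<ge> 1" using C1(1) by (metis mult_mono' mult_1 zero_le_one)
  then have C: "C \<ge> C1 * 2 powr (\<alpha> + 1)" "C \<ge> 2 * C2 + 24" "C \<ge> 1" "C > 0"
    using C2(1) by (auto simp: C_def)
  show thesis
  proof (rule that[of C "1 / 10"])
    fix z h
    assume z: "z \<in> spiral_boundary \<alpha>" "z \<noteq> 0" and h: "0 < h" "h \<le> 1 / 10 * norm z powr (1 + 1 / \<alpha>)"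
    \<comment> \<open>It suffices to name a centre (U, t0) around which a coordinate box lies in T.
      An angular shift is weighted by u, because moving the angle by 1/u costs the same length w as
      moving u by 1. The two inequalities on a/(4u) and a/u hold since u > 6; stated inside, they
      make the later checks linear.\<close>
    have key: "(\<exists>y. dist y z \<le> C * h \<and> ball y (h / C) \<subseteq> T)"
      if zu: "z = polar_pt \<alpha> u t" "u \<ge> 2 * pi"
        and UT: "\<And>a. 0 < a \<Longrightarrow> a \<le> 1 / 10 \<Longrightarrow> \<exists>U t0. \<bar>U - u\<bar> \<le> 2 * a \<and> \<bar>t0 - t\<bar> * u \<le> 24 * a \<and>
            (\<forall>u' t'. u' > 0 \<longrightarrow> \<bar>u' - U\<bar> \<le> a / 8 \<longrightarrow> \<bar>t' - t0\<bar> \<le> a / (4 * u) \<longrightarrow> a / (4 * u) \<le> a / 24 \<longrightarrow>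
              a / u \<le> a / 6 \<longrightarrow> polar_pt \<alpha> u' t' \<in> T)"
      for u t T
    proof -
      have u6: "u > 6" using zu two_pi_gt by linarith
      define w where "w = u powr (- \<alpha> - 1)"
      have w: "w > 0" using u6 by (simp add: w_def)
      have uw: "u powr - \<alpha> = u * w"
        using u6 by (simp add: w_def powr_diff)
      have "norm z powr (1 + 1 / \<alpha>) = w"
        using norm_polar_pt_powr[OF \<alpha>, of u t] zu by (simp only: w_def)
      then have hw: "h \<le> 1 / 10 * w" using h by simp
      define a where "a = h / w"
      have a: "0 < a" "a \<le> 1 / 10" "h = a * w"
        using h w hw by (auto simp: a_def pos_divide_le_eq)
      obtain U t0 where U: "\<bar>U - u\<bar> \<le> 2 * a" "\<bar>t0 - t\<bar> * u \<le> 24 * a" and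
        T: "\<And>u' t'. \<lbrakk>u' > 0; \<bar>u' - U\<bar> \<le> a / 8; \<bar>t' - t0\<bar> \<le> a / (4 * u); a / (4 * u) \<le> a / 24; a / u \<le> a / 6\<rbrakk> \<Longrightarrow>
            polar_pt \<alpha> u' t' \<in> T"
        using UT[OF a(1,2)] by blast
      have U2: "u / 2 \<le> U" "U \<le> 2 * u" "1 \<le> U" using U(1) a(2) u6 by linarith+
      have au: "a / (4 * u) \<le> a / 24" "a / u \<le> a / 6"
      proof -
        show "a / (4 * u) \<le> a / 24" using a u6 by (intro divide_left_mono) auto
        show "a / u \<le> a / 6" using a u6 by (intro divide_left_mono) auto
      qed
      have "dist (polar_pt \<alpha> U t0) z \<le> C2 * w * \<bar>u - U\<bar> + u * w * \<bar>t - t0\<bar>"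
        using C2(2)[of u U t t0] U2 u6 by (simp add: zu(1) dist_norm norm_minus_commute w_def[symmetric] uw)
      also have "\<dots> \<le> C2 * w * (2 * a) + w * (24 * a)"
      proof (intro add_mono mult_left_mono)
        show "\<bar>u - U\<bar> \<le> 2 * a" using U by (simp add: abs_minus_commute)
        show "u * w * \<bar>t - t0\<bar> \<le> w * (24 * a)"
          using mult_left_mono[OF U(2), of w] w by (simp add: abs_minus_commute mult_ac)
      qed (use C2(1) w in simp)
      also have "\<dots> = (2 * C2 + 24) * h" by (simp add: a(3) algebra_simps)
      also have "\<dots> \<le> C * h" using C(2) h(1) by (intro mult_right_mono) auto
      finally have d: "dist (polar_pt \<alpha> U t0) z \<le> C * h" .
      have "ball (polar_pt \<alpha> U t0) (h / C) \<subseteq> T"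
      proof
        fix y assume "y \<in> ball (polar_pt \<alpha> U t0) (h / C)"
        then have "norm (y - polar_pt \<alpha> U t0) \<le> h / C"
          by (simp add: dist_norm norm_minus_commute)
        also have "\<dots> \<le> a * U powr (- \<alpha> - 1) / C1"
        proof -
          have "2 powr - \<bar>- \<alpha> - 1\<bar> * w \<le> U powr (- \<alpha> - 1)"
            unfolding w_def using U2 u6 by (intro powr_between) auto
          moreover have "\<bar>- \<alpha> - 1\<bar> = \<alpha> + 1" using \<alpha> by simp
          ultimately have "w / 2 powr (\<alpha> + 1) \<le> U powr (- \<alpha> - 1)"
            by (simp only: powr_minus_divide mult_1_left times_divide_eq_left)
          then have "a * (w / 2 powr (\<alpha> + 1)) / C1 \<le> a * U powr (- \<alpha> - 1) / C1"
            using a C1(1) by (intro divide_right_mono mult_left_mono) auto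
          moreover have "h / C \<le> h / (C1 * 2 powr (\<alpha> + 1))"
            using C h(1) C1(1) by (intro divide_left_mono) auto
          ultimately show ?thesis by (simp add: a(3) mult.commute)
        qed
        finally obtain u' t' where y: "u' > 0" "y = polar_pt \<alpha> u' t'" "\<bar>u' - U\<bar> \<le> a / 8" "\<bar>t' - t0\<bar> \<le> a / (8 * U)"
          using C1(2)[of U a y t0] U2 a by auto
        have "a / (8 * U) \<le> a / (4 * u)" using U2 u6 a by (intro divide_left_mono) auto
        then show "y \<in> T" unfolding y(2) using y au by (intro T) (assumption | linarith)+
      qed
      then show ?thesis using d by blast
    qed
    from \<alpha> z show "(\<exists>y. dist y z \<le> C * h \<and> ball y (h / C) \<subseteq> spiral \<alpha>) \<and>
       (\<exists>y. dist y z \<le> C * h \<and> ball y (h / C) \<subseteq> - spiral \<alpha>)"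
    proof (cases rule: spiral_boundary_cases)
      case (outer t)
      have t0: "t > 6" using outer(1) two_pi_gt by linarith
      show ?thesis
      proof (intro conjI key[OF outer(2,1)])
        fix a :: real assume a: "0 < a" "a \<le> 1 / 10"
        show "\<exists>U t0. \<bar>U - t\<bar> \<le> 2 * a \<and> \<bar>t0 - t\<bar> * t \<le> 24 * a \<and>
            (\<forall>u' t'. u' > 0 \<longrightarrow> \<bar>u' - U\<bar> \<le> a / 8 \<longrightarrow> \<bar>t' - t0\<bar> \<le> a / (4 * t) \<longrightarrow> a / (4 * t) \<le> a / 24 \<longrightarrow>
              a / t \<le> a / 6 \<longrightarrow> polar_pt \<alpha> u' t' \<in> spiral \<alpha>)"
        \<comment> \<open>The angular shift a/t exceeds the tolerance a/(4t), so the angle stays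
          above 2\<pi> even at the starting point of the curve, while it is too small to violate t'
          < u'.\<close>
        proof (rule exI[of _ "t + 2 * a"], rule exI[of _ "t + a / t"], intro conjI allI impI)
          fix u' t' assume *: "u' > 0" "\<bar>u' - (t + 2 * a)\<bar> \<le> a / 8" "\<bar>t' - (t + a / t)\<bar> \<le> a / (4 * t)"
            "a / (4 * t) \<le> a / 24" "a / t \<le> a / 6"
          have "a / (4 * t) \<le> a / t" using a t0 by (intro divide_left_mono) auto
          then show "polar_pt \<alpha> u' t' \<in> spiral \<alpha>"
            using * outer(1) a two_pi_gt by (intro polar_pt_in_spiral \<alpha>) linarith+
        qed (use a t0 in auto)
        show "\<exists>U t0. \<bar>U - t\<bar> \<le> 2 * a \<and> \<bar>t0 - t\<bar> * t \<le> 24 * a \<and>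
            (\<forall>u' t'. u' > 0 \<longrightarrow> \<bar>u' - U\<bar> \<le> a / 8 \<longrightarrow> \<bar>t' - t0\<bar> \<le> a / (4 * t) \<longrightarrow> a / (4 * t) \<le> a / 24 \<longrightarrow>
              a / t \<le> a / 6 \<longrightarrow> polar_pt \<alpha> u' t' \<in> - spiral \<alpha>)"
        proof (rule exI[of _ "t - 2 * a"], rule exI[of _ t], intro conjI allI impI)
          fix u' t' assume *: "u' > 0" "\<bar>u' - (t - 2 * a)\<bar> \<le> a / 8" "\<bar>t' - t\<bar> \<le> a / (4 * t)"
            "a / (4 * t) \<le> a / 24"
          have "polar_pt \<alpha> u' t' \<notin> spiral \<alpha>"
            using * outer(1) a two_pi_gt by (intro polar_pt_notin_spiral \<alpha>) linarith+
          then show "polar_pt \<alpha> u' t' \<in> - spiral \<alpha>" by simp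
        qed (use a t0 in auto)
      qed
    next
      case (inner t)
      define v where "v = t + pi"
      have z: "z = polar_pt \<alpha> v t" using inner(2) by (simp add: v_def)
      have t0: "t > 6" "v > 0" "v \<ge> 2 * pi" using inner(1) two_pi_gt v_def by linarith+
      show ?thesis
      proof (intro conjI key[OF z t0(3)])
        fix a :: real assume a: "0 < a" "a \<le> 1 / 10"
        show "\<exists>U t0. \<bar>U - v\<bar> \<le> 2 * a \<and> \<bar>t0 - t\<bar> * v \<le> 24 * a \<and>
            (\<forall>u' t'. u' > 0 \<longrightarrow> \<bar>u' - U\<bar> \<le> a / 8 \<longrightarrow> \<bar>t' - t0\<bar> \<le> a / (4 * v) \<longrightarrow> a / (4 * v) \<le> a / 24 \<longrightarrow>
              a / v \<le> a / 6 \<longrightarrow> polar_pt \<alpha> u' t' \<in> spiral \<alpha>)"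
        proof (rule exI[of _ "v - 2 * a"], rule exI[of _ "t + a / v"], intro conjI allI impI)
          fix u' t' assume *: "u' > 0" "\<bar>u' - (v - 2 * a)\<bar> \<le> a / 8" "\<bar>t' - (t + a / v)\<bar> \<le> a / (4 * v)"
            "a / (4 * v) \<le> a / 24" "a / v \<le> a / 6"
          have "a / (4 * v) \<le> a / v" "0 \<le> a / v" using a t0 by (auto intro!: divide_left_mono)
          then show "polar_pt \<alpha> u' t' \<in> spiral \<alpha>"
            using * inner(1) a two_pi_gt v_def by (intro polar_pt_in_spiral \<alpha>) linarith+
        qed (use a t0 in auto)
        show "\<exists>U t0. \<bar>U - v\<bar> \<le> 2 * a \<and> \<bar>t0 - t\<bar> * v \<le> 24 * a \<and>
            (\<forall>u' t'. u' > 0 \<longrightarrow> \<bar>u' - U\<bar> \<le> a / 8 \<longrightarrow> \<bar>t' - t0\<bar> \<le> a / (4 * v) \<longrightarrow> a / (4 * v) \<le> a / 24 \<longrightarrow>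
              a / v \<le> a / 6 \<longrightarrow> polar_pt \<alpha> u' t' \<in> - spiral \<alpha>)"
        proof (rule exI[of _ "v + 2 * a"], rule exI[of _ t], intro conjI allI impI)
          fix u' t' assume *: "u' > 0" "\<bar>u' - (v + 2 * a)\<bar> \<le> a / 8" "\<bar>t' - t\<bar> \<le> a / (4 * v)"
            "a / (4 * v) \<le> a / 24"
          have "polar_pt \<alpha> u' t' \<notin> spiral \<alpha>"
            using * inner(1) a two_pi_gt v_def by (intro polar_pt_notin_spiral_gap \<alpha>) linarith+
          then show "polar_pt \<alpha> u' t' \<in> - spiral \<alpha>" by simp
        qed (use a t0 in auto)
      qed
    next
      case (segment u)
      have u0: "u > 6" "u < 12" using segment(1,2) two_pi_gt by linarith+
      show ?thesis
      proof (intro conjI key[OF segment(3,1)])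
        fix a :: real assume a: "0 < a" "a \<le> 1 / 10"
        \<comment> \<open>Move u towards the middle of the interval from 2\<pi> to 3\<pi>, so that
          the two corners of the first coil are covered as well.\<close>
        define U where "U = (if u \<le> 5 / 2 * pi then u + 2 * a else u - 2 * a)"
        show "\<exists>U t0. \<bar>U - u\<bar> \<le> 2 * a \<and> \<bar>t0 - 2 * pi\<bar> * u \<le> 24 * a \<and>
            (\<forall>u' t'. u' > 0 \<longrightarrow> \<bar>u' - U\<bar> \<le> a / 8 \<longrightarrow> \<bar>t' - t0\<bar> \<le> a / (4 * u) \<longrightarrow> a / (4 * u) \<le> a / 24 \<longrightarrow>
              a / u \<le> a / 6 \<longrightarrow> polar_pt \<alpha> u' t' \<in> spiral \<alpha>)"
        proof (rule exI[of _ U], rule exI[of _ "2 * pi + a / u"], intro conjI allI impI)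
          fix u' t' assume *: "u' > 0" "\<bar>u' - U\<bar> \<le> a / 8" "\<bar>t' - (2 * pi + a / u)\<bar> \<le> a / (4 * u)"
            "a / (4 * u) \<le> a / 24" "a / u \<le> a / 6"
          have "a / (4 * u) \<le> a / u" using a u0 by (intro divide_left_mono) auto
          then show "polar_pt \<alpha> u' t' \<in> spiral \<alpha>"
            using * segment(1,2) a two_pi_gt unfolding U_def
            by (intro polar_pt_in_spiral \<alpha>; cases "u \<le> 5 / 2 * pi"; simp only: if_True if_False; linarith)
        qed (use a u0 in \<open>auto simp: U_def\<close>)
        show "\<exists>U t0. \<bar>U - u\<bar> \<le> 2 * a \<and> \<bar>t0 - 2 * pi\<bar> * u \<le> 24 * a \<and>
            (\<forall>u' t'. u' > 0 \<longrightarrow> \<bar>u' - U\<bar> \<le> a / 8 \<longrightarrow> \<bar>t' - t0\<bar> \<le> a / (4 * u) \<longrightarrow> a / (4 * u) \<le> a / 24 \<longrightarrow>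
              a / u \<le> a / 6 \<longrightarrow> polar_pt \<alpha> u' t' \<in> - spiral \<alpha>)"
        \<comment> \<open>Angles below 2\<pi> precede the spiral. Here u < 12, so the weighted shift
          2au is at most 24a, which is the origin of the 24 in \<open>key\<close>.\<close>
        proof (rule exI[of _ u], rule exI[of _ "2 * pi - 2 * a"], intro conjI allI impI)
          fix u' t' assume *: "u' > 0" "\<bar>u' - u\<bar> \<le> a / 8" "\<bar>t' - (2 * pi - 2 * a)\<bar> \<le> a / (4 * u)"
            "a / (4 * u) \<le> a / 24"
          have "polar_pt \<alpha> u' t' \<notin> spiral \<alpha>"
            using * segment(1,2) a two_pi_gt by (intro polar_pt_notin_spiral_outside \<alpha>) linarith+
          then show "polar_pt \<alpha> u' t' \<in> - spiral \<alpha>" by simp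
        next
          have "2 * a * u \<le> 2 * a * 12" using a u0 by (intro mult_left_mono) auto
          then show "\<bar>2 * pi - 2 * a - 2 * pi\<bar> * u \<le> 24 * a" using a by simp
        qed (use a u0 in auto)
      qed
    qed
  qed (use C in auto)
qed

text \<open>The midline of a coil has margin \<pi>/2 to both curves, and t \<ge> 4\<pi> keeps it
  away from the initial segment. With the midline of the gap it supplies the test points that no
  one-sided ball may contain together.\<close>

lemma spiral_interior_point:
  assumes \<alpha>: "0 < \<alpha>" and t: "t \<ge> 4 * pi"
  shows "polar_pt \<alpha> (t + pi / 2) t \<in> interior (spiral \<alpha>)"
proof -
  obtain C where C: "C \<ge> 1" "\<And>u t a y. \<lbrakk>1 \<le> u; 0 < a; a \<le> 1; norm (y - polar_pt \<alpha> u t) \<le> a * u powr (- \<alpha> - 1) / C\<rbrakk>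
     \<Longrightarrow> \<exists>u' t'. u' > 0 \<and> y = polar_pt \<alpha> u' t' \<and> \<bar>u' - u\<bar> \<le> a / 8 \<and> \<bar>t' - t\<bar> \<le> a / (8 * u)"
    using polar_pt_near[OF \<alpha>] by metis
  define u where "u = t + pi / 2"
  have u: "u \<ge> 1" using t two_pi_gt by (simp add: u_def)
  define r where "r = 1 * u powr (- \<alpha> - 1) / C"
  have r: "r > 0" using u C by (simp add: r_def)
  have "ball (polar_pt \<alpha> u t) r \<subseteq> spiral \<alpha>"
  proof
    fix y assume "y \<in> ball (polar_pt \<alpha> u t) r"
    then have "norm (y - polar_pt \<alpha> u t) \<le> 1 * u powr (- \<alpha> - 1) / C"
      unfolding r_def by (simp add: dist_norm norm_minus_commute)
    from C(2)[OF u _ _ this] obtain u' t' where y: "y = polar_pt \<alpha> u' t'" "\<bar>u' - u\<bar> \<le> 1 / 8"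
      "\<bar>t' - t\<bar> \<le> 1 / (8 * u)" by auto
    have "1 / (8 * u) \<le> 1 / 8" using u by (intro divide_left_mono) auto
    then show "y \<in> spiral \<alpha>"
      unfolding y(1) using y(2,3) t two_pi_gt u_def by (intro polar_pt_in_spiral \<alpha>) linarith+
  qed
  then show ?thesis
    using r by (simp flip: u_def add: mem_interior) blast
qed

lemma spiral_gap_point:
  assumes \<alpha>: "0 < \<alpha>" and t: "t \<ge> 4 * pi"
  shows "polar_pt \<alpha> (t + 3 * pi / 2) t \<notin> interior (spiral \<alpha>)"
proof -
  have "polar_pt \<alpha> (t + 3 * pi / 2) t \<notin> spiral \<alpha>"
    using t two_pi_gt by (intro polar_pt_notin_spiral_gap \<alpha>) linarith+
  then show ?thesis using interior_subset by blast
qed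

text \<open>Within a multiple of the coil width around any point of the region of the coils lie both
  a point of the interior and a point outside it, so a one-sided ball cannot be larger. Farther out
  the right-hand side is bounded below, and h \<le> 1 suffices.\<close>

lemma one_sided_ball_radius:
  assumes \<alpha>: "0 < \<alpha>"
  obtains C where "C \<ge> 1"
    "\<And>x h. \<lbrakk>0 < h; h \<le> 1; ball x h \<subseteq> interior (spiral \<alpha>) \<or> ball x h \<subseteq> - interior (spiral \<alpha>)\<rbrakk>
      \<Longrightarrow> h \<le> C * norm x powr (1 + 1 / \<alpha>)"
proof -
  \<comment> \<open>The test points below have parameter v with u \<le> v \<le> u + 6\<pi>, which is
    at most 4u for u \<ge> 2\<pi>; this is the ratio 4. The factor 24 in C exceeds 6\<pi>.\<close>
  define K where "K = \<bar>- \<alpha>\<bar> * 4 powr \<bar>- \<alpha> - 1\<bar>"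
  have K: "K \<ge> 0" by (simp add: K_def)
  define C where "C = (2 * pi) powr (\<alpha> + 1) + 24 * K + 1"
  have C: "C \<ge> 1" "C \<ge> (2 * pi) powr (\<alpha> + 1)" "C > 24 * K" using K by (auto simp: C_def intro: add_nonneg_pos)
  show thesis
  proof (rule that[OF C(1)])
    fix x h
    assume h: "0 < h" "h \<le> 1" and b: "ball x h \<subseteq> interior (spiral \<alpha>) \<or> ball x h \<subseteq> - interior (spiral \<alpha>)"
    have far: "\<not> (dist x (polar_pt \<alpha> (t + pi / 2) t) < h \<and> dist x (polar_pt \<alpha> (t + 3 * pi / 2) t) < h)"
      if "t \<ge> 4 * pi" for t
      using b spiral_interior_point[OF \<alpha> that] spiral_gap_point[OF \<alpha> that]
      by (meson ComplD mem_ball subsetD)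
    show "h \<le> C * norm x powr (1 + 1 / \<alpha>)"
    proof (cases "x = 0")
      case True
      \<comment> \<open>Coils this far in have radius below h, so every ball about the origin
        contains both kinds of test points and the case is contradictory.\<close>
      define t where "t = 4 * pi + h powr (- 1 / \<alpha>)"
      have t: "t \<ge> 4 * pi" by (simp add: t_def)
      have lt: "(t + b) powr - \<alpha> < h" if "b > 0" for b
      proof -
        have "0 < h powr (- 1 / \<alpha>)" using h by simp
        moreover have "h powr (- 1 / \<alpha>) < t + b" using that two_pi_gt by (simp add: t_def)
        ultimately have "(t + b) powr - \<alpha> < (h powr (- 1 / \<alpha>)) powr - \<alpha>"
          using \<alpha> by (intro powr_less_mono2_neg) auto
        then show ?thesis using h \<alpha> by (simp add: powr_minus_inverse)
      qed
      show ?thesis using far[OF t] lt[of "pi / 2"] lt[of "3 * pi / 2"] True by simp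
    next
      case False
      obtain u t0 where u: "u = norm x powr (- 1 / \<alpha>)" "u > 0" and x0: "x = polar_pt \<alpha> u t0"
        using ex_polar_pt[OF \<alpha> False] by metis
      have nx: "norm x powr (1 + 1 / \<alpha>) = u powr (- \<alpha> - 1)"
        unfolding x0 by (rule norm_polar_pt_powr[OF \<alpha>])
      show ?thesis
      proof (cases "u \<ge> 2 * pi")
        case False
        then have "(2 * pi) powr (- \<alpha> - 1) \<le> u powr (- \<alpha> - 1)"
          using u \<alpha> by (intro powr_mono2') auto
        then have "C * (2 * pi) powr (- \<alpha> - 1) \<le> C * u powr (- \<alpha> - 1)"
          using C(1) by (intro mult_left_mono) auto
        moreover have "(2 * pi) powr (\<alpha> + 1) * (2 * pi) powr (- \<alpha> - 1) \<le> C * (2 * pi) powr (- \<alpha> - 1)"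
          using C(2) by (intro mult_right_mono) auto
        moreover have "(2 * pi) powr (\<alpha> + 1) * (2 * pi) powr (- \<alpha> - 1) = 1"
          by (simp add: powr_add[symmetric])
        ultimately show ?thesis using h nx by simp
      next
        case u2: True
        \<comment> \<open>The turn with u + 2\<pi> \<le> t < u + 4\<pi>: then t \<ge> 4\<pi>, as the
          test points demand, and they lie on the same ray as x, at most 6\<pi> further in the
          parameter.\<close>
        define k where "k = \<lceil>(u - t0) / (2 * pi)\<rceil> + 1"
        define t where "t = t0 + 2 * pi * of_int k"
        have x: "x = polar_pt \<alpha> u t" by (simp add: x0 t_def polar_pt_add_2pi)
        have "of_int k < (u - t0) / (2 * pi) + 2" "(u - t0) / (2 * pi) + 1 \<le> of_int k"
          unfolding k_def by linarith+
        then have tu: "t < u + 4 * pi" "u + 2 * pi \<le> t"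
          by (auto simp: t_def field_simps)
        have t4: "t \<ge> 4 * pi" using tu u2 by linarith
        have d: "dist x (polar_pt \<alpha> v t) < C * u powr (- \<alpha> - 1)" if v: "u \<le> v" "v \<le> u + 6 * pi" for v
        proof -
          have "dist x (polar_pt \<alpha> v t) = \<bar>u powr - \<alpha> - v powr - \<alpha>\<bar>"
            unfolding x polar_pt_def dist_norm scaleR_diff_left[symmetric] by simp
          also have "\<dots> \<le> K * u powr (- \<alpha> - 1) * \<bar>u - v\<bar>"
            unfolding K_def using v u2 u(2) by (intro powr_diff_bounds(1)) linarith+
          also have "\<dots> \<le> K * u powr (- \<alpha> - 1) * 24"
            using v two_pi_gt K by (intro mult_left_mono) auto
          also have "\<dots> < C * u powr (- \<alpha> - 1)"
            using mult_strict_right_mono[OF C(3), of "u powr (- \<alpha> - 1)"] u by (simp add: mult_ac)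
          finally show ?thesis .
        qed
        have "dist x (polar_pt \<alpha> (t + pi / 2) t) < C * u powr (- \<alpha> - 1)"
          "dist x (polar_pt \<alpha> (t + 3 * pi / 2) t) < C * u powr (- \<alpha> - 1)"
          using tu two_pi_gt by (intro d; linarith)+
        then show ?thesis using far[OF t4] unfolding nx by linarith
      qed
    qed
  qed
qed

text \<open>A one-sided ball forces h \<le> C2 |x|^\<sigma>. If |x| \<le> 2|z|, then a fixed
  fraction of h is an admissible scale at z. Otherwise |x| is at most 2ch, and since \<sigma> > 1
  the two inequalities bound h from below, so that two fixed balls serve all remaining
  cases.\<close>

lemma spiral_corkscrew:
  assumes \<alpha>: "0 < \<alpha>" and c: "c \<ge> 1"
  obtains C where "C \<ge> 1"
    "\<And>x z h. \<lbrakk>0 < h; h \<le> 1; ball x h \<subseteq> interior (spiral \<alpha>) \<or> ball x h \<subseteq> - interior (spiral \<alpha>);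
       z \<in> spiral_boundary \<alpha>; dist x z \<le> c * h\<rbrakk> \<Longrightarrow>
       (\<exists>y. dist x y \<le> C * h \<and> ball y (h / C) \<subseteq> interior (spiral \<alpha>)) \<and>
       (\<exists>y. dist x y \<le> C * h \<and> ball y (h / C) \<subseteq> - interior (spiral \<alpha>))"
proof -
  define \<sigma> where "\<sigma> = 1 + 1 / \<alpha>"
  have \<sigma>: "\<sigma> > 1" using \<alpha> by (simp add: \<sigma>_def)
  obtain C1 c0 where C1: "C1 \<ge> 1" "0 < c0" "c0 \<le> 1"
    "\<And>z h. \<lbrakk>z \<in> spiral_boundary \<alpha>; z \<noteq> 0; 0 < h; h \<le> c0 * norm z powr \<sigma>\<rbrakk> \<Longrightarrow>
       (\<exists>y. dist y z \<le> C1 * h \<and> ball y (h / C1) \<subseteq> spiral \<alpha>) \<and>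
       (\<exists>y. dist y z \<le> C1 * h \<and> ball y (h / C1) \<subseteq> - spiral \<alpha>)"
    using two_sided_balls[OF \<alpha>] unfolding \<sigma>_def by metis
  obtain C2 where C2: "C2 \<ge> 1" 
    "\<And>x h. \<lbrakk>0 < h; h \<le> 1; ball x h \<subseteq> interior (spiral \<alpha>) \<or> ball x h \<subseteq> - interior (spiral \<alpha>)\<rbrakk>
      \<Longrightarrow> h \<le> C2 * norm x powr \<sigma>"
    using one_sided_ball_radius[OF \<alpha>] unfolding \<sigma>_def by metis
  have Sball: "ball y r \<subseteq> interior (spiral \<alpha>)" if "ball y r \<subseteq> spiral \<alpha>" for y r
    using that by (simp add: interior_maximal)
  have Cball: "ball y r \<subseteq> - interior (spiral \<alpha>)" if "ball y r \<subseteq> - spiral \<alpha>" for y r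
    using that interior_subset by blast
  \<comment> \<open>From |x| \<le> 2|z| follows h \<le> C2 2^\<sigma> |z|^\<sigma>, so h/B is at
    most c0 |z|^\<sigma>.\<close>
  define B where "B = C2 * 2 powr \<sigma> / c0"
  have "2 powr \<sigma> \<ge> 1" using \<sigma> by (intro ge_one_powr_ge_zero) auto
  then have "C2 * 2 powr \<sigma> \<ge> 1" using C2(1) by (metis mult_mono' mult_1 zero_le_one)
  then have B: "B \<ge> 1" using C1 by (simp add: B_def pos_le_divide_eq)
  define z0 where "z0 = polar_pt \<alpha> (2 * pi) (2 * pi)"
  have z0: "z0 \<in> spiral_boundary \<alpha>" "z0 \<noteq> 0"
    using two_pi_gt by (auto simp: z0_def spiral_boundary_def polar_pt_def) (metis norm_ray norm_zero zero_neq_one)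
  define h0 where "h0 = c0 * norm z0 powr \<sigma>"
  have h0: "h0 > 0" using z0 C1 by (simp add: h0_def)
  obtain y1 y2 where y0: "ball y1 (h0 / C1) \<subseteq> spiral \<alpha>" "ball y2 (h0 / C1) \<subseteq> - spiral \<alpha>"
    using C1(4)[OF z0 h0] by (auto simp: h0_def)
  \<comment> \<open>Lower bound for h in the second case: h \<le> C2 (2ch)^\<sigma> with \<sigma> =
    1 + 1/\<alpha> gives 1 \<le> C2 (2c)^\<sigma> h^(1/\<alpha>), solved for h.\<close>
  define \<eta> where "\<eta> = (C2 * (2 * c) powr \<sigma>) powr (- \<alpha>)"
  have pos: "C2 * (2 * c) powr \<sigma> > 0" using C2 c by simp
  have \<eta>: "\<eta> > 0" using C2(1) c by (simp add: \<eta>_def)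
  define C where "C = (c + C1) + C1 * B + C1 / h0 + (2 * c + (norm y1 + norm y2) / \<eta>)"
  have nn: "0 \<le> C1 * B" "0 \<le> C1 / h0" "0 \<le> (norm y1 + norm y2) / \<eta>"
    using C1 B h0 \<eta> by (auto simp: less_imp_le add_nonneg_nonneg)
  have C: "C \<ge> c + C1" "C \<ge> C1 * B" "C \<ge> C1 / h0" "C \<ge> 2 * c + (norm y1 + norm y2) / \<eta>" "C \<ge> 1" "C > 0"
    using nn C1(1) c by (auto simp: C_def)
  show thesis
  proof (rule that[OF C(5)])
    fix x z h
    assume h: "0 < h" "h \<le> 1" and b: "ball x h \<subseteq> interior (spiral \<alpha>) \<or> ball x h \<subseteq> - interior (spiral \<alpha>)"
      and z: "z \<in> spiral_boundary \<alpha>" "dist x z \<le> c * h"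
    have hx: "h \<le> C2 * norm x powr \<sigma>" by (rule C2(2)[OF h b])
    then have x0: "x \<noteq> 0" using h by auto
    show "(\<exists>y. dist x y \<le> C * h \<and> ball y (h / C) \<subseteq> interior (spiral \<alpha>)) \<and>
       (\<exists>y. dist x y \<le> C * h \<and> ball y (h / C) \<subseteq> - interior (spiral \<alpha>))"
    proof (cases "norm x \<le> 2 * norm z")
      case True
      then have z0: "z \<noteq> 0" using x0 by auto
      define h' where "h' = h / B"
      have h': "0 < h'" "h' \<le> h" using h B by (auto simp: h'_def pos_divide_le_eq)
      have "norm x powr \<sigma> \<le> (2 * norm z) powr \<sigma>"
        using True \<sigma> by (intro powr_mono2) auto
      also have "\<dots> = 2 powr \<sigma> * norm z powr \<sigma>" by (simp add: powr_mult)
      finally have "C2 * norm x powr \<sigma> \<le> C2 * (2 powr \<sigma> * norm z powr \<sigma>)"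
        using C2(1) by (intro mult_left_mono) auto
      then have "h \<le> (c0 * norm z powr \<sigma>) * B"
        using hx C1(2) by (simp add: B_def mult_ac)
      then have "h' \<le> c0 * norm z powr \<sigma>"
        using B by (simp add: h'_def pos_divide_le_eq)
      from C1(4)[OF z(1) z0 h'(1) this] obtain w1 w2 where
        w: "dist w1 z \<le> C1 * h'" "ball w1 (h' / C1) \<subseteq> spiral \<alpha>" "dist w2 z \<le> C1 * h'" "ball w2 (h' / C1) \<subseteq> - spiral \<alpha>"
        by blast
      have "C1 * h' \<le> C1 * h" using h' C1 by (intro mult_left_mono) auto
      then have "dist x z + C1 * h' \<le> (c + C1) * h" using z(2) by (simp add: distrib_right)
      also have "\<dots> \<le> C * h" using C(1) h by (intro mult_right_mono) auto
      finally have d: "dist x w1 \<le> C * h" "dist x w2 \<le> C * h"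
        using w(1,3) dist_triangle2[of x w1 z] dist_triangle2[of x w2 z] by (auto simp: dist_commute)
      have "h / C \<le> h / (C1 * B)" using C h C1 B by (intro divide_left_mono) auto
      then have "h / C \<le> h' / C1" by (simp add: h'_def mult.commute)
      then have "ball w1 (h / C) \<subseteq> ball w1 (h' / C1)" "ball w2 (h / C) \<subseteq> ball w2 (h' / C1)"
        by (auto intro: subset_ball)
      then show ?thesis using d w Sball Cball by (meson order_trans)
    next
      case False
      then have "norm x < 2 * norm x - 2 * norm z" by simp
      also have "\<dots> \<le> 2 * dist x z" using norm_triangle_ineq2[of x z] by (simp add: dist_norm)
      also have "\<dots> \<le> 2 * c * h" using z by simp
      finally have xc: "norm x < 2 * c * h" .
      have "norm x powr \<sigma> \<le> (2 * c * h) powr \<sigma>"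
        using xc \<sigma> by (intro powr_mono2) auto
      then have "C2 * norm x powr \<sigma> \<le> C2 * (2 * c * h) powr \<sigma>"
        using C2 by (intro mult_left_mono) auto
      also have "C2 * (2 * c * h) powr \<sigma> = C2 * (2 * c) powr \<sigma> * h powr \<sigma>"
        using c h by (simp add: powr_mult)
      also have "h powr \<sigma> = h * h powr (1 / \<alpha>)"
        using h by (simp add: \<sigma>_def powr_add)
      finally have "h * 1 \<le> h * (C2 * (2 * c) powr \<sigma> * h powr (1 / \<alpha>))"
        using hx by (simp add: mult_ac)
      then have "1 \<le> C2 * (2 * c) powr \<sigma> * h powr (1 / \<alpha>)"
        using h by (simp only: mult_le_cancel_left_pos)
      then have "1 powr \<alpha> \<le> (C2 * (2 * c) powr \<sigma> * h powr (1 / \<alpha>)) powr \<alpha>"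
        using \<alpha> by (intro powr_mono2) auto
      also have "\<dots> = (C2 * (2 * c) powr \<sigma>) powr \<alpha> * (h powr (1 / \<alpha>)) powr \<alpha>"
        by (rule powr_mult)
      also have "(h powr (1 / \<alpha>)) powr \<alpha> = h" using h \<alpha> by (simp add: powr_powr)
      finally have hh: "1 powr \<alpha> \<le> (C2 * (2 * c) powr \<sigma>) powr \<alpha> * h" .
      have h\<eta>: "\<eta> \<le> h"
      proof -
        have "(C2 * (2 * c) powr \<sigma>) powr \<alpha> > 0" using C2(1) c by simp
        then show ?thesis
          using hh unfolding \<eta>_def powr_minus_divide
          by (simp only: pos_divide_le_eq powr_one_eq_one mult.commute)
      qed
      have dy: "dist x y \<le> C * h" if "norm y \<le> norm y1 + norm y2" for y
      proof -
        have "dist x y \<le> norm x + norm y" by (simp add: dist_norm norm_triangle_ineq4)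
        also have "\<dots> \<le> 2 * c * h + (norm y1 + norm y2) / \<eta> * \<eta>" using xc that \<eta> by simp
        also have "\<dots> \<le> 2 * c * h + (norm y1 + norm y2) / \<eta> * h"
          using h\<eta> \<eta> by (intro add_left_mono mult_left_mono) auto
        also have "\<dots> \<le> C * h" using mult_right_mono[OF C(4), of h] h by (simp add: distrib_right)
        finally show ?thesis .
      qed
      have "h / C \<le> 1 / C" using h C by (intro divide_right_mono) auto
      also have "\<dots> \<le> h0 / C1" using C C1 h0 by (simp add: field_simps)
      finally have "ball y1 (h / C) \<subseteq> ball y1 (h0 / C1)" "ball y2 (h / C) \<subseteq> ball y2 (h0 / C1)"
        by (simp_all add: subset_ball)
      then have "ball y1 (h / C) \<subseteq> interior (spiral \<alpha>) \<and> ball y2 (h / C) \<subseteq> - interior (spiral \<alpha>)"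
        using y0 Sball Cball by (meson order_trans)
      then show ?thesis using dy[of y1] dy[of y2] by auto
    qed
  qed
qed

section \<open>From balls to axis-parallel cubes\<close>

lemma cube_center_dist:
  fixes a :: "real^2"
  assumes "p \<in> cube a l"
  shows "dist (a + (l / 2) *\<^sub>R One) p \<le> l"
proof -
  have p: "\<bar>(a + (l / 2) *\<^sub>R One - p) $ i\<bar> \<le> l / 2" for i
  proof -
    have "a $ i \<le> p $ i" "p $ i \<le> (a + l *\<^sub>R One) $ i"
      using assms by (auto simp only: cube_def mem_box_cart)
    then show ?thesis
      unfolding vector_minus_component vector_add_component vector_scaleR_component One_nth real_scaleR_def by linarith
  qed
  have "dist (a + (l / 2) *\<^sub>R One) p \<le> (\<Sum>i\<in>UNIV. \<bar>(a + (l / 2) *\<^sub>R One - p) $ i\<bar>)"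
    unfolding dist_norm by (rule norm_le_l1_cart)
  also have "\<dots> \<le> (\<Sum>i\<in>(UNIV::2 set). l / 2)" by (intro sum_mono p)
  finally show ?thesis by simp
qed

lemma ball_subset_cube:
  fixes a :: "real^2"
  shows "ball (a + (l / 2) *\<^sub>R One) (l / 2) \<subseteq> cube a l"
proof
  fix p assume "p \<in> ball (a + (l / 2) *\<^sub>R One) (l / 2)"
  then have d: "norm (a + (l / 2) *\<^sub>R One - p) < l / 2" by (simp add: dist_norm)
  have "a $ i \<le> p $ i \<and> p $ i \<le> (a + l *\<^sub>R One) $ i" for i
  proof -
    have "\<bar>(a + (l / 2) *\<^sub>R One - p) $ i\<bar> < l / 2"
      using component_le_norm_cart[of "a + (l / 2) *\<^sub>R One - p" i] d by linarith
    then show ?thesis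
      unfolding vector_minus_component vector_add_component vector_scaleR_component One_nth real_scaleR_def by linarith
  qed
  then show "p \<in> cube a l" unfolding cube_def mem_box_cart by blast
qed

text \<open>The set A is arbitrary because the lemma is applied twice: to the domain for E-thickness
  and to its complement for I-thickness. Balls inscribed in the given cube feed the corkscrew
  condition, and a cube inscribed in the ball found there is the answer.\<close>

lemma corkscrew_cube:
  fixes A :: "(real^2) set"
  assumes fr: "frontier A \<noteq> {}" and c: "c \<ge> 1"
    and corkscrew: "\<And>c. c \<ge> 1 \<Longrightarrow> \<exists>C\<ge>1. \<forall>h x z. 0 < h \<longrightarrow> h \<le> 1 \<longrightarrow> ball x h \<subseteq> A \<longrightarrow> z \<in> frontier A \<longrightarrow>
       dist x z \<le> c * h \<longrightarrow> (\<exists>y. dist x y \<le> C * h \<and> ball y (h / C) \<subseteq> - A)"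
  shows "\<exists>C\<ge>1. \<forall>h a l. 0 < h \<longrightarrow> h \<le> 1 \<longrightarrow> cube a l \<subseteq> A \<longrightarrow> comparable c l h \<longrightarrow>
        comparable c (setdist (cube a l) (frontier A)) h \<longrightarrow>
        (\<exists>b l'. cube b l' \<subseteq> - A \<and> comparable C l' h \<and>
           comparable C (setdist (cube b l') (frontier A)) h \<and>
           comparable C (setdist (cube a l) (cube b l')) h)"
proof -
  have c4: "4 * c * c \<ge> 1" using c by (metis mult_mono' mult_1 one_le_numeral zero_le_one mult.assoc)
  obtain C1 where C1: "C1 \<ge> 1" "\<And>h x z. \<lbrakk>0 < h; h \<le> 1; ball x h \<subseteq> A; z \<in> frontier A; dist x z \<le> 4 * c * c * h\<rbrakk> \<Longrightarrow>
     (\<exists>y. dist x y \<le> C1 * h \<and> ball y (h / C1) \<subseteq> - A)"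
    using corkscrew[OF c4] by metis
  define C where "C = 8 * c * C1 + 2 * c"
  have "8 * c * C1 \<ge> 8 * c * 1" "8 * c * C1 \<ge> 8 * 1 * C1" using c C1(1) by (intro mult_mono; simp)+
  then have C: "C \<ge> 8 * c * C1" "C \<ge> C1 + 2 * c" "C \<ge> c" "C \<ge> 1" "C > 0"
    unfolding C_def using c C1(1) by linarith+
  show ?thesis
  proof (intro exI[of _ C] conjI allI impI C(4))
    fix h l :: real and a :: "real^2"
    assume h: "0 < h" "h \<le> 1" and sub: "cube a l \<subseteq> A" and l: "comparable c l h"
      and sd: "comparable c (setdist (cube a l) (frontier A)) h"
    have l2: "h / c \<le> l" "l \<le> c * h" using l by (auto simp: comparable_def)
    have "h / c > 0" using h c by simp
    then have l0: "l > 0" using l2 by linarith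
    define x where "x = a + (l / 2) *\<^sub>R One"
    have xcube: "x \<in> cube a l"
      using ball_subset_cube[of a l] l0 by (force simp: x_def)
    \<comment> \<open>Half of the smallest edge length that comparability allows, so the ball of
      this radius about the centre fits into the given cube.\<close>
    define H where "H = h / (2 * c)"
    have H: "0 < H" "H \<le> h" "H \<le> 1" "h = 2 * c * H" using h c by (auto simp: H_def field_simps)
    have Hl: "H \<le> l / 2" using l2(1) by (simp add: H_def)
    have ballA: "ball x H \<subseteq> A"
      using ball_subset_cube[of a l] subset_ball[OF Hl, of x] sub by (auto simp: x_def)
    have "compact (cube a l)" by (simp add: cube_def)
    then obtain p z where p: "p \<in> cube a l" "z \<in> frontier A" "dist p z = setdist (cube a l) (frontier A)"
      using setdist_compact_closed[of "cube a l" "frontier A"] fr xcube by (metis empty_iff frontier_closed)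
    have pz: "dist p z \<le> c * h" using sd p(3) by (simp add: comparable_def)
    have xz: "dist x z \<le> 2 * c * h"
      using dist_triangle[of x z p] cube_center_dist[OF p(1)] pz l2 unfolding x_def by linarith
    then have "dist x z \<le> 4 * c * c * H" by (simp add: H(4))
    then obtain y where y: "dist x y \<le> C1 * H" "ball y (H / C1) \<subseteq> - A"
      using C1(2)[OF H(1,3) ballA p(2)] by blast
    have "C1 * H \<le> C1 * h" using H C1 by (intro mult_left_mono) auto
    then have xy: "dist x y \<le> C1 * h" using y(1) by linarith
    \<comment> \<open>A quarter of the radius H/C1 of the ball found. The cube of edge \<rho> about
      its centre stays within \<rho> of it and so keeps distance at least 3\<rho> from the
      frontier.\<close>
    define \<rho> where "\<rho> = h / (8 * c * C1)"
    have \<rho>: "\<rho> > 0" "H / C1 = 4 * \<rho>" using h c C1 by (auto simp: \<rho>_def H_def)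
    have \<rho>C: "h / C \<le> \<rho>" "\<rho> \<le> h"
    proof -
      show "h / C \<le> \<rho>" unfolding \<rho>_def using C h c C1 by (intro divide_left_mono) auto
      have "8 * c * C1 \<ge> 1" using \<open>8 * c * C1 \<ge> 8 * c * 1\<close> c by linarith
      then have "h * 1 \<le> h * (8 * c * C1)" "0 < 8 * c * C1"
        using h by (auto simp only: mult_le_cancel_left_pos)
      then show "\<rho> \<le> h" unfolding \<rho>_def by (simp only: pos_divide_le_eq mult_1_right)
    qed
    define b where "b = y - (\<rho> / 2) *\<^sub>R One"
    have yb: "y = b + (\<rho> / 2) *\<^sub>R One" by (simp add: b_def)
    have near: "dist y q \<le> \<rho>" if "q \<in> cube b \<rho>" for q
      using cube_center_dist[OF that] by (simp add: yb)
    have ycube: "y \<in> cube b \<rho>"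
      using ball_subset_cube[of b \<rho>] \<rho> by (force simp: yb)
    have subB: "cube b \<rho> \<subseteq> - A"
    proof -
      have "cube b \<rho> \<subseteq> ball y (H / C1)" using near \<rho> by force
      then show ?thesis using y(2) by blast
    qed
    have "ball y (H / C1) \<inter> closure A = {}"
      using y(2) open_Int_closure_eq_empty[of "ball y (H / C1)" A] by auto
    then have far: "dist y w \<ge> 4 * \<rho>" if "w \<in> frontier A" for w
      using that \<rho> by (auto simp: frontier_def disjoint_iff not_less[symmetric])
    have Ch: "h \<le> C * h" "c * h \<le> C * h" "(C1 + 2 * c) * h \<le> C * h"
      using mult_right_mono[OF C(4), of h] mult_right_mono[OF C(3), of h] mult_right_mono[OF C(2), of h] h by auto
    show "\<exists>b l'. cube b l' \<subseteq> - A \<and> comparable C l' h \<and>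
           comparable C (setdist (cube b l') (frontier A)) h \<and>
           comparable C (setdist (cube a l) (cube b l')) h"
    proof (intro exI[of _ b] exI[of _ \<rho>] conjI subB)
      show "comparable C \<rho> h" using \<rho>C Ch by (auto simp: comparable_def)
      have "\<rho> \<le> setdist (cube b \<rho>) (frontier A)"
      proof (rule le_setdistI)
        fix q w assume q: "q \<in> cube b \<rho>" "w \<in> frontier A"
        show "\<rho> \<le> dist q w" using near[OF q(1)] far[OF q(2)] dist_triangle[of y w q] \<rho> by linarith
      qed (use ycube fr in auto)
      moreover have "setdist (cube b \<rho>) (frontier A) \<le> (C1 + 2 * c) * h"
        using setdist_le_dist[OF ycube p(2)] dist_triangle3[of y z x] xy xz by (simp add: distrib_right)
      ultimately show "comparable C (setdist (cube b \<rho>) (frontier A)) h"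
        using \<rho>C Ch by (auto simp: comparable_def)
      \<comment> \<open>A segment from the cube in A to the cube in the complement crosses the
        frontier, so the cubes are at least as far apart as the first one is from the
        frontier.\<close>
      have "setdist (cube a l) (frontier A) \<le> setdist (cube a l) (cube b \<rho>)"
      proof (rule le_setdistI)
        fix p q assume pq: "p \<in> cube a l" "q \<in> cube b \<rho>"
        have "closed_segment p q \<inter> frontier A \<noteq> {}"
          using pq sub subB by (intro connected_Int_frontier) (auto intro: ends_in_segment)
        then obtain w where w: "w \<in> closed_segment p q" "w \<in> frontier A" by blast
        have "dist p w \<le> dist p q" using dist_in_closed_segment[OF w(1)] by (simp add: dist_commute)
        then show "setdist (cube a l) (frontier A) \<le> dist p q"
          using setdist_le_dist[OF pq(1) w(2)] by linarith
      qed (use ycube xcube in auto)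
      moreover have "h / C \<le> h / c" using C h c by (intro divide_left_mono) auto
      moreover have "setdist (cube a l) (cube b \<rho>) \<le> C1 * h"
        using setdist_le_dist[OF xcube ycube] xy by linarith
      moreover have "C1 * h \<le> (C1 + 2 * c) * h" using h c by (simp add: distrib_right)
      ultimately show "comparable C (setdist (cube a l) (cube b \<rho>)) h"
        using sd Ch by (auto simp: comparable_def)
    qed
  qed
qed

lemma thick_interior_spiral:
  assumes \<alpha>: "0 < \<alpha>"
  shows "bounded (interior (spiral \<alpha>))" "thick (interior (spiral \<alpha>))"
proof -
  let ?E = "interior (spiral \<alpha>)"
  have "spiral \<alpha> \<subseteq> ball 0 1"
    using norm_spiral_less[OF \<alpha>] powr_two_pi_less_1[OF \<alpha>] by fastforce
  then show bdd: "bounded ?E"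
    using interior_subset bounded_subset[OF bounded_ball] by blast
  have ne: "?E \<noteq> {}" using spiral_interior_point[OF \<alpha>, of "4 * pi"] by blast
  have nU: "?E \<noteq> UNIV" using bdd not_bounded_UNIV by metis
  have fr: "frontier ?E \<noteq> {}" using ne nU frontier_eq_empty by blast
  have frb: "frontier ?E \<subseteq> spiral_boundary \<alpha>"
    using frontier_interior_subset frontier_spiral_subset[OF \<alpha>] by blast
  have nt: "nontrivial_domain ?E" using ne nU by (simp add: nontrivial_domain_def)
  have E: "\<exists>C\<ge>1. \<forall>h x z. 0 < h \<longrightarrow> h \<le> 1 \<longrightarrow> ball x h \<subseteq> ?E \<longrightarrow> z \<in> frontier ?E \<longrightarrow>
       dist x z \<le> c * h \<longrightarrow> (\<exists>y. dist x y \<le> C * h \<and> ball y (h / C) \<subseteq> - ?E)"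
   and I: "\<exists>C\<ge>1. \<forall>h x z. 0 < h \<longrightarrow> h \<le> 1 \<longrightarrow> ball x h \<subseteq> - ?E \<longrightarrow> z \<in> frontier ?E \<longrightarrow>
       dist x z \<le> c * h \<longrightarrow> (\<exists>y. dist x y \<le> C * h \<and> ball y (h / C) \<subseteq> - (- ?E))" if c: "c \<ge> 1" for c
  proof -
    obtain C where C: "C \<ge> 1"
      "\<And>x z h. \<lbrakk>0 < h; h \<le> 1; ball x h \<subseteq> ?E \<or> ball x h \<subseteq> - ?E;
       z \<in> spiral_boundary \<alpha>; dist x z \<le> c * h\<rbrakk> \<Longrightarrow>
       (\<exists>y. dist x y \<le> C * h \<and> ball y (h / C) \<subseteq> ?E) \<and>
       (\<exists>y. dist x y \<le> C * h \<and> ball y (h / C) \<subseteq> - ?E)"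
      using spiral_corkscrew[OF \<alpha> c] by metis
    show "\<exists>C\<ge>1. \<forall>h x z. 0 < h \<longrightarrow> h \<le> 1 \<longrightarrow> ball x h \<subseteq> ?E \<longrightarrow> z \<in> frontier ?E \<longrightarrow>
       dist x z \<le> c * h \<longrightarrow> (\<exists>y. dist x y \<le> C * h \<and> ball y (h / C) \<subseteq> - ?E)"
      using C frb by (intro exI[of _ C]) blast
    show "\<exists>C\<ge>1. \<forall>h x z. 0 < h \<longrightarrow> h \<le> 1 \<longrightarrow> ball x h \<subseteq> - ?E \<longrightarrow> z \<in> frontier ?E \<longrightarrow>
       dist x z \<le> c * h \<longrightarrow> (\<exists>y. dist x y \<le> C * h \<and> ball y (h / C) \<subseteq> - (- ?E))"
      unfolding double_complement using C frb by (intro exI[of _ C]) blast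
  qed
  have pw: "0 < 2 powr - real j \<and> 2 powr - real j \<le> 1" for j
    using powr_mono[of "- real j" 0 2] by simp
  have "E_thick ?E"
    unfolding E_thick_def
  \<comment> \<open>The corkscrew estimates hold for all scales h \<le> 1, so the threshold is j =
    0.\<close>
  proof (rule conjI[OF nt], rule exI[of _ 0], intro allI impI)
    fix c :: real assume c: "1 \<le> c"
    obtain C where C: "C \<ge> 1" "\<And>h a l. \<lbrakk>0 < h; h \<le> 1; cube a l \<subseteq> ?E; comparable c l h;
        comparable c (setdist (cube a l) (frontier ?E)) h\<rbrakk> \<Longrightarrow>
        (\<exists>b l'. cube b l' \<subseteq> - ?E \<and> comparable C l' h \<and>
           comparable C (setdist (cube b l') (frontier ?E)) h \<and>
           comparable C (setdist (cube a l) (cube b l')) h)"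
      using corkscrew_cube[OF fr c E] by metis
    show "\<exists>C\<ge>1. \<forall>j\<ge>0. \<forall>a l. cube a l \<subseteq> ?E \<and> comparable c l (2 powr - real j) \<and>
        comparable c (setdist (cube a l) (frontier ?E)) (2 powr - real j) \<longrightarrow>
        (\<exists>b l'. cube b l' \<subseteq> - ?E \<and> comparable C l' (2 powr - real j) \<and>
           comparable C (setdist (cube b l') (frontier ?E)) (2 powr - real j) \<and>
           comparable C (setdist (cube a l) (cube b l')) (2 powr - real j))"
      by (intro exI[of _ C] conjI C(1) allI impI) (use pw C(2) in blast)
  qed
  moreover have "I_thick ?E"
    unfolding I_thick_def
  proof (rule conjI[OF nt], rule exI[of _ 0], intro allI impI)
    fix c :: real assume c: "1 \<le> c"
    have fr': "frontier (- ?E) = frontier ?E" by (rule frontier_complement)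
    obtain C where C: "C \<ge> 1" "\<And>h a l. \<lbrakk>0 < h; h \<le> 1; cube a l \<subseteq> - ?E; comparable c l h;
        comparable c (setdist (cube a l) (frontier ?E)) h\<rbrakk> \<Longrightarrow>
        (\<exists>b l'. cube b l' \<subseteq> - (- ?E) \<and> comparable C l' h \<and>
           comparable C (setdist (cube b l') (frontier ?E)) h \<and>
           comparable C (setdist (cube a l) (cube b l')) h)"
      using corkscrew_cube[of "- ?E" c, unfolded fr', OF fr c I] by metis
    show "\<exists>C\<ge>1. \<forall>j\<ge>0. \<forall>a l. cube a l \<subseteq> - ?E \<and> comparable c l (2 powr - real j) \<and>
        comparable c (setdist (cube a l) (frontier ?E)) (2 powr - real j) \<longrightarrow>
        (\<exists>b l'. cube b l' \<subseteq> ?E \<and> comparable C l' (2 powr - real j) \<and>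
           comparable C (setdist (cube b l') (frontier ?E)) (2 powr - real j) \<and>
           comparable C (setdist (cube b l') (cube a l)) (2 powr - real j))"
    proof (intro exI[of _ C] conjI C(1) allI impI)
      fix j a l
      assume "cube a l \<subseteq> - ?E \<and> comparable c l (2 powr - real j) \<and>
        comparable c (setdist (cube a l) (frontier ?E)) (2 powr - real j)"
      then show "\<exists>b l'. cube b l' \<subseteq> ?E \<and> comparable C l' (2 powr - real j) \<and>
           comparable C (setdist (cube b l') (frontier ?E)) (2 powr - real j) \<and>
           comparable C (setdist (cube b l') (cube a l)) (2 powr - real j)"
        using C(2)[of "2 powr - real j" a l] pw[of j] by (simp add: setdist_sym[of "cube a l"])
    qed
  qed
  ultimately show "thick ?E" by (simp add: thick_def)
qed


subsection \<open>Neighbourhoods of the boundary\<close>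

lemma card_int_interval_le:
  fixes a b c :: real
  assumes "c > 0" "b \<ge> 0"
  shows "finite {n::int. \<bar>c * of_int n - a\<bar> \<le> b}"
    and "real (card {n::int. \<bar>c * of_int n - a\<bar> \<le> b}) \<le> 2 * b / c + 1"
proof -
  define l u where "l = (a - b) / c" and "u = (a + b) / c"
  have sub: "{n::int. \<bar>c * of_int n - a\<bar> \<le> b} \<subseteq> {\<lceil>l\<rceil>..\<lfloor>u\<rfloor>}"
  proof
    fix n :: int assume "n \<in> {n::int. \<bar>c * of_int n - a\<bar> \<le> b}"
    then have "a - b \<le> of_int n * c" "of_int n * c \<le> a + b" by (auto simp: abs_le_iff mult.commute)
    then have "l \<le> of_int n" "of_int n \<le> u"
      using assms by (auto simp: l_def u_def pos_divide_le_eq pos_le_divide_eq)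
    then show "n \<in> {\<lceil>l\<rceil>..\<lfloor>u\<rfloor>}" by (simp add: ceiling_le_iff le_floor_iff)
  qed
  then show "finite {n::int. \<bar>c * of_int n - a\<bar> \<le> b}" by (rule finite_subset) simp
  have "card {n::int. \<bar>c * of_int n - a\<bar> \<le> b} \<le> card {\<lceil>l\<rceil>..\<lfloor>u\<rfloor>}"
    using sub by (intro card_mono) auto
  also have "real (card {\<lceil>l\<rceil>..\<lfloor>u\<rfloor>}) \<le> u - l + 1"
  proof -
    have "u - l \<ge> 0" using assms by (simp add: u_def l_def diff_divide_distrib[symmetric])
    then show ?thesis by simp linarith
  qed
  also have "u - l = 2 * b / c" by (simp add: u_def l_def diff_divide_distrib[symmetric])
  finally show "real (card {n::int. \<bar>c * of_int n - a\<bar> \<le> b}) \<le> 2 * b / c + 1" by simp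
qed

lemma infdist_lessE:
  assumes "infdist x A < h" "A \<noteq> {}"
  obtains z where "z \<in> A" "dist x z < h"
  using assms by (auto simp: infdist_notempty cINF_less_iff)

lemma spiral_boundary_nonempty: "spiral_boundary \<alpha> \<noteq> {}"
  by (auto simp: spiral_boundary_def)

lemma polar_pt_eqD:
  assumes "0 < \<alpha>" "0 < u" "0 < u'" "polar_pt \<alpha> u t = polar_pt \<alpha> u' t'"
  shows "u = u'" "\<exists>k::int. t = t' + 2 * pi * of_int k"
proof -
  have "u powr - \<alpha> = u' powr - \<alpha>"
    using arg_cong[OF assms(4), of norm] by simp
  then have "(u powr - \<alpha>) powr - (1 / \<alpha>) = (u' powr - \<alpha>) powr - (1 / \<alpha>)" by simp
  then show "u = u'" using assms by (simp add: powr_powr)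
  then have "ray t = ray t'" using assms by (simp add: polar_pt_def)
  then show "\<exists>k::int. t = t' + 2 * pi * of_int k" by (simp add: ray_eq_iff)
qed

text \<open>In a disc of radius comparable to \<open>R\<close> around \<open>x0\<close> with \<open>R \<le> norm x0\<close>, the boundary consists of
  at most \<open>O(R / w + 1)\<close> arcs, where \<open>w = norm x0 powr (1 + 1/\<alpha>)\<close> is the width of the coils, and each
  arc has length \<open>O(R)\<close>.\<close>

lemma emeasure_boundary_nbhd:
  assumes \<alpha>: "0 < \<alpha>"
  obtains C where "C \<ge> 1"
    "\<And>x0 R h. \<lbrakk>0 < h; h \<le> R / 8; R \<le> 1; R \<le> norm x0; norm x0 \<le> 4; h \<le> norm x0 powr (1 + 1 / \<alpha>)\<rbrakk> \<Longrightarrow>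
      emeasure lborel {x \<in> cball x0 (3 * R / 4). infdist x (spiral_boundary \<alpha>) < h}
        \<le> ennreal (C * R * h * (R / norm x0 powr (1 + 1 / \<alpha>) + 1))"
proof -
  define \<sigma> where "\<sigma> = 1 + 1 / \<alpha>"
  have \<sigma>: "\<sigma> > 1" using \<alpha> by (simp add: \<sigma>_def)
  obtain C2 where C2: "C2 \<ge> 1" "\<And>u v t t'. \<lbrakk>0 < u; u / 2 \<le> v; v \<le> 2 * u\<rbrakk> \<Longrightarrow>
     norm (polar_pt \<alpha> u t - polar_pt \<alpha> v t') \<le> C2 * u powr (- \<alpha> - 1) * \<bar>u - v\<bar> + u powr - \<alpha> * \<bar>t - t'\<bar>"
    using polar_pt_dist_le[OF \<alpha>] by metis
  \<comment> \<open>The boundary points that matter are within 3R/4 + h \<le> 7R/8 of x0, and R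
    \<le> |x0|; their norms are thus at least |x0|/8, which is the ratio 8.\<close>
  define K where "K = \<bar>- (1 / \<alpha>)\<bar> * 8 powr \<bar>- (1 / \<alpha>) - 1\<bar>"
  have K: "K \<ge> 0" by (simp add: K_def)
  \<comment> \<open>K bounds the variation of u in units of R/w; the angle varies by at most
    5R/|x0|, and |x0| \<le> 4 turns this into 5 * 4^(1/\<alpha>) such units.\<close>
  define B where "B = K + 5 * 4 powr (1 / \<alpha>)"
  have B: "B \<ge> 0" using K by (simp add: B_def)
  \<comment> \<open>Moving along a curve to the nearest grid point costs at most (2 C2 + 2)h, and
    the passage from x to the boundary point costs less than h.\<close>
  define C3 where "C3 = 2 * C2 + 3"
  have C3: "C3 \<ge> 2" "C3 > 0" using C2 by (auto simp: C3_def)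
  define C where "C = (B + 2) * 11 * (pi * C3\<^sup>2)"
  have "pi * C3\<^sup>2 \<ge> 1 * 1"
    using two_pi_gt C3 by (intro mult_mono one_le_power) auto
  then have "(B + 2) * 11 * (pi * C3\<^sup>2) \<ge> 1 * 11 * 1"
    using B by (intro mult_mono) auto
  then have C: "C \<ge> 1" by (simp add: C_def)
  show thesis
  proof (rule that[OF C])
    fix x0 :: "real^2" and R h :: real
    assume h: "0 < h" "h \<le> R / 8" and R1: "R \<le> 1" and x0: "R \<le> norm x0" "norm x0 \<le> 4"
      and hw: "h \<le> norm x0 powr (1 + 1 / \<alpha>)"
    define \<rho> where "\<rho> = norm x0"
    have R: "R > 0" "R \<le> \<rho>" using h x0 by (auto simp: \<rho>_def)
    have \<rho>: "0 < \<rho>" "\<rho> \<le> 4" using R x0 by (auto simp: \<rho>_def)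
    have h\<rho>: "h / \<rho> \<le> 1 / 8" using h R \<rho> by (simp add: pos_divide_le_eq)
    define w where "w = \<rho> powr \<sigma>"
    have w: "w > 0" using \<rho> by (simp add: w_def)
    obtain u0 t0 where u0: "u0 = \<rho> powr - (1 / \<alpha>)" "u0 > 0" "x0 = polar_pt \<alpha> u0 t0"
      using ex_polar_pt[OF \<alpha>, of x0] \<rho> unfolding \<rho>_def by (metis norm_eq_zero less_irrefl minus_divide_left)
    have u0\<rho>: "u0 powr - \<alpha> = \<rho>" using u0 \<rho> \<alpha> by (simp add: powr_minus_inverse)
    \<comment> \<open>Both curves are the lines u - t = \<pi>n, the outer one with n even and the
      inner one with n odd. N lists the n that can occur near x0.\<close>
    define N where "N = {n::int. \<bar>pi * of_int n - (u0 - t0)\<bar> \<le> B * R / w}"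
    have N: "finite N" "real (card N) \<le> B * (R / w) + 1"
    proof -
      have b0: "0 \<le> B * R / w" using B R w by simp
      show "finite N" unfolding N_def using b0 by (intro card_int_interval_le) auto
      have "real (card N) \<le> 2 * (B * R / w) / pi + 1"
        unfolding N_def using b0 by (intro card_int_interval_le) auto
      also have "2 * (B * R / w) / pi \<le> B * R / w"
      proof -
        have "(B * R / w) * 2 \<le> (B * R / w) * pi"
          using b0 two_pi_gt by (intro mult_left_mono) auto
        then show ?thesis by (simp only: pos_divide_le_eq pi_gt_zero mult.commute[of 2])
      qed
      finally show "real (card N) \<le> B * (R / w) + 1" by simp
    qed
    have floor_le: "\<bar>1 * real_of_int \<lfloor>y\<rfloor> - 0\<bar> \<le> b + 1" if "\<bar>y\<bar> \<le> b" for y b :: real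
      using that by linarith
    \<comment> \<open>Indices of a grid with angular step h/|x0|, that is arc length h, reaching
      5R/h steps in both directions; the extra 1 allows for rounding down.\<close>
    define I where "I = {i::int. \<bar>1 * of_int i - 0\<bar> \<le> 5 * R / h + 1}"
    have I: "finite I" "real (card I) \<le> 11 * R / h"
    proof -
      have b0: "0 \<le> 5 * R / h + 1" using R h by (simp add: add_nonneg_nonneg)
      show "finite I" unfolding I_def using b0 by (intro card_int_interval_le) auto
      have "real (card I) \<le> 2 * (5 * R / h + 1) / 1 + 1"
        unfolding I_def using b0 by (intro card_int_interval_le) auto
      moreover have "R / h \<ge> 8" using h by (simp add: pos_le_divide_eq)
      ultimately show "real (card I) \<le> 11 * R / h" by simp
    qed
    \<comment> \<open>Grid points on the n-th line; \<open>z2\<close> below is the corresponding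
      grid on the first axis, which contains the initial segment. They need not be boundary points,
      only centres of a covering by balls of radius C3 h.\<close>
    define z1 where "z1 = (\<lambda>(n, i). polar_pt \<alpha> (t0 + real_of_int i * h / \<rho> + pi * real_of_int n) (t0 + real_of_int i * h / \<rho>))"
    define z2 where "z2 i = (x0 $ 1 + real_of_int i * h) *\<^sub>R ray 0" for i :: int
    define Z where "Z = z1 ` (N \<times> I) \<union> z2 ` I"
    have Z: "finite Z" "real (card Z) \<le> (B + 2) * (R / w + 1) * (11 * R / h)"
    proof -
      show "finite Z" using N I by (simp add: Z_def)
      have "card Z \<le> card (z1 ` (N \<times> I)) + card (z2 ` I)"
        unfolding Z_def by (rule card_Un_le)
      also have "\<dots> \<le> card (N \<times> I) + card I"
        using N I by (intro add_mono card_image_le) auto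
      also have "\<dots> = (card N + 1) * card I" by (simp add: card_cartesian_product)
      finally have "real (card Z) \<le> (real (card N) + 1) * real (card I)"
        by (metis of_nat_1 of_nat_add of_nat_le_iff of_nat_mult)
      also have "\<dots> \<le> (B * (R / w) + 1 + 1) * (11 * R / h)"
        using N I B R w by (intro mult_mono) (auto simp: add_nonneg_nonneg)
      also have "\<dots> \<le> (B + 2) * (R / w + 1) * (11 * R / h)"
      proof (intro mult_right_mono)
        have "B * y + 1 + 1 \<le> (B + 2) * (y + 1)" if "0 \<le> y" for y
          using that B by (simp add: algebra_simps)
        then show "B * (R / w) + 1 + 1 \<le> (B + 2) * (R / w + 1)"
          using R w by (metis divide_nonneg_pos less_imp_le)
      qed (use R h in simp)
      finally show "real (card Z) \<le> (B + 2) * (R / w + 1) * (11 * R / h)" .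
    qed
    have cover: "\<exists>y\<in>Z. dist y x < C3 * h"
      if x: "x \<in> cball x0 (3 * R / 4)" "infdist x (spiral_boundary \<alpha>) < h" for x
    proof -
      obtain z where z: "z \<in> spiral_boundary \<alpha>" "dist x z < h"
        using infdist_lessE[OF x(2) spiral_boundary_nonempty] by blast
      have zx0: "norm (z - x0) \<le> 7 * R / 8"
      proof -
        have "dist z x0 \<le> dist x z + dist x0 x" by (metis dist_commute dist_triangle add.commute)
        then show ?thesis using x(1) z(2) h by (simp add: dist_norm)
      qed
      have nz: "\<bar>norm z - \<rho>\<bar> \<le> 7 * R / 8"
        using norm_triangle_ineq3[of z x0] zx0 by (simp add: \<rho>_def)
      then have nz2: "norm z \<ge> \<rho> / 8" "norm z \<le> 2 * \<rho>" "norm z > 0" using R \<rho> by linarith+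
      then have z0: "z \<noteq> 0" by auto
      show ?thesis
      proof (cases "\<exists>u. 2 * pi \<le> u \<and> u \<le> 3 * pi \<and> z = polar_pt \<alpha> u (2 * pi)")
        case True
        then obtain u where u: "z = polar_pt \<alpha> u (2 * pi)" by blast
        define \<zeta> where "\<zeta> = u powr - \<alpha>"
        have "ray (2 * pi) = ray 0" using ray_add_2pi[of 0 1] by simp
        then have z\<zeta>: "z = \<zeta> *\<^sub>R ray 0" by (simp add: u polar_pt_def \<zeta>_def)
        define i where "i = \<lfloor>(\<zeta> - x0 $ 1) / h\<rfloor>"
        have "\<bar>(z - x0) $ 1\<bar> \<le> norm (z - x0)" by (rule component_le_norm_cart)
        then have "\<bar>\<zeta> - x0 $ 1\<bar> \<le> R" using zx0 R by (simp add: z\<zeta>)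
        then have "\<bar>(\<zeta> - x0 $ 1) / h\<bar> \<le> R / h" using h by (simp add: abs_divide divide_right_mono)
        moreover have "R / h \<le> 5 * R / h" using R h by (simp add: divide_right_mono)
        ultimately have "\<bar>(\<zeta> - x0 $ 1) / h\<bar> \<le> 5 * R / h" by (rule order_trans)
        then have "i \<in> I" unfolding I_def i_def by (intro CollectI floor_le)
        have "dist (z2 i) x < C3 * h"
        proof -
          have fl: "\<bar>(\<zeta> - x0 $ 1) / h - of_int i\<bar> \<le> 1" unfolding i_def by linarith
          have "z - z2 i = (\<zeta> - x0 $ 1 - of_int i * h) *\<^sub>R ray 0"
            by (simp add: z\<zeta> z2_def algebra_simps)
          then have "dist z (z2 i) = \<bar>\<zeta> - x0 $ 1 - of_int i * h\<bar>" by (simp add: dist_norm)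
          also have "\<zeta> - x0 $ 1 - of_int i * h = ((\<zeta> - x0 $ 1) / h - of_int i) * h"
            using h by (simp add: field_simps)
          also have "\<bar>\<dots>\<bar> \<le> 1 * h" using fl h by (simp add: abs_mult)
          finally have "dist (z2 i) x < 2 * h"
            using z(2) dist_triangle[of "z2 i" x z] by (simp add: dist_commute)
          also have "\<dots> \<le> C3 * h" using C3 h by simp
          finally show ?thesis .
        qed
        then show ?thesis using \<open>i \<in> I\<close> unfolding Z_def by blast
      next
        case False
        obtain T where T: "z = norm z *\<^sub>R ray T" "\<bar>T - t0\<bar> \<le> 5 * norm (z - x0) / \<rho>"
          using polar_angle_near[OF \<rho>(1), of z t0] u0 u0\<rho> by (metis polar_pt_def)
        define v where "v = norm z powr - (1 / \<alpha>)"
        have v: "v > 0" "v powr - \<alpha> = norm z" using nz2 \<alpha> by (auto simp: v_def powr_minus_inverse)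
        have zv: "z = polar_pt \<alpha> v T" using T(1) v by (simp add: polar_pt_def)
        have vu: "\<bar>v - u0\<bar> \<le> K * R / w"
        proof -
          have "\<bar>v - u0\<bar> \<le> K * \<rho> powr (- (1 / \<alpha>) - 1) * \<bar>norm z - \<rho>\<bar>"
            unfolding v_def u0(1) K_def using nz2 \<rho> by (intro powr_diff_bounds(1)) auto
          also have "\<dots> \<le> K * \<rho> powr (- (1 / \<alpha>) - 1) * R"
            using nz R K by (intro mult_left_mono) auto
          also have "- (1 / \<alpha>) - 1 = - \<sigma>" by (simp add: \<sigma>_def)
          finally show ?thesis by (simp add: powr_minus_divide w_def)
        qed
        have t\<rho>: "\<bar>T - t0\<bar> \<le> 5 * R / \<rho>"
        proof -
          have "5 * norm (z - x0) / \<rho> \<le> 5 * R / \<rho>"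
            using zx0 R \<rho> by (intro divide_right_mono) auto
          then show ?thesis using T(2) by linarith
        qed
        have "\<exists>n::int. v = T + pi * of_int n \<and> v \<ge> 2 * pi"
          using \<alpha> z(1) z0
        proof (cases rule: spiral_boundary_cases)
          case (outer s)
          have "s > 0" using outer(1) two_pi_gt by linarith
          then have "s = v" "\<exists>k::int. s = T + 2 * pi * of_int k"
            using polar_pt_eqD[OF \<alpha> _ v(1), of s s T] outer(2) zv by auto
          then obtain k :: int where "v = T + 2 * pi * of_int k" by blast
          then show ?thesis using outer(1) \<open>s = v\<close> by (intro exI[of _ "2 * k"]) simp
        next
          case (inner s)
          have "s + pi > 0" using inner(1) two_pi_gt by linarith
          then have "s + pi = v" "\<exists>k::int. s = T + 2 * pi * of_int k"
            using polar_pt_eqD[OF \<alpha> _ v(1), of "s + pi" s T] inner(2) zv by auto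
          then obtain k :: int where "v = T + 2 * pi * of_int k + pi" by blast
          moreover have "v \<ge> 2 * pi" using inner(1) \<open>s + pi = v\<close> pi_gt_zero by linarith
          ultimately show ?thesis by (intro exI[of _ "2 * k + 1"]) (simp add: algebra_simps)
        next
          case (segment u)
          then show ?thesis using False by blast
        qed
        then obtain n :: int where n: "v = T + pi * of_int n" "v \<ge> 2 * pi" by blast
        have "n \<in> N"
        proof -
          have "\<rho> powr (1 / \<alpha>) \<le> 4 powr (1 / \<alpha>)" using \<rho> \<alpha> by (intro powr_mono2) auto
          then have "\<rho> powr (1 / \<alpha>) / w \<le> 4 powr (1 / \<alpha>) / w" using w by (intro divide_right_mono) auto
          moreover have "\<rho> powr (1 / \<alpha>) / w = 1 / \<rho>"
            using \<rho> by (simp add: w_def \<sigma>_def powr_add)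
          ultimately have "5 * R * (1 / \<rho>) \<le> 5 * R * (4 powr (1 / \<alpha>) / w)" using R by (intro mult_left_mono) auto
          then have "5 * R / \<rho> \<le> 5 * 4 powr (1 / \<alpha>) * R / w" by (simp add: mult_ac)
          moreover have "B * R / w = K * R / w + 5 * 4 powr (1 / \<alpha>) * R / w"
            by (simp add: B_def distrib_right add_divide_distrib)
          moreover have "pi * of_int n - (u0 - t0) = (v - u0) - (T - t0)" using n by simp
          ultimately show ?thesis
            unfolding N_def using vu t\<rho> by simp
        qed
        define i where "i = \<lfloor>(T - t0) * \<rho> / h\<rfloor>"
        define t1 where "t1 = t0 + real_of_int i * h / \<rho>"
        have "i \<in> I"
        proof -
          have "\<bar>(T - t0) * \<rho>\<bar> \<le> 5 * R" using t\<rho> \<rho> by (simp add: abs_mult pos_le_divide_eq)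
          then have "\<bar>(T - t0) * \<rho> / h\<bar> \<le> 5 * R / h" using h by (simp add: abs_divide divide_right_mono)
          then show ?thesis unfolding I_def i_def by (intro CollectI floor_le)
        qed
        have Tt: "\<bar>T - t1\<bar> \<le> h / \<rho>"
        proof -
          have "\<bar>(T - t0) * \<rho> / h - of_int i\<bar> \<le> 1" unfolding i_def by linarith
          then have "\<bar>(T - t0) * \<rho> / h - of_int i\<bar> * (h / \<rho>) \<le> 1 * (h / \<rho>)"
            using h \<rho> by (intro mult_right_mono) auto
          also have "\<bar>(T - t0) * \<rho> / h - of_int i\<bar> * (h / \<rho>) = \<bar>((T - t0) * \<rho> / h - of_int i) * (h / \<rho>)\<bar>"
            using h \<rho> by (simp add: abs_mult)
          also have "((T - t0) * \<rho> / h - of_int i) * (h / \<rho>) = T - t1"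
            using h \<rho> by (simp add: t1_def field_simps)
          finally show ?thesis by simp
        qed
        define v1 where "v1 = t1 + pi * of_int n"
        have v1: "v - v1 = T - t1" by (simp add: v1_def n)
        have v6: "v > 6" using n two_pi_gt by linarith
        have Tt8: "\<bar>T - t1\<bar> \<le> 1 / 8" using Tt h\<rho> by linarith
        have "v / 2 \<le> v1" "v1 \<le> 2 * v" using v1 v6 Tt8 by linarith+
        then have "norm (polar_pt \<alpha> v T - polar_pt \<alpha> v1 t1) \<le> C2 * v powr (- \<alpha> - 1) * \<bar>v - v1\<bar> + v powr - \<alpha> * \<bar>T - t1\<bar>"
          using C2(2) v by blast
        also have "\<dots> \<le> C2 * (2 * \<rho>) * (h / \<rho>) + 2 * \<rho> * (h / \<rho>)"
        proof -
          have "v powr (- \<alpha> - 1) \<le> v powr - \<alpha>" using v6 by (intro powr_mono) auto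
          then have "v powr (- \<alpha> - 1) \<le> 2 * \<rho>" "v powr - \<alpha> \<le> 2 * \<rho>" using v nz2 by auto
          then show ?thesis unfolding v1 using Tt C2(1) \<rho> by (intro add_mono mult_mono mult_left_mono) auto
        qed
        also have "\<dots> = (2 * C2 + 2) * h" using \<rho> by (simp add: field_simps)
        finally have "dist z (polar_pt \<alpha> v1 t1) \<le> (2 * C2 + 2) * h" by (simp add: zv dist_norm)
        then have "dist (polar_pt \<alpha> v1 t1) x < (2 * C2 + 2) * h + h"
          using z(2) dist_triangle[of "polar_pt \<alpha> v1 t1" x z] by (simp add: dist_commute)
        then have "dist (z1 (n, i)) x < C3 * h" 
          by (simp add: z1_def v1_def t1_def C3_def algebra_simps)
        then show ?thesis using \<open>n \<in> N\<close> \<open>i \<in> I\<close> unfolding Z_def by blast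
      qed
    qed
    have "{x \<in> cball x0 (3 * R / 4). infdist x (spiral_boundary \<alpha>) < h} \<subseteq> (\<Union>y\<in>Z. ball y (C3 * h))"
      using cover by auto
    then have "emeasure lborel {x \<in> cball x0 (3 * R / 4). infdist x (spiral_boundary \<alpha>) < h}
        \<le> emeasure lborel (\<Union>y\<in>Z. ball y (C3 * h))"
      by (rule emeasure_mono) (simp add: borel_open open_UN)
    also have "\<dots> \<le> (\<Sum>y\<in>Z. emeasure lborel (ball y (C3 * h)))"
      using Z by (intro emeasure_subadditive_finite) auto
    also have "\<dots> = (\<Sum>y\<in>Z. ennreal (pi * (C3 * h)\<^sup>2))"
      using C3 h by (intro sum.cong refl) (simp add: emeasure_ball unit_ball_vol_2)
    also have "\<dots> = ennreal (real (card Z) * (pi * (C3 * h)\<^sup>2))"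
      by (simp add: ennreal_mult ennreal_of_nat_eq_real_of_nat)
    also have "\<dots> \<le> ennreal ((B + 2) * (R / w + 1) * (11 * R / h) * (pi * (C3 * h)\<^sup>2))"
      using Z by (intro ennreal_leI mult_right_mono) auto
    also have "(B + 2) * (R / w + 1) * (11 * R / h) * (pi * (C3 * h)\<^sup>2) = C * R * h * (R / w + 1)"
      using h by (simp add: C_def power2_eq_square)
    finally show "emeasure lborel {x \<in> cball x0 (3 * R / 4). infdist x (spiral_boundary \<alpha>) < h}
        \<le> ennreal (C * R * h * (R / norm x0 powr (1 + 1 / \<alpha>) + 1))"
      by (simp add: w_def \<rho>_def \<sigma>_def)
  qed
qed

section \<open>Integrals of a negative power of the distance to the boundary\<close>

lemma ennreal_le_suminf: "f j \<le> (\<Sum>j. f j :: ennreal)"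
  using sum_le_suminf[of f "{j}"] by simp

lemma geometric_sum_le:
  fixes r :: real
  assumes "0 \<le> r" "r < 1"
  shows "(\<Sum>i<n. r ^ i) \<le> 1 / (1 - r)"
proof -
  have "(\<Sum>i<n. r ^ i) \<le> (\<Sum>i. r ^ i)"
    using assms by (intro sum_le_suminf summable_geometric) auto
  then show ?thesis using assms by (simp add: suminf_geometric)
qed

text \<open>The model of a sum over scales that peaks at a critical level J and decays geometrically
  on both sides; the bound is independent of J.\<close>

lemma two_sided_geometric_sum_le:
  fixes r :: real
  assumes r: "0 \<le> r" "r < 1"
  shows "(\<Sum>j<n. if j < J then r ^ (J - j) else r ^ (j - J)) \<le> 2 / (1 - r)"
proof -
  let ?f = "\<lambda>j. if j < J then r ^ (J - j) else r ^ (j - J)"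
  have f0: "?f j \<ge> 0" for j using r by simp
  have "(\<Sum>j<n. ?f j) \<le> (\<Sum>j<J + n. ?f j)"
    using f0 by (intro sum_mono2) auto
  also have "\<dots> = sum ?f {0..<J} + sum ?f {J..<J + n}"
    unfolding lessThan_atLeast0 by (rule sum.atLeastLessThan_concat[symmetric]) auto
  also have "sum ?f {J..<J + n} = (\<Sum>j<n. ?f (j + J))"
    using sum.shift_bounds_nat_ivl[of ?f 0 J n] by (simp only: lessThan_atLeast0 add_0 add.commute[of n J])
  also have "sum ?f {0..<J} = (\<Sum>j<J. ?f j)" by (simp only: lessThan_atLeast0)
  also have "(\<Sum>j<n. ?f (j + J)) = (\<Sum>j<n. r ^ j)" by simp
  also have "(\<Sum>j<J. ?f j) = (\<Sum>j<J. r ^ Suc (J - Suc j))"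
    by (intro sum.cong) (auto simp: Suc_diff_Suc)
  also have "\<dots> = (\<Sum>j<J. r ^ Suc j)" by (rule sum.nat_diff_reindex)
  also have "\<dots> \<le> (\<Sum>j<J. r ^ j)"
    using r by (intro sum_mono power_decreasing) auto
  also have "(\<Sum>j<J. r ^ j) + (\<Sum>j<n. r ^ j) \<le> 1 / (1 - r) + 1 / (1 - r)"
    using r by (intro add_mono geometric_sum_le)
  finally show ?thesis by simp
qed

lemma powr_nat_pos: "2 powr (real j * a) = (2 powr a) ^ j"
  by (simp add: powr_powr[symmetric] powr_realpow[symmetric] mult.commute)

lemma dyadic_scale:
  fixes d :: real
  assumes "0 < d" "d < 1"
  obtains J :: nat where "d < 2 powr - real J" "2 powr - real J \<le> 2 * d"
proof -
  have p: "2 powr - real n = (1 / 2) ^ n" for n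
    by (simp add: powr_minus_divide powr_realpow power_one_over)
  obtain n where n: "(1 / 2) ^ n < d" using real_arch_pow_inv[OF assms(1), of "1/2"] by auto
  define m where "m = (LEAST n. (1 / 2) ^ n \<le> d)"
  have m: "(1 / 2) ^ m \<le> d" unfolding m_def
    by (rule LeastI[of "\<lambda>n. (1 / 2) ^ n \<le> d" n]) (rule less_imp_le[OF n])
  have "m \<noteq> 0" using m assms by (intro notI) simp
  then obtain J where J: "m = Suc J" by (cases m) auto
  have "\<not> (1 / 2) ^ J \<le> d"
    using not_less_Least[of J "\<lambda>n. (1 / 2) ^ n \<le> d"] J m_def by auto
  then show thesis using that[of J] m J by (simp add: p)
qed

text \<open>For \<gamma> > 0 this is comparable to d^(-\<gamma>) where the distance d is below 1,
  infinite on the boundary, and zero where d \<ge> 1. Written as a sum over neighbourhoods, its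
  integral over a set is a sum of measures.\<close>

definition layer :: "real \<Rightarrow> real \<Rightarrow> real^2 \<Rightarrow> ennreal" where
  "layer \<alpha> \<gamma> x = (\<Sum>j. ennreal (2 powr (real j * \<gamma>)) *
     indicator {y. infdist y (spiral_boundary \<alpha>) < 2 powr - real j} x)"

lemma open_infdist_less: "open {y. infdist y A < c}"
  by (intro open_Collect_less continuous_intros)

lemma layer_measurable [measurable]: "layer \<alpha> \<gamma> \<in> borel_measurable borel"
proof -
  show ?thesis
    unfolding layer_def
    by (intro borel_measurable_suminf_order borel_measurable_times_ennreal borel_measurable_const
        borel_measurable_indicator borel_open open_infdist_less)
qed

lemma layer_ge:
  assumes "infdist x (spiral_boundary \<alpha>) < 2 powr - real J"
  shows "ennreal (2 powr (real J * \<gamma>)) \<le> layer \<alpha> \<gamma> x"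
proof -
  let ?f = "\<lambda>j. ennreal (2 powr (real j * \<gamma>)) *
     indicator {y. infdist y (spiral_boundary \<alpha>) < 2 powr - real j} x"
  have "ennreal (2 powr (real J * \<gamma>)) = ?f J" using assms by simp
  also have "\<dots> \<le> (\<Sum>j. ?f j)" by (rule ennreal_le_suminf)
  finally show ?thesis by (simp add: layer_def)
qed

lemma layer_eq_top:
  assumes "infdist x (spiral_boundary \<alpha>) = 0" "\<gamma> > 0"
  shows "layer \<alpha> \<gamma> x = top"
proof (rule ccontr)
  assume "layer \<alpha> \<gamma> x \<noteq> top"
  then obtain r where r: "layer \<alpha> \<gamma> x = ennreal r" "r \<ge> 0" by (cases "layer \<alpha> \<gamma> x") auto
  have "1 < 2 powr \<gamma>" using assms by simp
  then obtain J where J: "r < (2 powr \<gamma>) ^ J" using real_arch_pow by blast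
  have "ennreal (2 powr (real J * \<gamma>)) \<le> ennreal r"
    using layer_ge[of x \<alpha> J \<gamma>] assms r by simp
  then show False using J r by (simp add: powr_nat_pos)
qed

lemma infdist_boundary_ge:
  assumes \<alpha>: "0 < \<alpha>"
  shows "norm x - 1 \<le> infdist x (spiral_boundary \<alpha>)"
proof (rule ccontr)
  assume "\<not> ?thesis"
  then obtain z where z: "z \<in> spiral_boundary \<alpha>" "dist x z < norm x - 1"
    using infdist_lessE[OF _ spiral_boundary_nonempty, of x \<alpha> "norm x - 1"] by auto
  have "norm z \<le> 1" using norm_spiral_boundary[OF \<alpha> z(1)] powr_two_pi_less_1[OF \<alpha>] by linarith
  then show False using z(2) norm_triangle_ineq2[of x z] by (simp add: dist_norm)
qed

lemma infdist_boundary_le: "infdist x (spiral_boundary \<alpha>) \<le> norm x"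
  using infdist_le[of 0 "spiral_boundary \<alpha>" x] by (simp add: spiral_boundary_def)

lemma layer_zero:
  assumes \<alpha>: "0 < \<alpha>" and "norm x \<ge> 2"
  shows "layer \<alpha> \<gamma> x = 0"
proof -
  have "infdist x (spiral_boundary \<alpha>) \<ge> 1" using infdist_boundary_ge[OF \<alpha>, of x] assms by linarith
  moreover have "2 powr - real j \<le> 1" for j using powr_mono[of "- real j" 0 2] by simp
  ultimately have "\<not> infdist x (spiral_boundary \<alpha>) < 2 powr - real j" for j
    by (meson not_le order_trans)
  then show ?thesis by (simp add: layer_def)
qed

lemma layer_integral_eq:
  assumes [measurable]: "Q \<in> sets borel"
  shows "(\<integral>\<^sup>+x\<in>Q. layer \<alpha> \<gamma> x \<partial>lborel) = (\<Sum>j. ennreal (2 powr (real j * \<gamma>)) *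
     emeasure lborel {x \<in> Q. infdist x (spiral_boundary \<alpha>) < 2 powr - real j})"
proof -
  have "{x \<in> Q. infdist x (spiral_boundary \<alpha>) < c} = Q \<inter> {y. infdist y (spiral_boundary \<alpha>) < c}" for c
    by auto
  then have meas: "{x \<in> Q. infdist x (spiral_boundary \<alpha>) < c} \<in> sets borel" for c
    using sets.Int[OF assms borel_open[OF open_infdist_less]] by simp
  have "layer \<alpha> \<gamma> x * indicator Q x = (\<Sum>j. ennreal (2 powr (real j * \<gamma>)) *
     indicator {x \<in> Q. infdist x (spiral_boundary \<alpha>) < 2 powr - real j} x)" for x
    unfolding layer_def ennreal_suminf_multc[symmetric] by (intro suminf_cong) (auto simp: indicator_def)
  then have "(\<integral>\<^sup>+x\<in>Q. layer \<alpha> \<gamma> x \<partial>lborel) = (\<integral>\<^sup>+x. (\<Sum>j. ennreal (2 powr (real j * \<gamma>)) *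
     indicator {x \<in> Q. infdist x (spiral_boundary \<alpha>) < 2 powr - real j} x) \<partial>lborel)"
    by (intro nn_integral_cong)
  also have "\<dots> = (\<Sum>j. \<integral>\<^sup>+x. ennreal (2 powr (real j * \<gamma>)) *
     indicator {x \<in> Q. infdist x (spiral_boundary \<alpha>) < 2 powr - real j} x \<partial>lborel)"
    by (intro nn_integral_suminf borel_measurable_times_ennreal borel_measurable_const borel_measurable_indicator) (simp add: meas)
  also have "\<dots> = (\<Sum>j. ennreal (2 powr (real j * \<gamma>)) *
     emeasure lborel {x \<in> Q. infdist x (spiral_boundary \<alpha>) < 2 powr - real j})"
    by (intro suminf_cong nn_integral_cmult_indicator) (simp add: meas)
  finally show ?thesis .
qed

text \<open>Coarser scales than hs = min(R/8, w) are bounded by the full area R^2, and their weights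
  2^(j\<gamma>) grow with j. Finer ones are bounded by the neighbourhood estimate, and there
  2^(j\<gamma>) 2^(-j) decays because \<gamma> < 1. The sum peaks at the critical scale with value
  of order R^2 hs^(-\<gamma>), and hs \<ge> R^(1+1/\<alpha>)/8.\<close>

lemma layer_integral_off_center:
  assumes \<alpha>: "0 < \<alpha>" and \<gamma>: "0 < \<gamma>" "\<gamma> < 1"
  obtains C where "C \<ge> 0"
    "\<And>x0 R. \<lbrakk>0 < R; R \<le> 1; R \<le> norm x0\<rbrakk> \<Longrightarrow>
      (\<integral>\<^sup>+x\<in>cball x0 (3 * R / 4). layer \<alpha> \<gamma> x \<partial>lborel) \<le> ennreal (C * R powr (2 - \<gamma> * (1 + 1 / \<alpha>)))"
proof -
  define \<sigma> where "\<sigma> = 1 + 1 / \<alpha>"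
  have \<sigma>: "\<sigma> > 1" using \<alpha> by (simp add: \<sigma>_def)
  obtain C1 where C1: "C1 \<ge> 1"
    "\<And>x0 R h. \<lbrakk>0 < h; h \<le> R / 8; R \<le> 1; R \<le> norm x0; norm x0 \<le> 4; h \<le> norm x0 powr \<sigma>\<rbrakk> \<Longrightarrow>
      emeasure lborel {x \<in> cball x0 (3 * R / 4). infdist x (spiral_boundary \<alpha>) < h}
        \<le> ennreal (C1 * R * h * (R / norm x0 powr \<sigma> + 1))"
    using emeasure_boundary_nbhd[OF \<alpha>, folded \<sigma>_def] by blast
  define r where "r = max (2 powr - \<gamma>) (2 powr (\<gamma> - 1))"
  have "2 powr - \<gamma> < 1" "2 powr (\<gamma> - 1) < 1"
    using powr_less_mono[of "- \<gamma>" 0 2] powr_less_mono[of "\<gamma> - 1" 0 2] \<gamma> by auto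
  then have r: "0 < r" "r < 1" by (auto simp: r_def less_max_iff_disj)
  define K where "K = 4 + 2 * C1"
  have K: "K \<ge> 4" "K \<ge> 2 * C1" using C1 by (auto simp: K_def)
  define C where "C = K * 16 powr \<gamma> * (2 / (1 - r))"
  have C: "C \<ge> 0" using K r by (simp add: C_def)
  show thesis
  proof (rule that[OF C])
    fix x0 :: "real^2" and R :: real
    assume R: "0 < R" "R \<le> 1" "R \<le> norm x0"
    let ?Q = "cball x0 (3 * R / 4)"
    show "(\<integral>\<^sup>+x\<in>?Q. layer \<alpha> \<gamma> x \<partial>lborel) \<le> ennreal (C * R powr (2 - \<gamma> * (1 + 1 / \<alpha>)))"
    proof (cases "norm x0 \<le> 4")
      case False
      have "layer \<alpha> \<gamma> x * indicator ?Q x = 0" for x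
      proof (cases "x \<in> ?Q")
        case True
        then have "norm x \<ge> 2"
          using False R norm_triangle_ineq2[of x0 x] by (simp add: dist_norm)
        then show ?thesis using layer_zero[OF \<alpha>] by simp
      qed simp
      then have "(\<integral>\<^sup>+x\<in>?Q. layer \<alpha> \<gamma> x \<partial>lborel) = (\<integral>\<^sup>+x. 0 \<partial>(lborel :: (real^2) measure))"
        by (intro nn_integral_cong)
      then show ?thesis by simp
    next
      case x04: True
      define w where "w = norm x0 powr \<sigma>"
      have "norm x0 > 0" using R by linarith
      then have w: "w > 0" by (simp add: w_def)
      \<comment> \<open>The largest scale at which the neighbourhood estimate applies: R/8 comes
        from the disc, w is the width of the coils at x0.\<close>
      define hs where "hs = min (R / 8) w"
      have hs: "0 < hs" "hs < 1" "hs \<le> R / 8" "hs \<le> w" using R w by (auto simp: hs_def)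
      have "R powr \<sigma> \<le> w" unfolding w_def using R \<sigma> by (intro powr_mono2) auto
      moreover have "R powr \<sigma> \<le> R" using R \<sigma> powr_mono'[of 1 \<sigma> R] by simp
      moreover have "0 \<le> R powr \<sigma>" by simp
      ultimately have "R powr \<sigma> / 8 \<le> R / 8" "R powr \<sigma> / 8 \<le> w" by linarith+
      then have hsR: "R powr \<sigma> / 8 \<le> hs" unfolding hs_def by (rule min.boundedI)
      obtain J0 where J0: "hs < 2 powr - real J0" "2 powr - real J0 \<le> 2 * hs"
        using dyadic_scale[OF hs(1,2)] by blast
      \<comment> \<open>\<open>J0\<close> has 2^(-J0) between hs and 2hs; one level more brings the
        scale below hs and still above hs/2. With hs \<ge> R^\<sigma>/8 this accounts for the 16 in
        C.\<close>
      define J where "J = Suc J0"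
      have pJ: "2 powr - real J = 2 powr - real J0 / 2"
        by (simp add: J_def powr_diff powr_minus_divide)
      have J: "2 powr - real J \<le> hs" "hs < 2 * 2 powr - real J" using J0 by (auto simp: pJ)
      have mono: "2 powr - real j \<le> 2 powr - real J" if "J \<le> j" for j
        using that by simp
      let ?g = "\<lambda>j. if j < J then r ^ (J - j) else r ^ (j - J)"
      have tm: "ennreal (2 powr (real j * \<gamma>)) * emeasure lborel {x \<in> ?Q. infdist x (spiral_boundary \<alpha>) < 2 powr - real j}
          \<le> ennreal (K * R\<^sup>2 * 2 powr (real J * \<gamma>) * ?g j)" for j
      proof (cases "j < J")
        case True
        have "emeasure lborel {x \<in> ?Q. infdist x (spiral_boundary \<alpha>) < 2 powr - real j} \<le> emeasure lborel ?Q"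
          by (intro emeasure_mono) auto
        also have "\<dots> = ennreal (pi * (3 * R / 4)\<^sup>2)"
          using R by (simp add: emeasure_cball unit_ball_vol_2)
        also have "\<dots> \<le> ennreal (4 * R\<^sup>2)"
        proof (intro ennreal_leI)
          have "pi * (3 * R / 4)\<^sup>2 \<le> 4 * (3 * R / 4)\<^sup>2" using two_pi_gt by (intro mult_right_mono) auto
          also have "\<dots> \<le> 4 * R\<^sup>2" by (simp add: power2_eq_square)
          finally show "pi * (3 * R / 4)\<^sup>2 \<le> 4 * R\<^sup>2" .
        qed
        finally have "ennreal (2 powr (real j * \<gamma>)) * emeasure lborel {x \<in> ?Q. infdist x (spiral_boundary \<alpha>) < 2 powr - real j}
          \<le> ennreal (2 powr (real j * \<gamma>)) * ennreal (4 * R\<^sup>2)" by (intro mult_left_mono) auto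
        also have "\<dots> = ennreal (4 * R\<^sup>2 * 2 powr (real j * \<gamma>))"
          by (simp add: ennreal_mult[symmetric] mult.commute)
        also have "\<dots> \<le> ennreal (K * R\<^sup>2 * 2 powr (real J * \<gamma>) * r ^ (J - j))"
        proof (rule ennreal_leI)
          have "2 powr (real j * \<gamma>) = 2 powr (real J * \<gamma>) * (2 powr - \<gamma>) ^ (J - j)"
            using True by (simp add: powr_nat_pos[symmetric] powr_add[symmetric] of_nat_diff algebra_simps)
          then have "4 * R\<^sup>2 * 2 powr (real j * \<gamma>) = 4 * R\<^sup>2 * (2 powr (real J * \<gamma>) * (2 powr - \<gamma>) ^ (J - j))" by simp
          also have "4 * R\<^sup>2 * (2 powr (real J * \<gamma>) * (2 powr - \<gamma>) ^ (J - j)) \<le> K * R\<^sup>2 * 2 powr (real J * \<gamma>) * r ^ (J - j)"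
            unfolding mult.assoc[symmetric] using K R
            by (intro mult_mono power_mono) (auto simp: r_def)
          finally show "4 * R\<^sup>2 * 2 powr (real j * \<gamma>) \<le> K * R\<^sup>2 * 2 powr (real J * \<gamma>) * r ^ (J - j)" by simp
        qed
        finally show ?thesis using True by simp
      next
        case False
        then have j: "J \<le> j" by simp
        have hj: "2 powr - real j \<le> hs" using mono[OF j] J by linarith
        have "emeasure lborel {x \<in> ?Q. infdist x (spiral_boundary \<alpha>) < 2 powr - real j}
            \<le> ennreal (C1 * R * 2 powr - real j * (R / w + 1))"
          unfolding w_def using hj hs R x04 by (intro C1(2)) (auto simp: w_def)
        then have "ennreal (2 powr (real j * \<gamma>)) * emeasure lborel {x \<in> ?Q. infdist x (spiral_boundary \<alpha>) < 2 powr - real j}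
            \<le> ennreal (2 powr (real j * \<gamma>)) * ennreal (C1 * R * 2 powr - real j * (R / w + 1))"
          by (intro mult_left_mono) auto
        also have "\<dots> = ennreal (2 powr (real j * \<gamma>) * (C1 * R * 2 powr - real j * (R / w + 1)))"
          using C1(1) R w by (intro ennreal_mult[symmetric]) (auto intro!: mult_nonneg_nonneg add_nonneg_nonneg)
        also have "\<dots> \<le> ennreal (K * R\<^sup>2 * 2 powr (real J * \<gamma>) * r ^ (j - J))"
        proof (rule ennreal_leI)
          have "2 powr (real j * \<gamma>) * (C1 * R * 2 powr - real j * (R / w + 1))
              = C1 * R * (2 powr - real J * (R / w + 1)) * 2 powr (real J * \<gamma>) * (2 powr (\<gamma> - 1)) ^ (j - J)"
          proof -
            have "2 powr (real j * \<gamma>) * 2 powr - real j = 2 powr - real J * 2 powr (real J * \<gamma>) * (2 powr (\<gamma> - 1)) ^ (j - J)"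
              using j by (simp add: powr_nat_pos[symmetric] powr_add[symmetric] of_nat_diff algebra_simps)
            then show ?thesis by (simp add: mult_ac)
          qed
          also have "\<dots> \<le> C1 * R * (2 * R) * 2 powr (real J * \<gamma>) * r ^ (j - J)"
          proof -
            \<comment> \<open>The critical scale is below both w and R: the first bound absorbs the
              number R/w of coils, the second the additional curve.\<close>
            have "2 powr - real J * (R / w + 1) \<le> 2 * R"
            proof -
              have "2 powr - real J * (R / w) \<le> w * (R / w)"
                using J hs R w by (intro mult_right_mono) auto
              then have "2 powr - real J * (R / w) \<le> R" using w by simp
              moreover have "2 powr - real J \<le> R" using J hs R by linarith
              ultimately show ?thesis by (simp add: distrib_left)
            qed
            then have a: "C1 * R * (2 powr - real J * (R / w + 1)) \<le> C1 * R * (2 * R)"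
              using C1(1) R by (intro mult_left_mono) auto
            have b: "(2 powr (\<gamma> - 1)) ^ (j - J) \<le> r ^ (j - J)"
              by (intro power_mono) (auto simp: r_def)
            show ?thesis
              using C1(1) R by (intro mult_mono[OF mult_right_mono[OF a] b]) auto
          qed
          also have "\<dots> \<le> K * R\<^sup>2 * 2 powr (real J * \<gamma>) * r ^ (j - J)"
          proof -
            have "C1 * R * (2 * R) = 2 * C1 * R\<^sup>2" by (simp add: power2_eq_square)
            also have "\<dots> \<le> K * R\<^sup>2" using K by (intro mult_right_mono) auto
            finally show ?thesis using r by (intro mult_right_mono) auto
          qed
          finally show "2 powr (real j * \<gamma>) * (C1 * R * 2 powr - real j * (R / w + 1)) \<le> K * R\<^sup>2 * 2 powr (real J * \<gamma>) * r ^ (j - J)" .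
        qed
        finally show ?thesis using False by simp
      qed
      have "(\<integral>\<^sup>+x\<in>?Q. layer \<alpha> \<gamma> x \<partial>lborel) \<le> (\<Sum>j. ennreal (K * R\<^sup>2 * 2 powr (real J * \<gamma>) * ?g j))"
        unfolding layer_integral_eq[OF borel_closed[OF closed_cball]] by (rule suminf_le[OF tm]) auto
      also have "\<dots> \<le> ennreal (K * R\<^sup>2 * 2 powr (real J * \<gamma>) * (2 / (1 - r)))"
        unfolding suminf_eq_SUP
      proof (rule SUP_least)
        fix n
        have "(\<Sum>j<n. ennreal (K * R\<^sup>2 * 2 powr (real J * \<gamma>) * ?g j)) = ennreal (K * R\<^sup>2 * 2 powr (real J * \<gamma>) * (\<Sum>j<n. ?g j))"
          using K r by (subst sum_ennreal) (auto simp: sum_distrib_left)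
        also have "\<dots> \<le> ennreal (K * R\<^sup>2 * 2 powr (real J * \<gamma>) * (2 / (1 - r)))"
          using K r by (intro ennreal_leI mult_left_mono two_sided_geometric_sum_le) auto
        finally show "(\<Sum>j<n. ennreal (K * R\<^sup>2 * 2 powr (real J * \<gamma>) * ?g j)) \<le> ennreal (K * R\<^sup>2 * 2 powr (real J * \<gamma>) * (2 / (1 - r)))" .
      qed
      also have "\<dots> \<le> ennreal (C * R powr (2 - \<gamma> * (1 + 1 / \<alpha>)))"
      proof (intro ennreal_leI)
        have "2 powr real J \<le> 16 * R powr - \<sigma>"
        proof -
          have "R powr \<sigma> / 8 < 2 * 2 powr - real J" using hsR J by linarith
          then have "R powr \<sigma> * 2 powr real J < 16"
            by (simp add: powr_minus_divide pos_less_divide_eq mult.commute)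
          then show ?thesis using R by (simp add: powr_minus_divide pos_le_divide_eq mult.commute)
        qed
        then have "(2 powr real J) powr \<gamma> \<le> (16 * R powr - \<sigma>) powr \<gamma>"
          using \<gamma> by (intro powr_mono2) auto
        then have "2 powr (real J * \<gamma>) \<le> 16 powr \<gamma> * R powr (- \<sigma> * \<gamma>)"
          by (simp add: powr_powr powr_mult)
        then have "K * R\<^sup>2 * 2 powr (real J * \<gamma>) * (2 / (1 - r)) \<le> K * R\<^sup>2 * (16 powr \<gamma> * R powr (- \<sigma> * \<gamma>)) * (2 / (1 - r))"
          using K r by (intro mult_right_mono mult_left_mono) auto
        also have "\<dots> = C * (R\<^sup>2 * R powr (- \<sigma> * \<gamma>))" by (simp add: C_def)
        also have "R\<^sup>2 * R powr (- \<sigma> * \<gamma>) = R powr (2 + - \<sigma> * \<gamma>)"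
          using R by (simp only: powr_add powr_numeral)
        also have "2 + - \<sigma> * \<gamma> = 2 - \<gamma> * (1 + 1 / \<alpha>)" by (simp add: \<sigma>_def algebra_simps)
        finally show "K * R\<^sup>2 * 2 powr (real J * \<gamma>) * (2 / (1 - r)) \<le> C * R powr (2 - \<gamma> * (1 + 1 / \<alpha>))" .
      qed
      finally show ?thesis .
    qed
  qed
qed

text \<open>Near the origin the estimate is summed over dyadic annuli, each of which is a scaled copy of
  one fixed annulus and hence covered by a fixed number of off-centre discs.\<close>

lemma layer_integral_ball_zero:
  assumes \<alpha>: "0 < \<alpha>" and \<gamma>: "0 < \<gamma>" "\<gamma> < 1" and \<kappa>: "0 < 2 - \<gamma> * (1 + 1 / \<alpha>)"
  obtains C where "C \<ge> 0"
    "\<And>R. \<lbrakk>0 < R; R \<le> 1\<rbrakk> \<Longrightarrow>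
      (\<integral>\<^sup>+x\<in>ball 0 (2 * R). layer \<alpha> \<gamma> x \<partial>lborel) \<le> ennreal (C * R powr (2 - \<gamma> * (1 + 1 / \<alpha>)))"
proof -
  define \<kappa> where "\<kappa> = 2 - \<gamma> * (1 + 1 / \<alpha>)"
  have \<kappa>0: "\<kappa> > 0" using \<kappa> by (simp add: \<kappa>_def)
  obtain C1 where C1: "C1 \<ge> 0"
    "\<And>x0 R. \<lbrakk>0 < R; R \<le> 1; R \<le> norm x0\<rbrakk> \<Longrightarrow>
      (\<integral>\<^sup>+x\<in>cball x0 (3 * R / 4). layer \<alpha> \<gamma> x \<partial>lborel) \<le> ennreal (C1 * R powr \<kappa>)"
    using layer_integral_off_center[OF \<alpha> \<gamma>, folded \<kappa>_def] by blast
  define A where "A = {x::real^2. 1 \<le> norm x \<and> norm x \<le> 2}"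
  have "closed A" unfolding A_def by (intro closed_Collect_conj closed_Collect_le continuous_intros)
  moreover have "bounded A" unfolding A_def bounded_iff by blast
  ultimately have "compact A" by (simp add: compact_eq_bounded_closed)
  moreover have "A \<subseteq> (\<Union>y\<in>A. ball y (3 / 4))" by force
  ultimately obtain Y where Y: "Y \<subseteq> A" "finite Y" "A \<subseteq> (\<Union>y\<in>Y. ball y (3 / 4))"
    using compactE_image[of A A "\<lambda>y. ball y (3 / 4)"] by (metis open_ball)
  define ann where "ann \<rho> = {x::real^2. \<rho> \<le> norm x \<and> norm x \<le> 2 * \<rho>}" for \<rho>
  have [measurable]: "ann \<rho> \<in> sets borel" for \<rho>
    unfolding ann_def by (intro borel_closed closed_Collect_conj closed_Collect_le continuous_intros)
  have ann: "(\<integral>\<^sup>+x\<in>ann \<rho>. layer \<alpha> \<gamma> x \<partial>lborel) \<le> ennreal (card Y * C1 * \<rho> powr \<kappa>)"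
    if \<rho>: "0 < \<rho>" "\<rho> \<le> 1" for \<rho>
  proof -
    have "layer \<alpha> \<gamma> x * indicator (ann \<rho>) x \<le> (\<Sum>y\<in>Y. layer \<alpha> \<gamma> x * indicator (cball (\<rho> *\<^sub>R y) (3 * \<rho> / 4)) x)" for x
    proof (cases "x \<in> ann \<rho>")
      case True
      then have "(1 / \<rho>) *\<^sub>R x \<in> A"
        using \<rho> by (auto simp: ann_def A_def pos_le_divide_eq pos_divide_le_eq)
      then obtain y where y: "y \<in> Y" "dist y ((1 / \<rho>) *\<^sub>R x) < 3 / 4" using Y by auto
      have "dist (\<rho> *\<^sub>R y) x = \<rho> * dist y ((1 / \<rho>) *\<^sub>R x)"
      proof -
        have "\<rho> *\<^sub>R y - x = \<rho> *\<^sub>R (y - (1 / \<rho>) *\<^sub>R x)" using \<rho> by (simp add: algebra_simps)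
        then show ?thesis using \<rho> by (simp add: dist_norm)
      qed
      also have "\<dots> \<le> \<rho> * (3 / 4)" using y \<rho> by (intro mult_left_mono) auto
      finally have "x \<in> cball (\<rho> *\<^sub>R y) (3 * \<rho> / 4)" by simp
      then have "layer \<alpha> \<gamma> x * indicator (ann \<rho>) x \<le> layer \<alpha> \<gamma> x * indicator (cball (\<rho> *\<^sub>R y) (3 * \<rho> / 4)) x"
        by (simp add: indicator_def)
      also have "\<dots> \<le> (\<Sum>y\<in>Y. layer \<alpha> \<gamma> x * indicator (cball (\<rho> *\<^sub>R y) (3 * \<rho> / 4)) x)"
        using Y y by (intro member_le_sum) auto
      finally show ?thesis .
    qed simp
    then have "(\<integral>\<^sup>+x\<in>ann \<rho>. layer \<alpha> \<gamma> x \<partial>lborel)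
        \<le> (\<integral>\<^sup>+x. (\<Sum>y\<in>Y. layer \<alpha> \<gamma> x * indicator (cball (\<rho> *\<^sub>R y) (3 * \<rho> / 4)) x) \<partial>lborel)"
      by (intro nn_integral_mono)
    also have "\<dots> = (\<Sum>y\<in>Y. \<integral>\<^sup>+x\<in>cball (\<rho> *\<^sub>R y) (3 * \<rho> / 4). layer \<alpha> \<gamma> x \<partial>lborel)"
      by (intro nn_integral_sum) (auto intro!: borel_measurable_times_ennreal borel_measurable_indicator)
    also have "\<dots> \<le> (\<Sum>y\<in>Y. ennreal (C1 * \<rho> powr \<kappa>))"
    proof (intro sum_mono C1(2) \<rho>)
      fix y assume "y \<in> Y"
      then have "1 \<le> norm y" using Y by (auto simp: A_def)
      then show "\<rho> \<le> norm (\<rho> *\<^sub>R y)" using \<rho> by (simp add: mult_le_cancel_left1)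
    qed
    also have "\<dots> = ennreal (card Y * C1 * \<rho> powr \<kappa>)"
      using C1 by (simp add: ennreal_mult ennreal_of_nat_eq_real_of_nat mult.assoc)
    finally show ?thesis .
  qed
  define r where "r = 2 powr - \<kappa>"
  have r: "0 < r" "r < 1" using \<kappa>0 powr_less_mono[of "- \<kappa>" 0 2] by (auto simp: r_def)
  define C where "C = card Y * C1 * (1 / (1 - r))"
  have C: "C \<ge> 0" using C1 r by (simp add: C_def)
  show thesis
  proof (rule that[OF C])
    fix R :: real assume R: "0 < R" "R \<le> 1"
    \<comment> \<open>The annuli miss the origin, where \<open>layer\<close> is infinite; it gets
      its own summand, whose integral over a single point vanishes.\<close>
    have le: "layer \<alpha> \<gamma> x * indicator (ball 0 (2 * R)) x
        \<le> layer \<alpha> \<gamma> x * indicator {0} x + (\<Sum>i. layer \<alpha> \<gamma> x * indicator (ann (R / 2 ^ i)) x)" for x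
    proof (cases "x \<in> ball 0 (2 * R) \<and> x \<noteq> 0")
      case True
      then have x: "0 < norm x" "norm x < 2 * R" by auto
      then have "0 < norm x / (2 * R)" "norm x / (2 * R) < 1" using R by (auto simp: pos_divide_less_eq)
      then obtain i where i: "norm x / (2 * R) < 2 powr - real i" "2 powr - real i \<le> 2 * (norm x / (2 * R))"
        by (rule dyadic_scale)
      have p: "2 powr - real i = 1 / 2 ^ i" by (simp add: powr_minus_divide powr_realpow)
      have "x \<in> ann (R / 2 ^ i)"
        using i R unfolding p ann_def by (auto simp: field_simps)
      then have "layer \<alpha> \<gamma> x * indicator (ball 0 (2 * R)) x \<le> layer \<alpha> \<gamma> x * indicator (ann (R / 2 ^ i)) x"
        by (simp add: indicator_def)
      also have "\<dots> \<le> (\<Sum>i. layer \<alpha> \<gamma> x * indicator (ann (R / 2 ^ i)) x)"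
        by (rule ennreal_le_suminf)
      also have "\<dots> \<le> layer \<alpha> \<gamma> x * indicator {0} x + \<dots>" by simp
      finally show ?thesis .
    next
      case False
      then have "layer \<alpha> \<gamma> x * indicator (ball 0 (2 * R)) x \<le> layer \<alpha> \<gamma> x * indicator {0} x"
        by (auto simp: indicator_def)
      also have "\<dots> \<le> \<dots> + (\<Sum>i. layer \<alpha> \<gamma> x * indicator (ann (R / 2 ^ i)) x)"
        by (rule add_increasing2) simp_all
      finally show ?thesis .
    qed
    have "(\<integral>\<^sup>+x\<in>ball 0 (2 * R). layer \<alpha> \<gamma> x \<partial>lborel)
       \<le> (\<integral>\<^sup>+x. layer \<alpha> \<gamma> x * indicator {0} x + (\<Sum>i. layer \<alpha> \<gamma> x * indicator (ann (R / 2 ^ i)) x) \<partial>lborel)"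
      by (intro nn_integral_mono le)
    also have "\<dots> = (\<integral>\<^sup>+x\<in>{0}. layer \<alpha> \<gamma> x \<partial>lborel) + (\<integral>\<^sup>+x. (\<Sum>i. layer \<alpha> \<gamma> x * indicator (ann (R / 2 ^ i)) x) \<partial>lborel)"
      by (intro nn_integral_add) measurable
    also have "(\<integral>\<^sup>+x\<in>{0}. layer \<alpha> \<gamma> x \<partial>lborel) = 0"
      by (intro nn_integral_null_set) (simp add: null_sets_def)
    also have "(\<integral>\<^sup>+x. (\<Sum>i. layer \<alpha> \<gamma> x * indicator (ann (R / 2 ^ i)) x) \<partial>lborel)
       = (\<Sum>i. \<integral>\<^sup>+x\<in>ann (R / 2 ^ i). layer \<alpha> \<gamma> x \<partial>lborel)"
      by (intro nn_integral_suminf) measurable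
    also have "0 + \<dots> \<le> (\<Sum>i. ennreal (card Y * C1 * R powr \<kappa> * r ^ i))"
    proof -
      have "(\<integral>\<^sup>+x\<in>ann (R / 2 ^ i). layer \<alpha> \<gamma> x \<partial>lborel) \<le> ennreal (card Y * C1 * R powr \<kappa> * r ^ i)" for i
      proof -
        have "R / 2 ^ i \<le> R / 1" using R by (intro divide_left_mono) auto
        then have "R / 2 ^ i \<le> 1" using R by (simp only: div_by_1)
        then have "(\<integral>\<^sup>+x\<in>ann (R / 2 ^ i). layer \<alpha> \<gamma> x \<partial>lborel) \<le> ennreal (card Y * C1 * (R / 2 ^ i) powr \<kappa>)"
          using R by (intro ann) simp_all
        also have "(R / 2 ^ i) powr \<kappa> = R powr \<kappa> * r ^ i"
        proof -
          have "(R / 2 ^ i) powr \<kappa> = R powr \<kappa> / (2 ^ i) powr \<kappa>" using R by (simp add: powr_divide)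
          also have "(2 ^ i) powr \<kappa> = (2 powr \<kappa>) ^ i"
            by (simp add: powr_realpow[symmetric] powr_powr mult.commute)
          finally show ?thesis by (simp add: r_def powr_minus_divide power_one_over)
        qed
        finally show ?thesis by (simp add: mult.assoc)
      qed
      then show ?thesis by (simp add: suminf_le)
    qed
    also have "\<dots> = ennreal (\<Sum>i. card Y * C1 * R powr \<kappa> * r ^ i)"
      using C1 r by (intro suminf_ennreal2) (auto intro!: summable_mult)
    also have "(\<Sum>i. card Y * C1 * R powr \<kappa> * r ^ i) = C * R powr \<kappa>"
      using r by (subst suminf_mult) (auto simp: suminf_geometric C_def)
    finally show "(\<integral>\<^sup>+x\<in>ball 0 (2 * R). layer \<alpha> \<gamma> x \<partial>lborel) \<le> ennreal (C * R powr (2 - \<gamma> * (1 + 1 / \<alpha>)))"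
      by (simp add: \<kappa>_def)
  qed
qed

text \<open>Half of the diagonal is R/\<surd>2, which is less than 3R/4; this is the reason for the
  radius in the disc estimates.\<close>

lemma dyadic_cube_subset_cball:
  fixes m :: int and k :: "int^2"
  assumes R_def: "R = 2 powr - real_of_int m"
  shows "dyadic_cube m k \<subseteq> cball (\<chi> i. R * (real_of_int (k $ i) + 1 / 2)) (3 * R / 4)"
proof
  let ?c = "(\<chi> i. R * (real_of_int (k $ i) + 1 / 2)) :: real^2"
  have R: "R > 0" by (simp add: R_def)
  fix x assume x: "x \<in> dyadic_cube m k"
  have c: "\<bar>(?c - x) $ i\<bar> \<le> R / 2" for i
  proof -
    have "R * real_of_int (k $ i) \<le> x $ i" "x $ i < R * real_of_int (k $ i) + R"
      using x unfolding dyadic_cube_eq R_def[symmetric] by (auto simp: distrib_left)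
    moreover have "(?c - x) $ i = R * real_of_int (k $ i) + R / 2 - x $ i"
      by (simp add: distrib_left)
    ultimately show ?thesis by linarith
  qed
  have "(norm (?c - x))\<^sup>2 = (?c - x) $ 1 * (?c - x) $ 1 + (?c - x) $ 2 * (?c - x) $ 2"
    by (simp only: power2_norm_eq_inner inner_vec_def sum_2 inner_real_def)
  also have "\<dots> = ((?c - x) $ 1)\<^sup>2 + ((?c - x) $ 2)\<^sup>2"
    by (simp only: power2_eq_square)
  also have "\<dots> \<le> (R / 2)\<^sup>2 + (R / 2)\<^sup>2"
    using c R by (intro add_mono abs_le_square_iff[THEN iffD1]) auto
  also have "\<dots> \<le> (3 * R / 4)\<^sup>2"
    by (simp add: power2_eq_square)
  finally have "norm (?c - x) \<le> 3 * R / 4"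
    using R by (intro power2_le_imp_le[of "norm (?c - x)"]) auto
  then show "x \<in> cball ?c (3 * R / 4)" by (simp add: dist_norm)
qed

text \<open>A small cube whose centre has norm at least its side R is covered by the off-centre
  estimate; otherwise it lies in the ball of radius 2R about the origin. For cubes of side above 1
  nothing is gained beyond the ball of radius 2, outside of which \<open>layer\<close> vanishes,
  hence the minimum with 1.\<close>

lemma layer_integral_dyadic:
  assumes \<alpha>: "0 < \<alpha>" and \<gamma>: "0 < \<gamma>" "\<gamma> < 1" and \<kappa>: "0 < 2 - \<gamma> * (1 + 1 / \<alpha>)"
  obtains C where "C \<ge> 0"
    "\<And>m k. (\<integral>\<^sup>+x\<in>dyadic_cube m k. layer \<alpha> \<gamma> x \<partial>lborel)
        \<le> ennreal (C * min 1 (2 powr (- real_of_int m * (2 - \<gamma> * (1 + 1 / \<alpha>)))))"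
proof -
  define \<kappa> where "\<kappa> = 2 - \<gamma> * (1 + 1 / \<alpha>)"
  have \<kappa>0: "\<kappa> > 0" using \<kappa> by (simp add: \<kappa>_def)
  obtain C1 where C1: "C1 \<ge> 0"
    "\<And>x0 R. \<lbrakk>0 < R; R \<le> 1; R \<le> norm x0\<rbrakk> \<Longrightarrow>
      (\<integral>\<^sup>+x\<in>cball x0 (3 * R / 4). layer \<alpha> \<gamma> x \<partial>lborel) \<le> ennreal (C1 * R powr \<kappa>)"
    using layer_integral_off_center[OF \<alpha> \<gamma>, folded \<kappa>_def] by blast
  obtain C2 where C2: "C2 \<ge> 0"
    "\<And>R. \<lbrakk>0 < R; R \<le> 1\<rbrakk> \<Longrightarrow>
      (\<integral>\<^sup>+x\<in>ball 0 (2 * R). layer \<alpha> \<gamma> x \<partial>lborel) \<le> ennreal (C2 * R powr \<kappa>)"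
    using layer_integral_ball_zero[OF \<alpha> \<gamma> \<kappa>, folded \<kappa>_def] by blast
  have mono: "(\<integral>\<^sup>+x\<in>S. layer \<alpha> \<gamma> x \<partial>lborel) \<le> (\<integral>\<^sup>+x\<in>T. layer \<alpha> \<gamma> x \<partial>lborel)"
    if "S \<subseteq> T \<union> {x. norm x \<ge> 2}" for S T
    using that layer_zero[OF \<alpha>, of _ \<gamma>]
    by (intro nn_integral_mono) (auto simp: indicator_def split: if_splits)
  have "(\<integral>\<^sup>+x\<in>dyadic_cube m k. layer \<alpha> \<gamma> x \<partial>lborel)
      \<le> ennreal ((C1 + C2) * min 1 (2 powr (- real_of_int m * \<kappa>)))" for m k
  proof (cases "m \<ge> 0")
    case False
    have "(\<integral>\<^sup>+x\<in>dyadic_cube m k. layer \<alpha> \<gamma> x \<partial>lborel) \<le> (\<integral>\<^sup>+x\<in>ball 0 (2 * 1). layer \<alpha> \<gamma> x \<partial>lborel)"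
      by (intro mono) auto
    also have "\<dots> \<le> ennreal (C2 * 1 powr \<kappa>)" by (intro C2(2)) auto
    also have "\<dots> \<le> ennreal ((C1 + C2) * 1)" using C1 by (intro ennreal_leI) simp
    also have "1 = min 1 (2 powr (- real_of_int m * \<kappa>))"
    proof -
      have "0 \<le> - real_of_int m * \<kappa>" using False \<kappa>0 by (simp add: mult_nonpos_nonneg)
      then have "1 \<le> 2 powr (- real_of_int m * \<kappa>)" by (intro ge_one_powr_ge_zero) auto
      then show ?thesis by simp
    qed
    finally show ?thesis .
  next
    case True
    define R where "R = 2 powr - real_of_int m"
    have R: "0 < R" "R \<le> 1" using True powr_mono[of "- real_of_int m" 0 2] by (auto simp: R_def)
    have R\<kappa>: "R powr \<kappa> = min 1 (2 powr (- real_of_int m * \<kappa>))"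
    proof -
      have "R powr \<kappa> \<le> 1" using R \<kappa>0 by (simp add: powr_le1)
      then show ?thesis by (simp add: R_def powr_powr)
    qed
    define c where "c = (\<chi> i. R * (real_of_int (k $ i) + 1 / 2) :: real^2)"
    have sub: "dyadic_cube m k \<subseteq> cball c (3 * R / 4)"
      using dyadic_cube_subset_cball[OF R_def, of k] by (simp only: c_def)
    show ?thesis
    proof (cases "R \<le> norm c")
      case True
      have "(\<integral>\<^sup>+x\<in>dyadic_cube m k. layer \<alpha> \<gamma> x \<partial>lborel) \<le> (\<integral>\<^sup>+x\<in>cball c (3 * R / 4). layer \<alpha> \<gamma> x \<partial>lborel)"
        using sub by (intro mono) auto
      also have "\<dots> \<le> ennreal (C1 * R powr \<kappa>)" using True R by (intro C1(2)) auto
      also have "\<dots> \<le> ennreal ((C1 + C2) * R powr \<kappa>)" using C2 by (intro ennreal_leI mult_right_mono) auto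
      finally show ?thesis unfolding R\<kappa> .
    next
      case False
      have "dyadic_cube m k \<subseteq> ball 0 (2 * R)"
      proof
        fix x assume "x \<in> dyadic_cube m k"
        then have "dist c x \<le> 3 * R / 4" using sub by auto
        then show "x \<in> ball 0 (2 * R)"
          using False norm_triangle_ineq2[of x c] R by (simp add: dist_norm norm_minus_commute)
      qed
      then have "(\<integral>\<^sup>+x\<in>dyadic_cube m k. layer \<alpha> \<gamma> x \<partial>lborel) \<le> (\<integral>\<^sup>+x\<in>ball 0 (2 * R). layer \<alpha> \<gamma> x \<partial>lborel)"
        by (intro mono) auto
      also have "\<dots> \<le> ennreal (C2 * R powr \<kappa>)" using R by (intro C2(2)) auto
      also have "\<dots> \<le> ennreal ((C1 + C2) * R powr \<kappa>)" using C1 by (intro ennreal_leI mult_right_mono) auto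
      finally show ?thesis unfolding R\<kappa> .
    qed
  qed
  then show thesis using that[of "C1 + C2"] C1 C2 by (simp add: \<kappa>_def)
qed


subsection \<open>Sufficiency\<close>

lemma admissible_pairD:
  assumes "admissible_pair \<phi>\<^sub>0 \<phi>"
  shows "\<phi>\<^sub>0 \<in> schwartz" "\<phi> \<in> schwartz" "(\<integral>z. \<phi> z \<partial>lborel) = 0" "fourier \<phi> (axis i 1) \<noteq> 0"
proof -
  show "\<phi>\<^sub>0 \<in> schwartz" "\<phi> \<in> schwartz" using assms by (auto simp: admissible_pair_def)
  show "(\<integral>z. \<phi> z \<partial>lborel) = 0"
    using assms by (intro fourier_zero_integral) (auto simp: admissible_pair_def)
  obtain C where "C > 0" "\<forall>\<xi>. 3/5 \<le> norm \<xi> \<and> norm \<xi> \<le> 5/3 \<longrightarrow> norm (fourier \<phi> \<xi>) \<ge> C"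
    using assms unfolding admissible_pair_def by blast
  moreover have "norm (axis i 1 :: real^'a) = 1" by simp
  ultimately have "norm (fourier \<phi> (axis i 1)) \<ge> C" by simp
  then show "fourier \<phi> (axis i 1) \<noteq> 0" using \<open>C > 0\<close> by auto
qed

text \<open>The ball up to the boundary lies in the spiral or in its complement, and decay follows
  in either case if the mean of the kernel is zero. At level 0 only the complement is available,
  hence the side condition. The exponent 4 beats the weights 2^(js) for s \<le> 1 and makes the
  bound far away integrable in the plane.\<close>

lemma convolution_decay:
  assumes \<alpha>: "0 < \<alpha>" and ad: "admissible_pair \<phi>\<^sub>0 \<phi>"
  obtains M where "M > 0"
    "\<And>j x. norm (convolution (resolution \<phi>\<^sub>0 \<phi> j) (regular_distribution (indicator (spiral \<alpha>))) x) \<le> M"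
    "\<And>j x. j \<noteq> 0 \<or> x \<notin> spiral \<alpha> \<Longrightarrow>
      norm (convolution (resolution \<phi>\<^sub>0 \<phi> j) (regular_distribution (indicator (spiral \<alpha>))) x)
        \<le> M / (1 + infdist x (spiral_boundary \<alpha>) * 2 ^ j) ^ 4"
proof -
  note S = spiral_borel[OF \<alpha>]
  note ad' = admissible_pairD[OF ad]
  define I where "I \<psi> = (\<integral>z. (1 + norm z) ^ 4 * norm (\<psi> z) \<partial>lborel)" for \<psi> :: "real^2 \<Rightarrow> complex"
  have I0: "I \<psi> \<ge> 0" for \<psi> unfolding I_def by (intro Bochner_Integration.integral_nonneg) (simp add: add_nonneg_nonneg)
  define M where "M = I \<phi>\<^sub>0 + I \<phi> + 1"
  have M: "M > 0" "I \<phi>\<^sub>0 \<le> M" "I \<phi> \<le> M" using I0[of \<phi>] I0[of \<phi>\<^sub>0] by (auto simp: M_def)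
  show thesis
  proof (rule that[OF M(1)])
    fix j :: nat and x :: "real^2"
    define \<psi> where "\<psi> = (if j = 0 then \<phi>\<^sub>0 else \<phi>)"
    have \<psi>: "\<psi> \<in> schwartz" using ad' by (simp add: \<psi>_def)
    have IM: "I \<psi> \<le> M" using M by (simp add: \<psi>_def)
    have cv: "convolution (resolution \<phi>\<^sub>0 \<phi> j) (regular_distribution (indicator (spiral \<alpha>))) x = kernel_avg \<psi> (1 / 2 ^ j) (spiral \<alpha>) x"
      unfolding \<psi>_def by (rule convolution_regular_indicator[OF ad'(1,2) S])
    have h: "(0::real) < 1 / 2 ^ j" by simp
    show "norm (convolution (resolution \<phi>\<^sub>0 \<phi> j) (regular_distribution (indicator (spiral \<alpha>))) x) \<le> M"
      unfolding cv using kernel_avg_bound[OF \<psi> S h, of x 4] IM unfolding I_def by linarith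
    assume jx: "j \<noteq> 0 \<or> x \<notin> spiral \<alpha>"
    let ?d = "infdist x (spiral_boundary \<alpha>)"
    have d: "?d \<ge> 0" by (rule infdist_nonneg)
    have "norm (kernel_avg \<psi> (1 / 2 ^ j) (spiral \<alpha>) x) \<le> I \<psi> / (1 + ?d / (1 / 2 ^ j)) ^ 4"
    proof (cases "ball x ?d \<inter> spiral \<alpha> = {}")
      case True
      then show ?thesis unfolding I_def by (rule kernel_avg_bound_disjoint[OF \<psi> S h d])
    next
      case False
      then have sub: "ball x ?d \<subseteq> spiral \<alpha>" using ball_infdist_boundary[OF \<alpha>, of x] by blast
      moreover have "x \<in> ball x ?d" using False d by (auto intro: le_less_trans)
      ultimately have "j \<noteq> 0" using jx by blast
      then have "(\<integral>z. \<psi> z \<partial>lborel) = 0" using ad' by (simp add: \<psi>_def)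
      then show ?thesis unfolding I_def by (rule kernel_avg_bound_subset[OF \<psi> S h d _ sub])
    qed
    also have "\<dots> = I \<psi> / (1 + ?d * 2 ^ j) ^ 4" by simp
    also have "\<dots> \<le> M / (1 + ?d * 2 ^ j) ^ 4" using IM d by (intro divide_right_mono) auto
    finally show "norm (convolution (resolution \<phi>\<^sub>0 \<phi> j) (regular_distribution (indicator (spiral \<alpha>))) x)
        \<le> M / (1 + ?d * 2 ^ j) ^ 4" unfolding cv .
  qed
qed

text \<open>For distance d below 1, levels coarser than d are bounded by M 2^(js) and finer ones are
  damped by (2^j d)^(-4), so the l^1 sum is of order d^(-s) and its p-th power is dominated by
  \<open>layer\<close>. Points at distance at least 1 are absorbed by the tail; on the boundary
  \<open>layer\<close> is infinite.\<close>

lemma TL_density_le_layer: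
  assumes \<alpha>: "0 < \<alpha>" and ad: "admissible_pair \<phi>\<^sub>0 \<phi>" and p: "1 \<le> p" and q: "1 \<le> q" and s: "0 < s" "s \<le> 1"
  obtains C where "C > 0"
    "\<And>m x. TL_density q p s m (\<lambda>j. norm (convolution (resolution \<phi>\<^sub>0 \<phi> j)
        (regular_distribution (indicator (spiral \<alpha>))) x))
      \<le> ennreal C * (layer \<alpha> (s * p) x + ennreal (1 / (1 + norm x) ^ 3))"
proof -
  obtain M where M: "M > 0"
    "\<And>j x. norm (convolution (resolution \<phi>\<^sub>0 \<phi> j) (regular_distribution (indicator (spiral \<alpha>))) x) \<le> M"
    "\<And>j x. j \<noteq> 0 \<or> x \<notin> spiral \<alpha> \<Longrightarrow>
      norm (convolution (resolution \<phi>\<^sub>0 \<phi> j) (regular_distribution (indicator (spiral \<alpha>))) x)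
        \<le> M / (1 + infdist x (spiral_boundary \<alpha>) * 2 ^ j) ^ 4"
    using convolution_decay[OF \<alpha> ad] by blast
  define r where "r = 2 powr - s"
  have r: "0 < r" "r < 1" using s powr_less_mono[of "- s" 0 2] by (auto simp: r_def)
  \<comment> \<open>16 = 2^4 arises from 2^(j-J) \<le> 2(1 + d 2^j) raised to the power 4; 2/(1 - r)
    is the two-sided geometric sum.\<close>
  define C1 where "C1 = (16 * M * (2 / (1 - r))) powr p"
  \<comment> \<open>27 = 3^3: at distance d \<ge> 1 one has 1 + |x| \<le> 3d, which turns d^(-3)
    into the tail.\<close>
  define C2 where "C2 = (2 * M) powr p * 27"
  define C where "C = C1 + C2"
  have C: "C1 > 0" "C2 > 0" "C > 0" using M r by (auto simp: C1_def C2_def C_def intro!: add_pos_pos)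
  show thesis
  proof (rule that[OF C(3)])
    fix m :: int and x :: "real^2"
    define a where "a j = norm (convolution (resolution \<phi>\<^sub>0 \<phi> j) (regular_distribution (indicator (spiral \<alpha>))) x)" for j
    have a0: "0 \<le> a j" for j by (simp add: a_def)
    define d where "d = infdist x (spiral_boundary \<alpha>)"
    have d0: "d \<ge> 0" by (simp add: d_def infdist_nonneg)
    have aM: "a j \<le> M" for j using M(2) by (simp add: a_def)
    have aM2: "a j \<le> M / (1 + d * 2 ^ j) ^ 4" if "j \<noteq> 0 \<or> x \<notin> spiral \<alpha>" for j
      using M(3)[OF that] by (simp add: a_def d_def)
    have p0: "0 < p" using p by simp
    have "TL_density q p s m a \<le> ennreal C * (layer \<alpha> (s * p) x + ennreal (1 / (1 + norm x) ^ 3))"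
    proof -
      consider "d = 0" | "0 < d" "d < 1" | "d \<ge> 1" using d0 by linarith
      then show ?thesis
      proof cases
        case 1
        then have "layer \<alpha> (s * p) x = top"
          using s p by (intro layer_eq_top) (auto simp: d_def)
        then show ?thesis using C by (simp add: ennreal_mult_top)
      next
        case 2
        obtain J where J: "d < 2 powr - real J" "2 powr - real J \<le> 2 * d"
          using dyadic_scale[OF 2] by blast
        let ?g = "\<lambda>j. if j < J then r ^ (J - j) else r ^ (j - J)"
        have term_le: "2 powr (real j * s) * a j \<le> 16 * M * 2 powr (real J * s) * ?g j" for j
        proof (cases "j \<le> J")
          case True
          have eq: "2 powr (real j * s) = 2 powr (real J * s) * r ^ (J - j)"
            using True by (simp add: r_def powr_nat_pos[symmetric] powr_add[symmetric] of_nat_diff algebra_simps)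
          have "2 powr (real j * s) * a j \<le> 2 powr (real j * s) * (16 * M)"
            using aM[of j] M(1) by (intro mult_left_mono) auto
          also have "\<dots> = 16 * M * 2 powr (real J * s) * r ^ (J - j)" unfolding eq by simp
          also have "r ^ (J - j) = ?g j" using True by auto
          finally show ?thesis .
        next
          case False
          then have j: "J < j" "j \<noteq> 0" by auto
          have "(2 powr real (j - J)) \<le> 2 * (d * 2 ^ j)"
          proof -
            have "2 powr real (j - J) = 2 powr - real J * 2 ^ j"
              using j by (simp add: powr_realpow[symmetric] powr_add[symmetric] of_nat_diff)
            also have "\<dots> \<le> 2 * d * 2 ^ j" using J by (intro mult_right_mono) auto
            finally show ?thesis by simp
          qed
          then have "2 powr real (j - J) \<le> 2 * (1 + d * 2 ^ j)" by simp
          then have "(2 powr real (j - J)) ^ 4 \<le> (2 * (1 + d * 2 ^ j)) ^ 4"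
            by (intro power_mono) auto
          then have le: "(2 powr real (j - J)) ^ 4 \<le> 16 * (1 + d * 2 ^ j) ^ 4"
            unfolding power_mult_distrib by simp
          have pos: "0 < (1 + d * 2 ^ j) ^ 4" using d0 by (intro zero_less_power add_pos_nonneg) auto
          have "a j \<le> M / (1 + d * 2 ^ j) ^ 4" by (intro aM2) (use j in simp)
          also have "\<dots> \<le> M * (16 / (2 powr real (j - J)) ^ 4)"
            using le pos M(1) by (simp add: field_simps)
          also have "16 / (2 powr real (j - J)) ^ 4 = 16 * 2 powr (- 4 * real (j - J))"
          proof -
            have "(2 powr real (j - J)) ^ 4 = 2 powr (4 * real (j - J))"
              by (simp add: powr_powr powr_realpow[symmetric] mult.commute)
            then show ?thesis by (simp add: powr_minus_divide)
          qed
          finally have "2 powr (real j * s) * a j \<le> 2 powr (real j * s) * (M * (16 * 2 powr (- 4 * real (j - J))))"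
            by (intro mult_left_mono) auto
          also have "\<dots> = 16 * M * 2 powr (real J * s) * 2 powr ((s - 4) * real (j - J))"
          proof -
            have "2 powr (real j * s) = 2 powr (real J * s) * 2 powr (s * real (j - J))"
              using j by (simp add: powr_add[symmetric] of_nat_diff algebra_simps)
            moreover have "2 powr (s * real (j - J)) * 2 powr (- 4 * real (j - J)) = 2 powr ((s - 4) * real (j - J))"
              by (simp add: powr_add[symmetric] algebra_simps)
            ultimately show ?thesis by (simp add: mult_ac)
          qed
          also have "\<dots> \<le> 16 * M * 2 powr (real J * s) * r ^ (j - J)"
          proof (intro mult_left_mono)
            have "(s - 4) * real (j - J) \<le> - s * real (j - J)" using s by (intro mult_right_mono) auto
            then have "2 powr ((s - 4) * real (j - J)) \<le> 2 powr (real (j - J) * - s)"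
              by (intro powr_mono) (simp_all add: mult.commute)
            then show "2 powr ((s - 4) * real (j - J)) \<le> r ^ (j - J)"
              unfolding powr_nat_pos r_def .
          qed (use M(1) in simp)
          finally show ?thesis using j by simp
        qed
        define A where "A = 16 * M * 2 powr (real J * s) * (2 / (1 - r))"
        have A0: "0 \<le> A" using M(1) r by (simp add: A_def)
        have "(\<Sum>j<n. 2 powr (real j * s) * a j) \<le> A" for n
        proof -
          have "(\<Sum>j<n. 2 powr (real j * s) * a j) \<le> (\<Sum>j<n. 16 * M * 2 powr (real J * s) * ?g j)"
            by (intro sum_mono term_le)
          also have "\<dots> = 16 * M * 2 powr (real J * s) * (\<Sum>j<n. ?g j)" by (simp only: sum_distrib_left)
          also have "\<dots> \<le> A"
            unfolding A_def using M(1) r by (intro mult_left_mono two_sided_geometric_sum_le) auto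
          finally show ?thesis .
        qed
        then have "TL_density q p s m a \<le> ennreal (A powr p)"
          by (intro TL_density_le q p0 a0 A0)
        also have "A powr p = C1 * 2 powr (real J * (s * p))"
        proof -
          have "A = (16 * M * (2 / (1 - r))) * 2 powr (real J * s)" by (simp add: A_def)
          then show ?thesis by (simp only: powr_mult powr_powr C1_def mult.assoc)
        qed
        also have "ennreal (C1 * 2 powr (real J * (s * p))) = ennreal C1 * ennreal (2 powr (real J * (s * p)))"
          using C by (intro ennreal_mult) auto
        also have "\<dots> \<le> ennreal C * (layer \<alpha> (s * p) x + ennreal (1 / (1 + norm x) ^ 3))"
        proof (intro mult_mono)
          show "ennreal C1 \<le> ennreal C" using C by (intro ennreal_leI) (simp add: C_def)
          have "ennreal (2 powr (real J * (s * p))) \<le> layer \<alpha> (s * p) x"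
            using J by (intro layer_ge) (simp add: d_def)
          also have "\<dots> \<le> layer \<alpha> (s * p) x + ennreal (1 / (1 + norm x) ^ 3)"
            by (rule add_increasing2) simp_all
          finally show "ennreal (2 powr (real J * (s * p))) \<le> layer \<alpha> (s * p) x + ennreal (1 / (1 + norm x) ^ 3)" .
        qed simp_all
        finally show ?thesis .
      next
        case 3
        \<comment> \<open>The origin is a boundary point, so d \<ge> 1 forces |x| \<ge> 1, outside
          the spiral; there the decay is available at level 0 too.\<close>
        have nS: "x \<notin> spiral \<alpha>"
        proof
          assume "x \<in> spiral \<alpha>"
          then have "norm x < 1" using norm_spiral_less[OF \<alpha>] powr_two_pi_less_1[OF \<alpha>] by force
          then show False using infdist_boundary_le[of x \<alpha>] 3 by (simp add: d_def)
        qed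
        have term_le: "2 powr (real j * s) * a j \<le> M / d ^ 4 * (1 / 2) ^ j" for j
        proof -
          have d4: "0 < d ^ 4" "0 < d" using 3 by simp_all
          have "(d * 2 ^ j) ^ 4 \<le> (1 + d * 2 ^ j) ^ 4" using d0 by (intro power_mono) auto
          then have "d ^ 4 * (2 ^ j) ^ 4 \<le> (1 + d * 2 ^ j) ^ 4" by (simp only: power_mult_distrib)
          then have "M / (1 + d * 2 ^ j) ^ 4 \<le> M / (d ^ 4 * (2 ^ j) ^ 4)"
            using M(1) d4 by (intro divide_left_mono) (auto intro!: mult_pos_pos zero_less_power add_pos_nonneg simp: d0 d4)
          then have aj: "a j \<le> M / (d ^ 4 * (2 ^ j) ^ 4)" using aM2[of j] nS by auto
          have "2 powr (real j * s) \<le> 2 powr (real j * 1)" using s by (intro powr_mono mult_left_mono) auto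
          then have "2 powr (real j * s) \<le> (2 ^ j) ^ 1" by (simp add: powr_realpow)
          then have "2 powr (real j * s) * a j \<le> (2 ^ j) ^ 1 * (M / (d ^ 4 * (2 ^ j) ^ 4))"
            using aj a0[of j] by (intro mult_mono) auto
          also have "\<dots> \<le> (2 ^ j) ^ 3 * (M / (d ^ 4 * (2 ^ j) ^ 4))"
            using M(1) d4 by (intro mult_right_mono power_increasing) auto
          also have "\<dots> = M / d ^ 4 * (1 / 2) ^ j"
            using d4 by (simp add: power_one_over power4_eq_xxxx power3_eq_cube divide_simps)
          finally show ?thesis .
        qed
        define A where "A = 2 * M / d ^ 4"
        have A0: "0 \<le> A" using M(1) by (simp add: A_def)
        have "(\<Sum>j<n. 2 powr (real j * s) * a j) \<le> A" for n
        proof -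
          have "(\<Sum>j<n. 2 powr (real j * s) * a j) \<le> (\<Sum>j<n. M / d ^ 4 * (1 / 2) ^ j)"
            by (intro sum_mono term_le)
          also have "\<dots> = M / d ^ 4 * (\<Sum>j<n. (1 / 2) ^ j)" by (simp only: sum_distrib_left)
          also have "\<dots> \<le> M / d ^ 4 * (1 / (1 - 1 / 2))"
            using M(1) by (intro mult_left_mono geometric_sum_le) auto
          finally show ?thesis by (simp add: A_def mult.commute[of M])
        qed
        then have "TL_density q p s m a \<le> ennreal (A powr p)"
          by (intro TL_density_le q p0 a0 A0)
        also have "\<dots> \<le> ennreal (C2 * (1 / (1 + norm x) ^ 3))"
        proof (intro ennreal_leI)
          have x3: "1 + norm x \<le> 3 * d" using infdist_boundary_ge[OF \<alpha>, of x] 3 by (simp add: d_def)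
          have "A powr p = (2 * M) powr p * (1 / d ^ 4) powr p"
            by (simp only: A_def powr_mult[symmetric]) simp
          also have "(1 / d ^ 4) powr p \<le> 27 * (1 / (1 + norm x) ^ 3)"
          proof -
            have "1 \<le> d ^ 4" using 3 by simp
            then have "0 < d ^ 4" by linarith
            then have "0 < 1 / d ^ 4" "1 / d ^ 4 \<le> 1"
              using \<open>1 \<le> d ^ 4\<close> by (simp_all only: divide_le_eq_1_pos zero_less_divide_1_iff)
            then have "(1 / d ^ 4) powr p \<le> (1 / d ^ 4) powr 1" using p by (intro powr_mono') auto
            also have "\<dots> = 1 / d ^ 4" using \<open>0 < 1 / d ^ 4\<close> by simp
            also have "\<dots> \<le> 1 / d ^ 3" using 3 by (intro divide_left_mono power_increasing) auto
            also have "\<dots> \<le> 27 * (1 / (1 + norm x) ^ 3)"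
            proof -
              have "(1 + norm x) ^ 3 \<le> (3 * d) ^ 3" using x3 by (intro power_mono) auto
              then have "(1 + norm x) ^ 3 \<le> 27 * d ^ 3" unfolding power_mult_distrib by simp
              moreover have "0 < (1 + norm x) ^ 3" by (intro zero_less_power add_pos_nonneg) auto
              moreover have "0 < d ^ 3" using 3 by simp
              ultimately show ?thesis by (simp add: divide_simps)
            qed
            finally show ?thesis .
          qed
          finally show "A powr p \<le> C2 * (1 / (1 + norm x) ^ 3)" by (simp add: C2_def mult_left_mono)
        qed
        also have "\<dots> = ennreal C2 * ennreal (1 / (1 + norm x) ^ 3)"
          using C by (intro ennreal_mult) auto
        also have "\<dots> \<le> ennreal C * (layer \<alpha> (s * p) x + ennreal (1 / (1 + norm x) ^ 3))"
        proof (intro mult_mono)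
          show "ennreal C2 \<le> ennreal C" using C by (intro ennreal_leI) (simp add: C_def)
          show "ennreal (1 / (1 + norm x) ^ 3) \<le> layer \<alpha> (s * p) x + ennreal (1 / (1 + norm x) ^ 3)"
            by (rule add_increasing) simp_all
        qed simp_all
        finally show ?thesis .
      qed
    qed
    then show "TL_density q p s m (\<lambda>j. norm (convolution (resolution \<phi>\<^sub>0 \<phi> j)
        (regular_distribution (indicator (spiral \<alpha>))) x))
      \<le> ennreal C * (layer \<alpha> (s * p) x + ennreal (1 / (1 + norm x) ^ 3))"
      unfolding a_def .
  qed
qed

text \<open>Integration of the pointwise bound over a cube gives min(1, 2^(-m\<kappa>)) for the
  \<open>layer\<close> term, and 2\<tau>p \<le> \<kappa> makes this admissible. For the tail, small
  cubes use their area and \<tau>p < 1, while large cubes use the finite total mass.\<close>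

lemma spiral_TL_space:
  assumes \<alpha>: "0 < \<alpha>" and ad: "admissible_pair \<phi>\<^sub>0 \<phi>" and p: "1 \<le> p" and q: "1 \<le> q" and s: "0 < s" "s \<le> 1"
    and \<tau>: "0 \<le> \<tau>" "\<tau> < 1 / p" and sp: "s * p < 1" and \<kappa>: "0 < 2 - s * p * (1 + 1 / \<alpha>)"
    and \<kappa>\<tau>: "2 * \<tau> * p \<le> 2 - s * p * (1 + 1 / \<alpha>)"
  shows "regular_distribution (indicator (spiral \<alpha>)) \<in> TL_space \<phi>\<^sub>0 \<phi> s \<tau> p q"
proof -
  have "spiral \<alpha> \<subseteq> ball 0 1"
    using norm_spiral_less[OF \<alpha>] powr_two_pi_less_1[OF \<alpha>] by fastforce
  then have bdd: "bounded (spiral \<alpha>)" using bounded_ball bounded_subset by blast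
  define \<kappa> where "\<kappa> = 2 - s * p * (1 + 1 / \<alpha>)"
  have sp0: "0 < s * p" using s p by simp
  obtain C where C: "C > 0"
    "\<And>m x. TL_density q p s m (\<lambda>j. norm (convolution (resolution \<phi>\<^sub>0 \<phi> j)
        (regular_distribution (indicator (spiral \<alpha>))) x))
      \<le> ennreal C * (layer \<alpha> (s * p) x + ennreal (1 / (1 + norm x) ^ 3))"
    using TL_density_le_layer[OF \<alpha> ad p q s] by blast
  obtain D where D: "D \<ge> 0"
    "\<And>m k. (\<integral>\<^sup>+x\<in>dyadic_cube m k. layer \<alpha> (s * p) x \<partial>lborel)
        \<le> ennreal (D * min 1 (2 powr (- real_of_int m * \<kappa>)))"
    using layer_integral_dyadic[OF \<alpha> sp0 sp \<kappa>] unfolding \<kappa>_def by blast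
  define E where "E = enn2real (\<integral>\<^sup>+(x::real^2). ennreal (1 / (1 + norm x) ^ 3) \<partial>lborel)"
  have "(\<integral>\<^sup>+(x::real^2). ennreal (1 / (1 + norm x) ^ 3) \<partial>lborel) < \<infinity>"
    using nn_integral_decay_finite[where 'a="real^2"] by (simp add: numeral_3_eq_3 del: power_Suc)
  then have E: "(\<integral>\<^sup>+(x::real^2). ennreal (1 / (1 + norm x) ^ 3) \<partial>lborel) = ennreal E" "E \<ge> 0"
    by (auto simp: E_def)
  have "TL_norm \<phi>\<^sub>0 \<phi> s \<tau> p q (regular_distribution (indicator (spiral \<alpha>))) < \<infinity>"
  proof (subst TL_norm_finite_iff)
    show "0 < p" using p by simp
    show "\<exists>B\<ge>0. \<forall>m k. (\<integral>\<^sup>+x\<in>dyadic_cube m k. TL_density q p s m (\<lambda>j. norm (convolution (resolution \<phi>\<^sub>0 \<phi> j)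
        (regular_distribution (indicator (spiral \<alpha>))) x)) \<partial>lborel)
      \<le> ennreal (B * 2 powr (- real_of_int m * real CARD(2) * \<tau> * p))"
    proof (intro exI[of _ "C * (D + E + 1)"] conjI allI)
      show "0 \<le> C * (D + E + 1)" using C D E by simp
      fix m :: int and k :: "int^2"
      let ?P = "dyadic_cube m k"
      define e where "e = 2 powr (- real_of_int m * real CARD(2) * \<tau> * p)"
      have 1: "D * min 1 (2 powr (- real_of_int m * \<kappa>)) \<le> D * e"
      proof (intro mult_left_mono D)
        show "min 1 (2 powr (- real_of_int m * \<kappa>)) \<le> e"
        proof (cases "m \<ge> 0")
          case True
          have "real_of_int m * (2 * \<tau> * p) \<le> real_of_int m * \<kappa>"
            using True \<kappa>\<tau> by (intro mult_left_mono) (auto simp: \<kappa>_def)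
          then have "2 powr (- real_of_int m * \<kappa>) \<le> e"
            unfolding e_def by (intro powr_mono) (auto simp: mult_ac)
          then show ?thesis by simp
        next
          case False
          have "0 \<le> - real_of_int m * (real CARD(2) * \<tau> * p)" using False \<tau> p by (intro mult_nonneg_nonneg) auto
          then have "1 \<le> e" unfolding e_def by (intro ge_one_powr_ge_zero) (auto simp: mult.assoc)
          then show ?thesis by simp
        qed
      qed
      have 2: "(\<integral>\<^sup>+x\<in>?P. ennreal (1 / (1 + norm x) ^ 3) \<partial>lborel) \<le> ennreal ((E + 1) * e)"
      proof (cases "m \<ge> 0")
        case True
        have "(\<integral>\<^sup>+x\<in>?P. ennreal (1 / (1 + norm x) ^ 3) \<partial>lborel) \<le> (\<integral>\<^sup>+x. indicator ?P x \<partial>lborel)"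
        proof (intro nn_integral_mono)
          fix x :: "real^2"
          have "1 \<le> (1 + norm x) ^ 3" by (intro one_le_power) simp
          then have "1 / (1 + norm x) ^ 3 \<le> 1 / 1" by (intro divide_left_mono) (simp_all add: add_pos_nonneg)
          then show "ennreal (1 / (1 + norm x) ^ 3) * indicator ?P x \<le> indicator ?P x"
            by (auto simp: indicator_def ennreal_le_1)
        qed
        also have "\<dots> = ennreal ((2 powr - real_of_int m)\<^sup>2)" by (simp add: emeasure_dyadic_cube)
        also have "\<dots> \<le> ennreal ((E + 1) * e)"
        proof (intro ennreal_leI)
          have "\<tau> * p < 1" using \<tau> p by (simp add: pos_less_divide_eq)
          then have "real_of_int m * (\<tau> * p) \<le> real_of_int m * 1" using True by (intro mult_left_mono) auto
          then have "2 powr (- real_of_int m * 2) \<le> e" unfolding e_def by (intro powr_mono) (auto simp: mult_ac)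
          moreover have "(2 powr - real_of_int m)\<^sup>2 = 2 powr (- real_of_int m * 2)"
            by (simp only: powr_powr[symmetric]) (simp add: powr_numeral)
          moreover have "1 * e \<le> (E + 1) * e" using E by (intro mult_right_mono) (auto simp: e_def)
          ultimately show "(2 powr - real_of_int m)\<^sup>2 \<le> (E + 1) * e" by linarith
        qed
        finally show ?thesis .
      next
        case False
        have "(\<integral>\<^sup>+x\<in>?P. ennreal (1 / (1 + norm x) ^ 3) \<partial>lborel) \<le> (\<integral>\<^sup>+(x::real^2). ennreal (1 / (1 + norm x) ^ 3) \<partial>lborel)"
          by (intro nn_integral_mono) (auto simp: indicator_def)
        also have "\<dots> \<le> ennreal ((E + 1) * e)"
          unfolding E(1)
        proof (intro ennreal_leI)
          have "0 \<le> - real_of_int m * (real CARD(2) * \<tau> * p)" using False \<tau> p by (intro mult_nonneg_nonneg) auto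
          then have "1 \<le> e" unfolding e_def by (intro ge_one_powr_ge_zero) (auto simp: mult.assoc)
          then have "(E + 1) * 1 \<le> (E + 1) * e" using E by (intro mult_left_mono) auto
          then show "E \<le> (E + 1) * e" by simp
        qed
        finally show ?thesis .
      qed
      have "(\<integral>\<^sup>+x\<in>?P. TL_density q p s m (\<lambda>j. norm (convolution (resolution \<phi>\<^sub>0 \<phi> j)
          (regular_distribution (indicator (spiral \<alpha>))) x)) \<partial>lborel)
        \<le> (\<integral>\<^sup>+x. ennreal C * (layer \<alpha> (s * p) x * indicator ?P x + ennreal (1 / (1 + norm x) ^ 3) * indicator ?P x) \<partial>lborel)"
        using C(2) by (intro nn_integral_mono) (auto simp: indicator_def)
      also have "\<dots> = ennreal C * ((\<integral>\<^sup>+x\<in>?P. layer \<alpha> (s * p) x \<partial>lborel) + (\<integral>\<^sup>+x\<in>?P. ennreal (1 / (1 + norm x) ^ 3) \<partial>lborel))"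
      proof -
        have m: "(\<lambda>x. layer \<alpha> (s * p) x * indicator ?P x) \<in> borel_measurable lborel"
          "(\<lambda>x. ennreal (1 / (1 + norm x) ^ 3) * indicator ?P x) \<in> borel_measurable lborel"
          using layer_measurable[of \<alpha> "s * p"] dyadic_cube_borel[of m k]
          by (auto intro!: borel_measurable_times_ennreal borel_measurable_indicator)
        show ?thesis
          by (simp only: nn_integral_cmult[OF borel_measurable_add[OF m]] nn_integral_add[OF m])
      qed
      also have "\<dots> \<le> ennreal C * (ennreal (D * e) + ennreal ((E + 1) * e))"
        using order_trans[OF D(2) ennreal_leI[OF 1]] 2 by (intro mult_left_mono add_mono) auto
      also have "\<dots> = ennreal (C * (D + E + 1) * e)"
        using C D E by (simp add: ennreal_mult[symmetric] ennreal_plus[symmetric] e_def algebra_simps del: ennreal_plus)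
      finally show "(\<integral>\<^sup>+x\<in>?P. TL_density q p s m (\<lambda>j. norm (convolution (resolution \<phi>\<^sub>0 \<phi> j)
          (regular_distribution (indicator (spiral \<alpha>))) x)) \<partial>lborel)
        \<le> ennreal (C * (D + E + 1) * 2 powr (- real_of_int m * real CARD(2) * \<tau> * p))"
        by (simp only: e_def)
    qed
  qed
  then show ?thesis
    using regular_distribution_indicator_tempered[OF spiral_borel[OF \<alpha>] bdd] by (simp add: TL_space_def)
qed


subsection \<open>Necessity\<close>

text \<open>At a scale \<open>h\<close> much smaller than the width of the coils, the outer boundary curve near the
  positive first axis is almost vertical: the distance that the phase \<open>u - t\<close> moves in the radial
  direction dominates what it moves along the curve.\<close>

lemma curve_looks_vertical:
  assumes \<alpha>: "0 < \<alpha>" and \<epsilon>: "0 < \<epsilon>" and M: "1 \<le> M"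
  obtains g0 \<eta> \<phi>0 where "0 < g0" "0 < \<eta>" "\<eta> \<le> 1 / 4"
    "\<And>k \<theta> \<phi> h y. \<lbrakk>\<phi> = \<theta> + 2 * pi * of_int k; 0 \<le> \<theta>; \<theta> \<le> \<eta>; \<phi>0 \<le> \<phi>; 0 < h; h * \<phi> powr (\<alpha> + 1) \<le> g0;
        norm (y - polar_pt \<alpha> \<phi> \<phi>) \<le> h * M\<rbrakk> \<Longrightarrow>
      ((y - polar_pt \<alpha> \<phi> \<phi>) $ 1 \<le> - h * \<epsilon> \<longrightarrow> y \<in> spiral \<alpha>) \<and>
      ((y - polar_pt \<alpha> \<phi> \<phi>) $ 1 \<ge> h * \<epsilon> \<longrightarrow> y \<notin> spiral \<alpha>) \<and>
      (\<phi> + 1) powr - \<alpha> \<le> norm y \<and> norm y \<le> (\<phi> - 1) powr - \<alpha> \<and>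
      (\<eta> / 2 \<le> \<theta> \<longrightarrow> 0 \<le> y $ 1 \<and> 0 \<le> y $ 2)"
proof -
  define b where "b = - (1 / \<alpha>)"
  define K1 where "K1 = \<bar>b\<bar> * 2 powr - \<bar>b - 1\<bar>"
  define K2 where "K2 = \<bar>b\<bar> * 2 powr \<bar>b - 1\<bar>"
  have K: "K1 > 0" "K2 > 0" using \<alpha> by (auto simp: K1_def K2_def b_def)
  \<comment> \<open>At angles up to \<eta> the tangential displacement enters the radial one with at
    most h\<epsilon>/4, while cos \<theta> \<ge> 1/2 leaves at least h\<epsilon>/2 from the first
    coordinate.\<close>
  define \<eta> where "\<eta> = min (1 / 4) (\<epsilon> / (4 * M))"
  have \<eta>: "0 < \<eta>" "\<eta> \<le> 1 / 4" "\<eta> * M \<le> \<epsilon> / 4"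
  proof -
    show "0 < \<eta>" "\<eta> \<le> 1 / 4" using \<epsilon> M by (auto simp: \<eta>_def)
    have "\<eta> * M \<le> \<epsilon> / (4 * M) * M" using M by (intro mult_right_mono) (auto simp: \<eta>_def)
    then show "\<eta> * M \<le> \<epsilon> / 4" using M by simp
  qed
  \<comment> \<open>A sum of all factors X for which hX \<le> |p| or gX \<le> 1 is wanted, where g
    is the ratio of h to the coil width \<phi>^(-\<alpha>-1). The single condition g \<le> 1/Z
    yields all of them.\<close>
  define Z where "Z = 4 * M\<^sup>2 / \<epsilon> + 2 * M + K2 * M + 5 * M + 4 * M / \<eta> + \<epsilon> + 1"
  have nn: "0 \<le> 4 * M\<^sup>2 / \<epsilon>" "0 \<le> 2 * M" "0 \<le> K2 * M" "0 \<le> 5 * M" "0 \<le> 4 * M / \<eta>"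
    using M \<epsilon> K \<eta> by auto
  have Z: "4 * M\<^sup>2 / \<epsilon> \<le> Z" "2 * M \<le> Z" "K2 * M \<le> Z" "5 * M \<le> Z" "4 * M / \<eta> \<le> Z" "\<epsilon> \<le> Z" "1 \<le> Z"
    unfolding Z_def using nn \<epsilon> by linarith+
  define g0 where "g0 = 1 / Z"
  have g0: "g0 > 0" using Z(7) by (simp add: g0_def)
  \<comment> \<open>Ensures that a radial change of h\<epsilon>/8 moves u more than the angle can
    move, namely 5hM/\<rho>; 40 is 5 * 8. The summand 4\<pi> keeps away from the first turn.\<close>
  define \<phi>0 where "\<phi>0 = 4 * pi + (40 * M / (K1 * \<epsilon>) + 1)"
  have \<phi>0: "\<phi>0 \<ge> 4 * pi" "40 * M / (K1 * \<epsilon>) < \<phi>0"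
    using M K \<epsilon> two_pi_gt by (auto simp: \<phi>0_def intro: add_nonneg_nonneg)
  show thesis
  proof (rule that[OF g0 \<eta>(1,2)])
    fix k :: int and \<theta> \<phi> h :: real and y :: "real^2"
    assume \<phi>: "\<phi> = \<theta> + 2 * pi * of_int k" and \<theta>: "0 \<le> \<theta>" "\<theta> \<le> \<eta>" and \<phi>\<phi>0: "\<phi>0 \<le> \<phi>" and h: "0 < h"
      and hg: "h * \<phi> powr (\<alpha> + 1) \<le> g0" and y: "norm (y - polar_pt \<alpha> \<phi> \<phi>) \<le> h * M"
    define p where "p = polar_pt \<alpha> \<phi> \<phi>"
    define \<rho> where "\<rho> = \<phi> powr - \<alpha>"
    have \<phi>12: "\<phi> > 12" "\<phi> \<ge> 4 * pi" using \<phi>\<phi>0 \<phi>0 two_pi_gt by linarith+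
    have \<rho>: "\<rho> > 0" using \<phi>12 by (simp add: \<rho>_def)
    have ray\<phi>: "ray \<phi> = ray \<theta>" unfolding \<phi> by (rule ray_add_2pi)
    have p: "p = \<rho> *\<^sub>R ray \<theta>" by (simp add: p_def polar_pt_def \<rho>_def ray\<phi>)
    have np: "norm p = \<rho>" using \<rho> by (simp add: p)
    define g where "g = h * \<phi> powr (\<alpha> + 1)"
    have g: "g > 0" using h \<phi>12 by (simp add: g_def)
    have gZ: "g * Z \<le> 1" using hg Z(7) by (simp add: g_def g0_def pos_le_divide_eq)
    have gX: "g * X \<le> 1" if "X \<le> Z" for X
      using mult_left_mono[OF that, of g] g gZ by linarith
    have hg': "h * \<phi> = g * \<rho>"
      using \<phi>12 by (simp add: g_def \<rho>_def powr_add powr_minus)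
    have "h * 1 \<le> h * \<phi>" using h \<phi>12 by (intro mult_left_mono) auto
    then have h\<rho>: "h \<le> g * \<rho>" using hg' by simp
    have h\<rho>X: "h * X \<le> \<rho>" if "X \<le> Z" "0 \<le> X" for X
    proof -
      have "h * X \<le> g * \<rho> * X" using h\<rho> that by (intro mult_right_mono) auto
      also have "\<dots> = g * X * \<rho>" by simp
      also have "\<dots> \<le> 1 * \<rho>" using gX[OF that(1)] \<rho> by (intro mult_right_mono) auto
      finally show ?thesis by simp
    qed
    have hM: "h * M \<le> \<rho> / 2" using h\<rho>X[of "2 * M"] Z M by simp
    have hM\<eta>: "h * M \<le> \<rho> * \<eta> / 4"
      using h\<rho>X[of "4 * M / \<eta>"] Z M \<eta> by (simp add: pos_divide_le_eq mult.commute mult.left_commute)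
    have hM2: "h * M\<^sup>2 \<le> \<rho> * \<epsilon> / 4"
      using h\<rho>X[of "4 * M\<^sup>2 / \<epsilon>"] Z M \<epsilon> by (simp add: pos_divide_le_eq mult.commute mult.left_commute)
    have h\<epsilon>: "h * \<epsilon> \<le> \<rho>" using h\<rho>X[of \<epsilon>] Z \<epsilon> by simp
    define v where "v = y - p"
    have v: "norm v \<le> h * M" using y by (simp add: v_def p_def)
    have yv: "y = p + v" by (simp add: v_def)
    have ny: "\<bar>norm y - \<rho>\<bar> \<le> h * M"
      using norm_triangle_ineq3[of y p] v np by (simp add: v_def)
    then have ny2: "\<rho> / 2 \<le> norm y" "norm y \<le> 2 * \<rho>" "0 < norm y" using hM \<rho> by linarith+
    have cos\<theta>: "cos \<theta> \<ge> 1 / 2"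
    proof -
      have "cos (pi / 3) \<le> cos \<theta>" using \<theta> \<eta> two_pi_gt by (intro cos_monotone_0_pi_le) auto
      then show ?thesis by (simp add: cos_60)
    qed
    have sin\<theta>: "0 \<le> sin \<theta>" "sin \<theta> \<le> \<eta>" "\<theta> / 2 \<le> sin \<theta>"
    proof -
      show s0: "0 \<le> sin \<theta>" using \<theta> \<eta> two_pi_gt by (intro sin_ge_zero) auto
      show "sin \<theta> \<le> \<eta>" using sin_x_le_x[of \<theta>] \<theta> by linarith
      show "\<theta> / 2 \<le> sin \<theta>" using abs_sin_ge_half[of \<theta>] cos\<theta> \<theta> \<eta> two_pi_gt s0 by simp
    qed
    have v2: "\<bar>v $ 2\<bar> \<le> h * M" "\<bar>v $ 1\<bar> \<le> h * M" using v component_le_norm_cart[of v] order_trans by blast+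
    have sv: "\<bar>sin \<theta> * v $ 2\<bar> \<le> h * \<epsilon> / 4"
    proof -
      have "\<bar>sin \<theta> * v $ 2\<bar> \<le> \<eta> * (h * M)"
        unfolding abs_mult using sin\<theta> v2 \<eta> by (intro mult_mono) auto
      also have "\<dots> = h * (\<eta> * M)" by simp
      also have "\<dots> \<le> h * (\<epsilon> / 4)" using \<eta> h by (intro mult_left_mono) auto
      finally show ?thesis by simp
    qed
    have pv: "p \<bullet> v = \<rho> * (cos \<theta> * v $ 1 + sin \<theta> * v $ 2)"
      by (simp add: p inner_vec_def sum_2 algebra_simps)
    have ny_sq: "(norm y)\<^sup>2 = \<rho>\<^sup>2 + 2 * (p \<bullet> v) + (norm v)\<^sup>2"
      unfolding yv np[symmetric] power2_norm_eq_inner by (simp add: inner_add_left inner_add_right inner_commute)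
    define s where "s = h * \<epsilon> / 8"
    have s: "0 < s" "s \<le> \<rho>" using h \<epsilon> h\<epsilon> \<rho> by (auto simp: s_def)
    define u where "u = norm y powr b"
    have u: "u > 0" "u powr - \<alpha> = norm y" using ny2 \<alpha> by (auto simp: u_def b_def powr_minus_inverse)
    have \<phi>b: "\<phi> = \<rho> powr b" using \<phi>12 \<alpha> by (simp add: \<rho>_def b_def powr_powr)
    obtain t where t: "y = norm y *\<^sub>R ray t" "\<bar>t - \<phi>\<bar> \<le> 5 * norm (y - \<rho> *\<^sub>R ray \<phi>) / \<rho>"
      by (rule polar_angle_near[OF \<rho>])
    have yut: "y = polar_pt \<alpha> u t" using t(1) u by (simp add: polar_pt_def)
    have th: "\<bar>t - \<phi>\<bar> * \<rho> \<le> 5 * (h * M)"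
    proof -
      have "norm (y - \<rho> *\<^sub>R ray \<phi>) \<le> h * M" using y by (simp add: polar_pt_def \<rho>_def)
      moreover have "\<bar>t - \<phi>\<bar> * \<rho> \<le> 5 * norm (y - \<rho> *\<^sub>R ray \<phi>)" using t(2) \<rho> by (simp add: pos_le_divide_eq)
      ultimately show ?thesis by linarith
    qed
    have t1: "\<bar>t - \<phi>\<bar> \<le> 1"
    proof -
      have "5 * (h * M) \<le> \<rho>" using h\<rho>X[of "5 * M"] Z M by simp
      then have "\<bar>t - \<phi>\<bar> * \<rho> \<le> 1 * \<rho>" using th by linarith
      then show ?thesis using \<rho> by (simp only: mult_le_cancel_right_pos)
    qed
    have \<rho>b: "\<rho> powr (b - 1) = \<phi> / \<rho>"
      using \<rho> by (simp add: powr_diff \<phi>b[symmetric])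
    have u1: "\<bar>u - \<phi>\<bar> \<le> 1"
    proof -
      have "\<bar>u - \<phi>\<bar> \<le> K2 * \<rho> powr (b - 1) * \<bar>norm y - \<rho>\<bar>"
        unfolding u_def K2_def \<phi>b using ny2 \<rho> by (intro powr_diff_bounds(1)) auto
      also have "\<dots> \<le> K2 * (\<phi> / \<rho>) * (h * M)"
        unfolding \<rho>b using ny K \<rho> \<phi>12 by (intro mult_left_mono) auto
      also have "\<dots> = K2 * M * (h * \<phi>) / \<rho>" by simp
      also have "\<dots> = g * (K2 * M)" unfolding hg' using \<rho> by simp
      also have "\<dots> \<le> 1" using gX[of "K2 * M"] Z by simp
      finally show ?thesis .
    qed
    have ulow: "K1 * (\<phi> / \<rho>) * \<bar>norm y - \<rho>\<bar> \<le> \<bar>u - \<phi>\<bar>"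
      unfolding u_def K1_def \<phi>b \<rho>b[unfolded \<phi>b, symmetric] using ny2 \<rho> by (intro powr_diff_bounds(2)) auto
    \<comment> \<open>A radial change of at least s moves u by at least K1 (\<phi>/\<rho>) s, which
      carries the large factor \<phi> that the angular change lacks. Hence the sign of u - t is that
      of u - \<phi>, and so it is decided by the radius alone.\<close>
    have key: "\<bar>t - \<phi>\<bar> < \<bar>u - \<phi>\<bar>" if "s \<le> \<bar>norm y - \<rho>\<bar>"
    proof -
      have "5 * M < K1 * \<phi> * (\<epsilon> / 8)"
      proof -
        have "40 * M / (K1 * \<epsilon>) < \<phi>" using \<phi>0 \<phi>\<phi>0 by linarith
        then have "40 * M < \<phi> * (K1 * \<epsilon>)" using K \<epsilon> by (simp add: pos_divide_less_eq)
        then show ?thesis by (simp add: mult_ac)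
      qed
      then have "h * (5 * M) < h * (K1 * \<phi> * (\<epsilon> / 8))" using h by (simp only: mult_less_cancel_left_pos)
      then have "\<bar>t - \<phi>\<bar> * \<rho> < K1 * \<phi> * s" using th by (simp add: s_def mult_ac)
      also have "\<dots> \<le> K1 * \<phi> * \<bar>norm y - \<rho>\<bar>" using that K \<phi>12 by (intro mult_left_mono) auto
      also have "\<dots> = K1 * (\<phi> / \<rho>) * \<bar>norm y - \<rho>\<bar> * \<rho>" using \<rho> by simp
      also have "\<dots> \<le> \<bar>u - \<phi>\<bar> * \<rho>" using ulow \<rho> by (intro mult_right_mono) auto
      finally show ?thesis using \<rho> by (simp only: mult_less_cancel_right_pos)
    qed
    have in_S: "y \<in> spiral \<alpha>" if "v $ 1 \<le> - h * \<epsilon>"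
    proof -
      have "cos \<theta> * v $ 1 \<le> cos \<theta> * (- h * \<epsilon>)" using that cos\<theta> by (intro mult_left_mono) auto
      moreover have "1 / 2 * (h * \<epsilon>) \<le> cos \<theta> * (h * \<epsilon>)" using cos\<theta> h \<epsilon> by (intro mult_right_mono) auto
      ultimately have "cos \<theta> * v $ 1 + sin \<theta> * v $ 2 \<le> - (h * \<epsilon>) / 4" using sv by (simp add: abs_le_iff)
      then have "p \<bullet> v \<le> \<rho> * (- (h * \<epsilon>) / 4)" unfolding pv using \<rho> by (intro mult_left_mono) auto
      moreover have "(norm v)\<^sup>2 \<le> h * (\<rho> * \<epsilon> / 4)"
      proof -
        have "(norm v)\<^sup>2 \<le> (h * M)\<^sup>2" using v by (intro power_mono) auto
        also have "\<dots> = h * (h * M\<^sup>2)" by (simp add: power2_eq_square)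
        also have "\<dots> \<le> h * (\<rho> * \<epsilon> / 4)" using hM2 h by (intro mult_left_mono) auto
        finally show ?thesis .
      qed
      ultimately have "(norm y)\<^sup>2 \<le> \<rho>\<^sup>2 - 2 * \<rho> * s" unfolding ny_sq s_def by (simp add: algebra_simps)
      also have "\<dots> \<le> (\<rho> - s)\<^sup>2" by (simp add: power2_diff)
      finally have nys: "norm y \<le> \<rho> - s" by (rule power2_le_imp_le) (use s in simp)
      then have "\<rho> powr b \<le> u" unfolding u_def b_def using ny2 s \<alpha> by (intro powr_mono2') auto
      then have "\<phi> \<le> u" by (simp only: \<phi>b)
      moreover have "s \<le> \<bar>norm y - \<rho>\<bar>" using nys by linarith
      ultimately have "t < u" using key by linarith
      moreover have "u \<le> t + pi" using u1 t1 two_pi_gt by linarith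
      moreover have "2 * pi \<le> t" using t1 \<phi>12 two_pi_gt by linarith
      ultimately show ?thesis unfolding yut by (intro polar_pt_in_spiral \<alpha>)
    qed
    have notin_S: "y \<notin> spiral \<alpha>" if "v $ 1 \<ge> h * \<epsilon>"
    proof -
      have "cos \<theta> * (h * \<epsilon>) \<le> cos \<theta> * v $ 1" using that cos\<theta> by (intro mult_left_mono) auto
      moreover have "1 / 2 * (h * \<epsilon>) \<le> cos \<theta> * (h * \<epsilon>)" using cos\<theta> h \<epsilon> by (intro mult_right_mono) auto
      ultimately have "(h * \<epsilon>) / 4 \<le> cos \<theta> * v $ 1 + sin \<theta> * v $ 2" using sv by (simp add: abs_le_iff)
      then have "\<rho> * ((h * \<epsilon>) / 4) \<le> p \<bullet> v" unfolding pv using \<rho> by (intro mult_left_mono) auto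
      moreover have "4 * \<rho> * s = 2 * (\<rho> * ((h * \<epsilon>) / 4))" by (simp add: s_def)
      ultimately have "\<rho>\<^sup>2 + 4 * \<rho> * s \<le> (norm y)\<^sup>2"
        unfolding ny_sq using zero_le_power2[of "norm v"] by linarith
      moreover have "(\<rho> + s)\<^sup>2 \<le> \<rho>\<^sup>2 + 4 * \<rho> * s"
        using mult_right_mono[OF s(2), of s] s by (simp add: power2_eq_square algebra_simps)
      ultimately have "(\<rho> + s)\<^sup>2 \<le> (norm y)\<^sup>2" by linarith
      then have nys: "\<rho> + s \<le> norm y" by (rule power2_le_imp_le) simp
      then have "u \<le> \<rho> powr b" unfolding u_def b_def using \<rho> s \<alpha> by (intro powr_mono2') auto
      then have "u \<le> \<phi>" by (simp only: \<phi>b)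
      moreover have "s \<le> \<bar>norm y - \<rho>\<bar>" using nys by linarith
      ultimately have "u < t" using key by linarith
      then show ?thesis unfolding yut using u u1 t1 two_pi_gt by (intro polar_pt_notin_spiral \<alpha>) linarith+
    qed
    have "(\<phi> + 1) powr - \<alpha> \<le> u powr - \<alpha>" "u powr - \<alpha> \<le> (\<phi> - 1) powr - \<alpha>"
      using u(1) u1 \<phi>12 \<alpha> by (intro powr_mono2'; linarith)+
    \<comment> \<open>Angles of at least \<eta>/2 keep the whole neighbourhood in the first
      quadrant, so that a single dyadic cube with corner 0 captures it.\<close>
    moreover have "0 \<le> y $ 1 \<and> 0 \<le> y $ 2" if "\<eta> / 2 \<le> \<theta>"
    proof
      have "\<rho> * (1 / 2) \<le> \<rho> * cos \<theta>" using cos\<theta> \<rho> by (intro mult_left_mono) auto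
      then show "0 \<le> y $ 1" using v2(2) hM by (simp add: yv p abs_le_iff)
      have "\<rho> * (\<eta> / 4) \<le> \<rho> * sin \<theta>" using sin\<theta> that \<rho> by (intro mult_left_mono) auto
      then show "0 \<le> y $ 2" using v2(1) hM\<eta> by (simp add: yv p abs_le_iff)
    qed
    ultimately show "((y - polar_pt \<alpha> \<phi> \<phi>) $ 1 \<le> - h * \<epsilon> \<longrightarrow> y \<in> spiral \<alpha>) \<and>
      ((y - polar_pt \<alpha> \<phi> \<phi>) $ 1 \<ge> h * \<epsilon> \<longrightarrow> y \<notin> spiral \<alpha>) \<and>
      (\<phi> + 1) powr - \<alpha> \<le> norm y \<and> norm y \<le> (\<phi> - 1) powr - \<alpha> \<and>
      (\<eta> / 2 \<le> \<theta> \<longrightarrow> 0 \<le> y $ 1 \<and> 0 \<le> y $ 2)"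
      using in_S notin_S u(2) unfolding p_def[symmetric] v_def[symmetric] by simp
  qed
qed

text \<open>Disjoint balls of radius comparable to h = 2^(-j) are strung along the outer curve of
  the k-th turn over angles between \<eta>/2 and \<eta>. There are about k^(-\<alpha>)/h of them,
  each of area of order h^2. The bounds on the norm separate the sets of different turns.\<close>

lemma lower_sets:
  assumes \<alpha>: "0 < \<alpha>" and ad: "admissible_pair \<phi>\<^sub>0 \<phi>"
  obtains c c1 \<delta> k0 where "0 < c" "0 < c1" "0 < \<delta>" "\<delta> \<le> 1" "2 \<le> (k0::nat)"
    "\<And>k j. \<lbrakk>k0 \<le> k; 2 powr - real j \<le> \<delta> * real k powr (- \<alpha> - 1)\<rbrakk> \<Longrightarrow>
      \<exists>A\<in>sets borel. ennreal (c1 * real k powr - \<alpha> * 2 powr - real j) \<le> emeasure lborel A \<and>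
        (\<forall>x\<in>A. c \<le> norm (convolution (resolution \<phi>\<^sub>0 \<phi> j) (regular_distribution (indicator (spiral \<alpha>))) x) \<and>
          0 \<le> x $ 1 \<and> 0 \<le> x $ 2 \<and>
          (2 * pi * real k + 2) powr - \<alpha> < norm x \<and> norm x < (2 * pi * real k - 2) powr - \<alpha>)"
proof -
  note S = spiral_borel[OF \<alpha>]
  note ad' = admissible_pairD[OF ad]
  obtain t \<epsilon> M c where \<epsilon>: "\<epsilon> > 0" and M: "M > 0" and c: "c > 0" and
    low: "\<And>S h x. \<lbrakk>S \<in> sets borel;
       \<And>z. norm z \<le> M \<Longrightarrow> z $ (1::2) > t + \<epsilon> \<Longrightarrow> x - h *\<^sub>R z \<in> S;
       \<And>z. norm z \<le> M \<Longrightarrow> z $ 1 < t - \<epsilon> \<Longrightarrow> x - h *\<^sub>R z \<notin> S\<rbrakk>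
     \<Longrightarrow> norm (kernel_avg \<phi> h S x) \<ge> c"
    using kernel_avg_halfspace_lower[OF schwartz_integrable[OF ad'(2)] ad'(4)] by metis
  \<comment> \<open>The points x - hz to be located differ from the curve point by the offset h|t|,
    the radius of the ball, which is at most h, and at most hM.\<close>
  define M' where "M' = M + \<bar>t\<bar> + 1"
  have M': "1 \<le> M'" using M by (simp add: M'_def)
  have \<epsilon>2: "0 < \<epsilon> / 2" using \<epsilon> by simp
  obtain g0 \<eta> \<phi>1 where g0: "0 < g0" and \<eta>: "0 < \<eta>" "\<eta> \<le> 1 / 4" and
    curve: "\<And>k \<theta> \<phi> h y. \<lbrakk>\<phi> = \<theta> + 2 * pi * of_int k; 0 \<le> \<theta>; \<theta> \<le> \<eta>; \<phi>1 \<le> \<phi>; 0 < h; h * \<phi> powr (\<alpha> + 1) \<le> g0;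
        norm (y - polar_pt \<alpha> \<phi> \<phi>) \<le> h * M'\<rbrakk> \<Longrightarrow>
      ((y - polar_pt \<alpha> \<phi> \<phi>) $ 1 \<le> - h * (\<epsilon> / 2) \<longrightarrow> y \<in> spiral \<alpha>) \<and>
      ((y - polar_pt \<alpha> \<phi> \<phi>) $ 1 \<ge> h * (\<epsilon> / 2) \<longrightarrow> y \<notin> spiral \<alpha>) \<and>
      (\<phi> + 1) powr - \<alpha> \<le> norm y \<and> norm y \<le> (\<phi> - 1) powr - \<alpha> \<and>
      (\<eta> / 2 \<le> \<theta> \<longrightarrow> 0 \<le> y $ 1 \<and> 0 \<le> y $ 2)"
    by (rule curve_looks_vertical[OF \<alpha> \<epsilon>2 M']) blast
  \<comment> \<open>Half of the slack \<epsilon> is spent on x varying in its ball, the other half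
    on the curvature of the boundary.\<close>
  define \<delta>1 where "\<delta>1 = min (\<epsilon> / 2) 1"
  have \<delta>1: "0 < \<delta>1" "\<delta>1 \<le> \<epsilon> / 2" "\<delta>1 \<le> 1" using \<epsilon> by (auto simp: \<delta>1_def)
  define \<delta> where "\<delta> = min 1 (g0 / 8 powr (\<alpha> + 1))"
  have \<delta>: "0 < \<delta>" "\<delta> \<le> 1" "\<delta> * 8 powr (\<alpha> + 1) \<le> g0"
  proof -
    show "0 < \<delta>" "\<delta> \<le> 1" using g0 by (auto simp: \<delta>_def)
    have "\<delta> * 8 powr (\<alpha> + 1) \<le> g0 / 8 powr (\<alpha> + 1) * 8 powr (\<alpha> + 1)"
      by (intro mult_right_mono) (auto simp: \<delta>_def)
    then show "\<delta> * 8 powr (\<alpha> + 1) \<le> g0" by simp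
  qed
  define c1 where "c1 = \<eta> * 8 powr - \<alpha> * \<delta>1 / 4"
  have c1: "0 < c1" using \<eta> \<delta>1 by (simp add: c1_def)
  define k0 where "k0 = max 2 (nat \<lceil>\<phi>1\<rceil>)"
  have k0: "2 \<le> k0" "\<phi>1 \<le> real k0" by (auto simp: k0_def le_max_iff_disj) linarith
  show thesis
  proof (rule that[OF c c1 \<delta>(1,2) k0(1)])
    fix k j :: nat
    assume k: "k0 \<le> k" and j: "2 powr - real j \<le> \<delta> * real k powr (- \<alpha> - 1)"
    define h where "h = 2 powr - real j"
    have h: "0 < h" by (simp add: h_def)
    have h2: "h = 1 / 2 ^ j" by (simp add: h_def powr_minus_divide powr_realpow)
    have k2: "2 \<le> real k" using k k0 by simp
    \<comment> \<open>Level 0 would use \<open>\<phi>\<^sub>0\<close>, whereas the half-space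
      estimate was derived for \<phi>; the scale condition excludes it.\<close>
    have j0: "j \<noteq> 0"
    proof
      assume "j = 0"
      then have "1 \<le> \<delta> * real k powr (- \<alpha> - 1)" using j by simp
      moreover have "\<delta> * real k powr (- \<alpha> - 1) \<le> 1 * real k powr (- \<alpha> - 1)"
        using \<delta> by (intro mult_right_mono) auto
      moreover have "real k powr (- \<alpha> - 1) < real k powr 0"
        using k2 \<alpha> by (intro powr_less_mono) auto
      moreover have "real k powr 0 = 1" using k2 by simp
      ultimately show False by linarith
    qed
    have cv: "convolution (resolution \<phi>\<^sub>0 \<phi> j) (regular_distribution (indicator (spiral \<alpha>))) x = kernel_avg \<phi> h (spiral \<alpha>) x" for x
      using convolution_regular_indicator[OF ad'(1,2) S, of j x] j0 by (simp add: h2)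
    have hk: "h * y powr (\<alpha> + 1) \<le> g0" if y: "0 < y" "y \<le> 8 * real k" for y
    proof -
      have "y powr (\<alpha> + 1) \<le> (8 * real k) powr (\<alpha> + 1)" using y \<alpha> by (intro powr_mono2) auto
      also have "\<dots> = 8 powr (\<alpha> + 1) * real k powr (\<alpha> + 1)" by (rule powr_mult)
      finally have "h * y powr (\<alpha> + 1) \<le> (\<delta> * real k powr (- \<alpha> - 1)) * (8 powr (\<alpha> + 1) * real k powr (\<alpha> + 1))"
        using j h \<delta> by (intro mult_mono) (auto simp: h_def)
      also have "\<dots> = \<delta> * 8 powr (\<alpha> + 1) * (real k powr (- \<alpha> - 1) * real k powr (\<alpha> + 1))" by simp
      also have "real k powr (- \<alpha> - 1) * real k powr (\<alpha> + 1) = 1"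
        using k2 by (simp add: powr_add[symmetric])
      finally show ?thesis using \<delta>(3) by simp
    qed
    define \<rho> where "\<rho> = (8 * real k) powr - \<alpha>"
    have \<rho>: "\<rho> > 0" using k2 by (simp add: \<rho>_def)
    \<comment> \<open>Angular step: at radius at least \<rho>, an angle \<sigma> spans a distance of
      at least \<rho>\<sigma>/2 = 2 \<delta>1 h, twice the radius of the balls.\<close>
    define \<sigma> where "\<sigma> = 4 * \<delta>1 * h / \<rho>"
    have \<sigma>: "\<sigma> > 0" using \<delta>1 h \<rho> by (simp add: \<sigma>_def)
    \<comment> \<open>The indices run from 0 to N, so there are N + 1 \<ge> \<eta>/(2\<sigma>)
      balls, also when the quotient is below 1.\<close>
    define N where "N = nat \<lfloor>\<eta> / (2 * \<sigma>)\<rfloor>"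
    have N: "real N \<le> \<eta> / (2 * \<sigma>)" "\<eta> / (2 * \<sigma>) \<le> real N + 1"
    proof -
      have "0 \<le> \<eta> / (2 * \<sigma>)" using \<eta> \<sigma> by simp
      then show "real N \<le> \<eta> / (2 * \<sigma>)" "\<eta> / (2 * \<sigma>) \<le> real N + 1" unfolding N_def by linarith+
    qed
    define \<theta> where "\<theta> i = \<eta> / 2 + real i * \<sigma>" for i :: nat
    have \<theta>: "\<eta> / 2 \<le> \<theta> i" "\<theta> i \<le> \<eta>" if "i \<le> N" for i
    proof -
      show "\<eta> / 2 \<le> \<theta> i" using \<sigma> by (simp add: \<theta>_def)
      have "real i * \<sigma> \<le> \<eta> / (2 * \<sigma>) * \<sigma>" using that N \<sigma> by (intro mult_right_mono) auto
      then show "\<theta> i \<le> \<eta>" using \<sigma> by (simp add: \<theta>_def)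
    qed
    define \<Phi> where "\<Phi> i = \<theta> i + 2 * pi * real k" for i
    have \<Phi>: "2 * pi * real k \<le> \<Phi> i" "\<Phi> i \<le> 2 * pi * real k + 1 / 4" "\<phi>1 \<le> \<Phi> i" "0 < \<Phi> i" "\<Phi> i \<le> 8 * real k" if "i \<le> N" for i
    proof -
      show 1: "2 * pi * real k \<le> \<Phi> i" "\<Phi> i \<le> 2 * pi * real k + 1 / 4"
        using \<theta>[OF that] \<eta> by (auto simp: \<Phi>_def)
      have "6 * real k \<le> 2 * pi * real k" using two_pi_gt by (intro mult_right_mono) auto
      then show "\<phi>1 \<le> \<Phi> i" "0 < \<Phi> i" using 1 k k0 k2 by linarith+
      have "pi \<le> 31 / 8" using pi_less_4 pi_approx by simp
      then have "2 * pi * real k \<le> 31 / 4 * real k" by (intro mult_right_mono) auto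
      then show "\<Phi> i \<le> 8 * real k" using 1 k2 by linarith
    qed
    define P where "P i = polar_pt \<alpha> (\<Phi> i) (\<Phi> i)" for i
    \<comment> \<open>Shifting by ht along the first axis places the hyperplane z_1 = t of the
      detected half-space on the curve point.\<close>
    define X where "X i = P i + (h * t) *\<^sub>R axis 1 1" for i
    have near: "((y - P i) $ 1 \<le> - h * (\<epsilon> / 2) \<longrightarrow> y \<in> spiral \<alpha>) \<and>
      ((y - P i) $ 1 \<ge> h * (\<epsilon> / 2) \<longrightarrow> y \<notin> spiral \<alpha>) \<and>
      (\<Phi> i + 1) powr - \<alpha> \<le> norm y \<and> norm y \<le> (\<Phi> i - 1) powr - \<alpha> \<and> 0 \<le> y $ 1 \<and> 0 \<le> y $ 2"
      if i: "i \<le> N" and y: "norm (y - P i) \<le> h * M'" for i y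
    proof -
      have "\<Phi> i = \<theta> i + 2 * pi * of_int (int k)" by (simp add: \<Phi>_def)
      moreover have "0 \<le> \<theta> i" using \<theta>[OF i] \<eta> by linarith
      ultimately show ?thesis
        using curve[of "\<Phi> i" "\<theta> i" "int k" h y] \<theta>[OF i] \<Phi>[OF i] h hk[of "\<Phi> i"] y unfolding P_def by blast
    qed
    have pt: "c \<le> norm (kernel_avg \<phi> h (spiral \<alpha>) x) \<and> 0 \<le> x $ 1 \<and> 0 \<le> x $ 2 \<and>
          (2 * pi * real k + 2) powr - \<alpha> < norm x \<and> norm x < (2 * pi * real k - 2) powr - \<alpha>"
      if i: "i \<le> N" and x: "x \<in> ball (X i) (\<delta>1 * h)" for i x
    proof -
      have xX: "norm (x - X i) \<le> \<delta>1 * h" using x by (simp add: dist_norm norm_minus_commute)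
      have ht: "norm ((h * t) *\<^sub>R (axis 1 1 :: real^2)) = h * \<bar>t\<bar>" using h by (simp add: abs_mult)
      have dec: "x - h *\<^sub>R z - P i = (x - X i) + (h * t) *\<^sub>R axis 1 1 - h *\<^sub>R z" for z
        by (simp add: X_def)
      have nz: "norm (x - h *\<^sub>R z - P i) \<le> h * M'" if "norm z \<le> M" for z
      proof -
        have "norm (x - h *\<^sub>R z - P i) \<le> norm (x - X i) + norm ((h * t) *\<^sub>R (axis 1 1 :: real^2)) + norm (h *\<^sub>R z)"
          unfolding dec by (intro order_trans[OF norm_triangle_ineq4] add_right_mono norm_triangle_ineq)
        also have "\<dots> \<le> \<delta>1 * h + h * \<bar>t\<bar> + h * M"
          using xX ht h that by (intro add_mono) auto
        also have "\<dots> \<le> h * M'"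
          using mult_right_mono[OF \<delta>1(3), of h] h by (simp add: M'_def algebra_simps)
        finally show ?thesis .
      qed
      have x1: "\<bar>(x - X i) $ 1\<bar> \<le> \<delta>1 * h" using xX component_le_norm_cart[of "x - X i" 1] by linarith
      have d1: "\<delta>1 * h \<le> \<epsilon> / 2 * h" using \<delta>1 h by (intro mult_right_mono) auto
      have comp: "(x - h *\<^sub>R z - P i) $ 1 = (x - X i) $ 1 + h * (t - z $ 1)" for z
        unfolding dec by (simp add: axis_def algebra_simps)
      have "norm (x - P i) \<le> h * M'" using nz[of 0] M by simp
      from near[OF i this] have nx: "(\<Phi> i + 1) powr - \<alpha> \<le> norm x" "norm x \<le> (\<Phi> i - 1) powr - \<alpha>" "0 \<le> x $ 1" "0 \<le> x $ 2"
        by auto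
      have k6: "2 * pi * real k - 2 > 0"
      proof -
        have "6 * real k \<le> 2 * pi * real k" using two_pi_gt by (intro mult_right_mono) auto
        then show ?thesis using k2 by linarith
      qed
      have "(2 * pi * real k + 2) powr - \<alpha> < (\<Phi> i + 1) powr - \<alpha>"
        using \<Phi>[OF i] \<alpha> by (intro powr_less_mono2_neg) auto
      moreover have "(\<Phi> i - 1) powr - \<alpha> < (2 * pi * real k - 2) powr - \<alpha>"
        using \<Phi>[OF i] \<alpha> k6 by (intro powr_less_mono2_neg) auto
      moreover have "c \<le> norm (kernel_avg \<phi> h (spiral \<alpha>) x)"
      proof (rule low[OF S])
        fix z :: "real^2" assume z: "norm z \<le> M" "z $ 1 > t + \<epsilon>"
        have "h * (t - z $ 1) \<le> h * (- \<epsilon>)" using z h by (intro mult_left_mono) auto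
        then have "(x - h *\<^sub>R z - P i) $ 1 \<le> - h * (\<epsilon> / 2)"
          unfolding comp using x1 d1 by (simp add: algebra_simps abs_le_iff)
        then show "x - h *\<^sub>R z \<in> spiral \<alpha>" using near[OF i nz[OF z(1)]] by blast
      next
        fix z :: "real^2" assume z: "norm z \<le> M" "z $ 1 < t - \<epsilon>"
        have "h * \<epsilon> \<le> h * (t - z $ 1)" using z h by (intro mult_left_mono) auto
        then have "h * (\<epsilon> / 2) \<le> (x - h *\<^sub>R z - P i) $ 1"
          unfolding comp using x1 d1 by (simp add: algebra_simps abs_le_iff)
        then show "x - h *\<^sub>R z \<notin> spiral \<alpha>" using near[OF i nz[OF z(1)]] by blast
      qed
      ultimately show ?thesis using nx by linarith
    qed
    have sep: "2 * (\<delta>1 * h) \<le> dist (X i) (X l)" if il: "i \<le> N" "l \<le> N" "i \<noteq> l" for i l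
    proof -
      have "1 \<le> \<bar>real i - real l\<bar>" using il(3) by linarith
      then have "1 * \<sigma> \<le> \<bar>real i - real l\<bar> * \<sigma>" using \<sigma> by (intro mult_right_mono) auto
      also have "\<dots> = \<bar>\<theta> i - \<theta> l\<bar>" using \<sigma> by (simp add: \<theta>_def left_diff_distrib[symmetric] abs_mult)
      finally have d\<theta>: "\<sigma> \<le> \<bar>\<theta> i - \<theta> l\<bar>" by simp
      have d4: "\<bar>\<theta> i - \<theta> l\<bar> \<le> 1 / 4" using \<theta>[OF il(1)] \<theta>[OF il(2)] \<eta> by linarith
      have "cos (pi / 3) \<le> cos \<bar>\<theta> i - \<theta> l\<bar>" using d4 two_pi_gt by (intro cos_monotone_0_pi_le) auto
      then have "\<bar>\<theta> i - \<theta> l\<bar> / 2 \<le> \<bar>sin (\<theta> i - \<theta> l)\<bar>"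
        using d4 two_pi_gt by (intro abs_sin_ge_half) (auto simp: cos_60)
      then have sn: "\<sigma> / 2 \<le> \<bar>sin (\<Phi> i - \<Phi> l)\<bar>" using d\<theta> by (simp add: \<Phi>_def)
      have "\<rho> \<le> \<Phi> l powr - \<alpha>" unfolding \<rho>_def using \<Phi>[OF il(2)] \<alpha> by (intro powr_mono2') auto
      then have "\<rho> * (\<sigma> / 2) \<le> \<bar>\<Phi> l powr - \<alpha>\<bar> * \<bar>sin (\<Phi> i - \<Phi> l)\<bar>"
        using sn \<rho> \<sigma> by (intro mult_mono) auto
      also have "\<dots> \<le> norm (P i - P l)"
        unfolding P_def polar_pt_def by (rule norm_polar_diff_ge_sin)
      also have "norm (P i - P l) = dist (X i) (X l)" by (simp add: X_def dist_norm)
      finally show ?thesis using \<rho> by (simp add: \<sigma>_def)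
    qed
    define A where "A = (\<Union>i\<le>N. ball (X i) (\<delta>1 * h))"
    have "disjoint_family_on (\<lambda>i. ball (X i) (\<delta>1 * h)) {..N}"
      unfolding disjoint_family_on_def
    proof (intro ballI impI)
      fix i l assume il: "i \<in> {..N}" "l \<in> {..N}" "i \<noteq> l"
      show "ball (X i) (\<delta>1 * h) \<inter> ball (X l) (\<delta>1 * h) = {}"
      proof (rule ccontr)
        assume "\<not> ?thesis"
        then obtain x where x: "dist (X i) x < \<delta>1 * h" "dist (X l) x < \<delta>1 * h" by auto
        then show False using sep[of i l] il dist_triangle2[of "X i" "X l" x] by simp
      qed
    qed
    then have "emeasure lborel A = (\<Sum>i\<le>N. emeasure lborel (ball (X i) (\<delta>1 * h)))"
      unfolding A_def by (intro sum_emeasure[symmetric]) auto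
    also have "\<dots> = (\<Sum>i\<le>N. ennreal (pi * (\<delta>1 * h)\<^sup>2))"
      using \<delta>1 h by (intro sum.cong refl) (simp add: emeasure_ball unit_ball_vol_2)
    also have "\<dots> = ennreal ((real N + 1) * (pi * (\<delta>1 * h)\<^sup>2))"
    proof -
      have "(\<Sum>i\<le>N. ennreal (pi * (\<delta>1 * h)\<^sup>2)) = ennreal (\<Sum>i\<le>N. pi * (\<delta>1 * h)\<^sup>2)"
        by (intro sum_ennreal) auto
      then show ?thesis by (simp add: add.commute)
    qed
    finally have emA: "emeasure lborel A = ennreal ((real N + 1) * (pi * (\<delta>1 * h)\<^sup>2))" .
    have "c1 * real k powr - \<alpha> * h \<le> (real N + 1) * (pi * (\<delta>1 * h)\<^sup>2)"
    proof -
      have "\<rho> = 8 powr - \<alpha> * real k powr - \<alpha>" unfolding \<rho>_def by (rule powr_mult)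
      then have "c1 * real k powr - \<alpha> * h = \<eta> / (2 * \<sigma>) * (2 * (\<delta>1 * h)\<^sup>2)"
        using \<delta>1 h \<rho> by (simp add: c1_def \<sigma>_def power2_eq_square field_simps)
      also have "\<dots> \<le> (real N + 1) * (pi * (\<delta>1 * h)\<^sup>2)"
        using N(2) two_pi_gt \<eta> \<sigma> by (intro mult_mono mult_right_mono) auto
      finally show ?thesis .
    qed
    then have "ennreal (c1 * real k powr - \<alpha> * 2 powr - real j) \<le> emeasure lborel A"
      unfolding emA h_def by (rule ennreal_leI)
    moreover have "A \<in> sets borel" unfolding A_def by (intro borel_open open_UN) auto
    ultimately show "\<exists>A\<in>sets borel. ennreal (c1 * real k powr - \<alpha> * 2 powr - real j) \<le> emeasure lborel A \<and>
        (\<forall>x\<in>A. c \<le> norm (convolution (resolution \<phi>\<^sub>0 \<phi> j) (regular_distribution (indicator (spiral \<alpha>))) x) \<and>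
          0 \<le> x $ 1 \<and> 0 \<le> x $ 2 \<and>
          (2 * pi * real k + 2) powr - \<alpha> < norm x \<and> norm x < (2 * pi * real k - 2) powr - \<alpha>)"
      unfolding cv using pt by (intro bexI[of _ A] conjI ballI) (auto simp: A_def)
  qed
qed

section \<open>Summation over levels at one coil and over coils at their own scale\<close>

lemma density_lower:
  assumes q: "1 \<le> q" and p: "0 < p" and c: "0 \<le> c" "c \<le> a j" and j: "max m 0 \<le> int j"
  shows "ennreal (2 powr (real j * (s * p)) * c powr p) \<le> TL_density q p s m a"
proof -
  have "2 powr (real j * (s * p)) * c powr p = (2 powr (real j * s) * c) powr p"
    by (simp add: powr_mult powr_powr mult.assoc)
  also have "\<dots> \<le> (2 powr (real j * s) * a j) powr p"
    using c p by (intro powr_mono2 mult_left_mono) auto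
  finally have "ennreal (2 powr (real j * (s * p)) * c powr p) \<le> ennreal ((2 powr (real j * s) * a j) powr p)"
    by (rule ennreal_leI)
  also have "\<dots> \<le> TL_density q p s m a"
    using c by (intro TL_density_ge[OF q p _ j]) auto
  finally show ?thesis .
qed

lemma mem_dyadic_cube_origin:
  assumes "0 \<le> x $ 1" "0 \<le> x $ 2" "norm x < 2 powr - real_of_int m"
  shows "x \<in> dyadic_cube m (0 :: int^2)"
proof -
  have "x $ i < 2 powr - real_of_int m" for i
    using component_le_norm_cart[of x i] assms(3) by linarith
  then show ?thesis
    using assms unfolding dyadic_cube_eq by (auto simp: forall_2)
qed

lemma k_lt_two_pi_k: "2 \<le> k \<Longrightarrow> real k < 2 * pi * real k - 2"
proof -
  assume "2 \<le> k"
  then have "2 \<le> real k" by simp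
  moreover have "6 * real k \<le> 2 * pi * real k" using two_pi_gt by (intro mult_right_mono) auto
  ultimately show ?thesis by linarith
qed

text \<open>At one fixed turn, level j carries p-th power density of order 2^j on a set of measure
  of order 2^(-j), so infinitely many levels contribute equally within the unit cube, whose volume
  is 1 for every \<tau>. The sets of different levels may overlap and only one level per point may
  be counted, which covers q = \<infinity>; the weights 2^j are geometric, so the largest level at a
  point dominates their sum.\<close>

lemma spiral_not_TL_critical:
  assumes \<alpha>: "0 < \<alpha>" and ad: "admissible_pair \<phi>\<^sub>0 \<phi>" and p: "1 \<le> p" and q: "1 \<le> q"
  shows "regular_distribution (indicator (spiral \<alpha>)) \<notin> TL_space \<phi>\<^sub>0 \<phi> (1 / p) \<tau> p q"
proof
  let ?T = "regular_distribution (indicator (spiral \<alpha>))"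
  let ?F = "\<lambda>x. TL_density q p (1 / p) 0 (\<lambda>j. norm (convolution (resolution \<phi>\<^sub>0 \<phi> j) ?T x))"
  let ?P = "dyadic_cube 0 (0 :: int^2)"
  assume "?T \<in> TL_space \<phi>\<^sub>0 \<phi> (1 / p) \<tau> p q"
  then have "TL_norm \<phi>\<^sub>0 \<phi> (1 / p) \<tau> p q ?T < \<infinity>" by (simp add: TL_space_def)
  moreover have p0: "0 < p" using p by simp
  ultimately obtain B where B: "B \<ge> 0" and
    B': "\<And>m k. (\<integral>\<^sup>+x\<in>dyadic_cube m k. TL_density q p (1 / p) m (\<lambda>j. norm (convolution (resolution \<phi>\<^sub>0 \<phi> j) ?T x)) \<partial>lborel)
      \<le> ennreal (B * 2 powr (- real_of_int m * real CARD(2) * \<tau> * p))"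
    unfolding TL_norm_finite_iff[OF p0] by blast
  have BP: "(\<integral>\<^sup>+x\<in>?P. ?F x \<partial>lborel) \<le> ennreal B" using B'[of 0 0] by simp
  obtain c c1 \<delta> k0 where c: "0 < c" "0 < c1" "0 < \<delta>" "\<delta> \<le> 1" "2 \<le> (k0::nat)" and
    low: "\<And>k j. \<lbrakk>k0 \<le> k; 2 powr - real j \<le> \<delta> * real k powr (- \<alpha> - 1)\<rbrakk> \<Longrightarrow>
      \<exists>A\<in>sets borel. ennreal (c1 * real k powr - \<alpha> * 2 powr - real j) \<le> emeasure lborel A \<and>
        (\<forall>x\<in>A. c \<le> norm (convolution (resolution \<phi>\<^sub>0 \<phi> j) ?T x) \<and>
          0 \<le> x $ 1 \<and> 0 \<le> x $ 2 \<and>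
          (2 * pi * real k + 2) powr - \<alpha> < norm x \<and> norm x < (2 * pi * real k - 2) powr - \<alpha>)"
    by (rule lower_sets[OF \<alpha> ad]) blast
  have k0: "0 < real k0" "1 \<le> real k0" using c by auto
  have "0 < \<delta> * real k0 powr (- \<alpha> - 1)" using c k0 by simp
  then obtain J where "(1 / 2) ^ J < \<delta> * real k0 powr (- \<alpha> - 1)"
    using real_arch_pow_inv[of "\<delta> * real k0 powr (- \<alpha> - 1)" "1 / 2"] by auto
  then have J: "2 powr - real J < \<delta> * real k0 powr (- \<alpha> - 1)"
    by (simp add: powr_minus_divide powr_realpow power_one_over)
  define w where "w = c1 * real k0 powr - \<alpha>"
  have w: "w > 0" using c k0 by (simp add: w_def)
  have "\<forall>j. \<exists>A\<in>sets borel. ennreal (w * 2 powr - real (J + j)) \<le> emeasure lborel A \<and>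
        (\<forall>x\<in>A. c \<le> norm (convolution (resolution \<phi>\<^sub>0 \<phi> (J + j)) ?T x) \<and> x \<in> ?P)"
  proof
    fix j
    have "2 powr - real (J + j) \<le> 2 powr - real J" by simp
    then have "2 powr - real (J + j) \<le> \<delta> * real k0 powr (- \<alpha> - 1)" using J by linarith
    from low[OF order_refl this] obtain A where A: "A \<in> sets borel"
      "ennreal (w * 2 powr - real (J + j)) \<le> emeasure lborel A"
      "\<And>x. x \<in> A \<Longrightarrow> c \<le> norm (convolution (resolution \<phi>\<^sub>0 \<phi> (J + j)) ?T x) \<and>
          0 \<le> x $ 1 \<and> 0 \<le> x $ 2 \<and> norm x < (2 * pi * real k0 - 2) powr - \<alpha>"
      unfolding w_def by blast
    have "(2 * pi * real k0 - 2) powr - \<alpha> \<le> 1 powr - \<alpha>"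
      using k_lt_two_pi_k[OF c(5)] k0 \<alpha> by (intro powr_mono2') auto
    then have "x \<in> ?P" if "x \<in> A" for x
      using A(3)[OF that] by (intro mem_dyadic_cube_origin) auto
    then show "\<exists>A\<in>sets borel. ennreal (w * 2 powr - real (J + j)) \<le> emeasure lborel A \<and>
        (\<forall>x\<in>A. c \<le> norm (convolution (resolution \<phi>\<^sub>0 \<phi> (J + j)) ?T x) \<and> x \<in> ?P)"
      using A by blast
  qed
  then obtain A where A: "\<And>j. A j \<in> sets borel" "\<And>j. ennreal (w * 2 powr - real (J + j)) \<le> emeasure lborel (A j)"
    "\<And>j x. x \<in> A j \<Longrightarrow> c \<le> norm (convolution (resolution \<phi>\<^sub>0 \<phi> (J + j)) ?T x) \<and> x \<in> ?P"
    by metis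
  \<comment> \<open>The factor 1/2 compensates for the sum of 2^j over j \<le> m, which is at most 2
    * 2^m.\<close>
  define e where "e = c powr p / 2"
  have e: "e > 0" using c by (simp add: e_def)
  define f where "f j = e * 2 powr real (J + j)" for j :: nat
  have f0: "0 \<le> f j" for j using e by (simp add: f_def)
  have pw: "(\<Sum>j<n. ennreal (f j) * indicator (A j) x) \<le> ?F x * indicator ?P x" for n x
  proof (cases "\<exists>j<n. x \<in> A j")
    case False
    then have "(\<Sum>j<n. ennreal (f j) * indicator (A j) x) = 0" by (intro sum.neutral) auto
    then show ?thesis by simp
  next
    case True
    define I where "I = {j. j < n \<and> x \<in> A j}"
    have I: "finite I" "I \<noteq> {}" using True by (auto simp: I_def)
    define m where "m = Max I"
    have m: "m \<in> I" "\<And>j. j \<in> I \<Longrightarrow> j \<le> m" using Max_in[OF I] Max_ge[OF I(1)] by (auto simp: m_def)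
    have "(\<Sum>j<n. ennreal (f j) * indicator (A j) x) = (\<Sum>j\<in>I. ennreal (f j))"
      by (rule sum.mono_neutral_cong_right) (auto simp: I_def indicator_def)
    also have "\<dots> \<le> (\<Sum>j\<le>m. ennreal (f j))" using m by (intro sum_mono2) auto
    also have "\<dots> = ennreal (\<Sum>j\<le>m. f j)" using f0 by (intro sum_ennreal) auto
    also have "\<dots> \<le> ennreal (2 powr (real (J + m) * (1 / p * p)) * c powr p)"
    proof (intro ennreal_leI)
      have "(\<Sum>j\<le>m. f j) = e * 2 ^ J * (\<Sum>j\<le>m. 2 ^ j)"
        by (simp add: f_def sum_distrib_left powr_realpow[symmetric] powr_add mult.assoc)
      also have "(\<Sum>j\<le>m. (2::real) ^ j) \<le> 2 * 2 ^ m"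
        by (induction m) auto
      then have "e * 2 ^ J * (\<Sum>j\<le>m. 2 ^ j) \<le> e * 2 ^ J * (2 * 2 ^ m)"
        using e by (intro mult_left_mono) auto
      also have "\<dots> = 2 powr (real (J + m) * (1 / p * p)) * c powr p"
        using p by (simp add: e_def powr_add powr_realpow)
      finally show "(\<Sum>j\<le>m. f j) \<le> 2 powr (real (J + m) * (1 / p * p)) * c powr p" .
    qed
    also have "\<dots> \<le> ?F x"
      using c A(3)[of x m] m(1) by (intro density_lower[OF q p0]) (auto simp: I_def)
    also have "?F x = ?F x * indicator ?P x" using A(3)[of x m] m(1) by (simp add: I_def)
    finally show ?thesis .
  qed
  have bound: "real n * (e * w) \<le> B" for n
  proof -
    have "ennreal (real n * (e * w)) = (\<Sum>j<n. ennreal (e * w))"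
      using e w by (simp add: ennreal_mult ennreal_of_nat_eq_real_of_nat)
    also have "\<dots> \<le> (\<Sum>j<n. ennreal (f j) * emeasure lborel (A j))"
    proof (intro sum_mono)
      fix j
      have "e * w = f j * (w * 2 powr - real (J + j))"
      proof -
        have "2 powr real (J + j) * 2 powr - real (J + j) = 1" by (simp only: powr_add[symmetric]) simp
        moreover have "f j * (w * 2 powr - real (J + j)) = e * w * (2 powr real (J + j) * 2 powr - real (J + j))"
          unfolding f_def by (simp only: mult_ac)
        ultimately show ?thesis by (simp only: mult_1_right)
      qed
      then have "ennreal (e * w) = ennreal (f j) * ennreal (w * 2 powr - real (J + j))"
        using f0 w by (simp add: ennreal_mult mult_ac)
      also have "\<dots> \<le> ennreal (f j) * emeasure lborel (A j)" using A(2) by (intro mult_left_mono) auto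
      finally show "ennreal (e * w) \<le> ennreal (f j) * emeasure lborel (A j)" .
    qed
    also have "\<dots> = (\<Sum>j<n. \<integral>\<^sup>+x. ennreal (f j) * indicator (A j) x \<partial>lborel)"
      using A(1) by (intro sum.cong refl nn_integral_cmult_indicator[symmetric]) simp
    also have "\<dots> = (\<integral>\<^sup>+x. (\<Sum>j<n. ennreal (f j) * indicator (A j) x) \<partial>lborel)"
      using A(1) by (intro nn_integral_sum[symmetric] borel_measurable_times_ennreal borel_measurable_const borel_measurable_indicator) simp
    also have "\<dots> \<le> (\<integral>\<^sup>+x\<in>?P. ?F x \<partial>lborel)" by (intro nn_integral_mono pw)
    also have "\<dots> \<le> ennreal B" by (rule BP)
    finally show ?thesis using B by (simp add: ennreal_le_iff)
  qed
  obtain n :: nat where "B / (e * w) < real n" using reals_Archimedean2 by blast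
  then have "B < real n * (e * w)" using e w by (simp add: pos_divide_less_eq)
  then show False using bound[of n] by linarith
qed

text \<open>At turn k the level with 2^(-j) comparable to the width k^(-\<alpha>-1) is used: measure
  k^(-\<alpha>) 2^(-j) times 2^(jsp) is the summand. All turns from K on lie in a cube at the origin
  of side comparable to K^(-\<alpha>), and the right-hand side is the amount that the norm allows
  for it.\<close>

lemma spiral_TL_sum_bound:
  assumes \<alpha>: "0 < \<alpha>" and ad: "admissible_pair \<phi>\<^sub>0 \<phi>" and p: "1 \<le> p" and q: "1 \<le> q" and s: "0 < s" and \<tau>: "0 \<le> \<tau>"
    and TL: "regular_distribution (indicator (spiral \<alpha>)) \<in> TL_space \<phi>\<^sub>0 \<phi> s \<tau> p q"
  obtains C k1 where "0 < C" "1 \<le> (k1::nat)"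
    "\<And>K L. k1 \<le> K \<Longrightarrow> (\<Sum>k=K..L. real k powr ((\<alpha> + 1) * (s * p) - 2 * \<alpha> - 1)) \<le> C * real K powr (- (2 * \<alpha> * \<tau> * p))"
proof -
  let ?T = "regular_distribution (indicator (spiral \<alpha>))"
  let ?F = "\<lambda>m x. TL_density q p s m (\<lambda>j. norm (convolution (resolution \<phi>\<^sub>0 \<phi> j) ?T x))"
  define \<gamma> where "\<gamma> = s * p"
  have \<gamma>: "0 < \<gamma>" using s p by (simp add: \<gamma>_def)
  have "TL_norm \<phi>\<^sub>0 \<phi> s \<tau> p q ?T < \<infinity>" using TL by (simp add: TL_space_def)
  moreover have p0: "0 < p" using p by simp
  ultimately obtain B where B: "B \<ge> 0" and
    B': "\<And>m k. (\<integral>\<^sup>+x\<in>dyadic_cube m k. ?F m x \<partial>lborel)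
      \<le> ennreal (B * 2 powr (- real_of_int m * real CARD(2) * \<tau> * p))"
    unfolding TL_norm_finite_iff[OF p0] by blast
  obtain c c1 \<delta> k0 where c: "0 < c" "0 < c1" "0 < \<delta>" "\<delta> \<le> 1" "2 \<le> (k0::nat)" and
    low: "\<And>k j. \<lbrakk>k0 \<le> k; 2 powr - real j \<le> \<delta> * real k powr (- \<alpha> - 1)\<rbrakk> \<Longrightarrow>
      \<exists>A\<in>sets borel. ennreal (c1 * real k powr - \<alpha> * 2 powr - real j) \<le> emeasure lborel A \<and>
        (\<forall>x\<in>A. c \<le> norm (convolution (resolution \<phi>\<^sub>0 \<phi> j) ?T x) \<and>
          0 \<le> x $ 1 \<and> 0 \<le> x $ 2 \<and>
          (2 * pi * real k + 2) powr - \<alpha> < norm x \<and> norm x < (2 * pi * real k - 2) powr - \<alpha>)"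
    by (rule lower_sets[OF \<alpha> ad]) blast
  define w where "w = c powr p * c1 * \<delta> / 2"
  have w: "w > 0" using c by (simp add: w_def)
  define \<beta> where "\<beta> = (\<alpha> + 1) * \<gamma> - 2 * \<alpha>"
  have "\<forall>k. \<exists>j A. k0 \<le> k \<longrightarrow> (A \<in> sets borel \<and> 2 powr - real j \<le> real k powr (- \<alpha> - 1) \<and>
      ennreal (w * real k powr (\<beta> - 1)) \<le> ennreal (2 powr (real j * \<gamma>) * c powr p) * emeasure lborel A \<and>
      (\<forall>x\<in>A. c \<le> norm (convolution (resolution \<phi>\<^sub>0 \<phi> j) ?T x) \<and>
          0 \<le> x $ 1 \<and> 0 \<le> x $ 2 \<and>
          (2 * pi * real k + 2) powr - \<alpha> < norm x \<and> norm x < (2 * pi * real k - 2) powr - \<alpha>))"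
  proof
    fix k
    show "\<exists>j A. k0 \<le> k \<longrightarrow> (A \<in> sets borel \<and> 2 powr - real j \<le> real k powr (- \<alpha> - 1) \<and>
      ennreal (w * real k powr (\<beta> - 1)) \<le> ennreal (2 powr (real j * \<gamma>) * c powr p) * emeasure lborel A \<and>
      (\<forall>x\<in>A. c \<le> norm (convolution (resolution \<phi>\<^sub>0 \<phi> j) ?T x) \<and>
          0 \<le> x $ 1 \<and> 0 \<le> x $ 2 \<and>
          (2 * pi * real k + 2) powr - \<alpha> < norm x \<and> norm x < (2 * pi * real k - 2) powr - \<alpha>))"
    proof (cases "k0 \<le> k")
      case True
      have k2: "2 \<le> real k" using True c by simp
      define v where "v = real k powr (- \<alpha> - 1)"
      have v: "0 < v" "v < 1"
      proof -
        show "0 < v" using k2 by (simp add: v_def)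
        have "real k powr (- \<alpha> - 1) < real k powr 0" using k2 \<alpha> by (intro powr_less_mono) auto
        moreover have "real k powr 0 = 1" using k2 by simp
        ultimately show "v < 1" unfolding v_def by linarith
      qed
      have dv: "\<delta> * v \<le> v" using c v by (simp add: mult_le_cancel_right1)
      have d: "0 < \<delta> * v" "\<delta> * v < 1" using c v dv by (simp, linarith)
      obtain J where J: "\<delta> * v < 2 powr - real J" "2 powr - real J \<le> 2 * (\<delta> * v)"
        using dyadic_scale[OF d] by blast
      define j where "j = Suc J"
      have pj: "2 powr - real j = 2 powr - real J / 2"
        by (simp add: j_def powr_diff powr_minus_divide)
      have j: "2 powr - real j \<le> \<delta> * v" "\<delta> * v / 2 \<le> 2 powr - real j" using J by (auto simp: pj)
      obtain A where A: "A \<in> sets borel" "ennreal (c1 * real k powr - \<alpha> * 2 powr - real j) \<le> emeasure lborel A"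
        "\<forall>x\<in>A. c \<le> norm (convolution (resolution \<phi>\<^sub>0 \<phi> j) ?T x) \<and>
          0 \<le> x $ 1 \<and> 0 \<le> x $ 2 \<and>
          (2 * pi * real k + 2) powr - \<alpha> < norm x \<and> norm x < (2 * pi * real k - 2) powr - \<alpha>"
        using low[OF True, of j] j(1) unfolding v_def by blast
      have jv: "2 powr - real j \<le> v" using j dv by linarith
      have "w * real k powr (\<beta> - 1) \<le> (2 powr (real j * \<gamma>) * c powr p) * (c1 * real k powr - \<alpha> * 2 powr - real j)"
      proof -
        have "1 / v \<le> 2 powr real j"
          using jv v by (simp add: powr_minus_divide pos_divide_le_eq mult.commute)
        then have "(1 / v) powr \<gamma> \<le> (2 powr real j) powr \<gamma>" using \<gamma> v by (intro powr_mono2) auto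
        moreover have "(1 / v) powr \<gamma> = real k powr ((\<alpha> + 1) * \<gamma>)"
        proof -
          have "1 / v = real k powr (\<alpha> + 1)" by (simp add: v_def powr_minus_divide[symmetric] add.commute)
          then show ?thesis by (simp only: powr_powr)
        qed
        ultimately have a: "real k powr ((\<alpha> + 1) * \<gamma>) \<le> 2 powr (real j * \<gamma>)" by (simp add: powr_powr)
        have "real k powr (\<beta> - 1) = real k powr ((\<alpha> + 1) * \<gamma>) * (real k powr - \<alpha> * v)"
          unfolding v_def powr_add[symmetric] by (simp add: \<beta>_def algebra_simps)
        then have "w * real k powr (\<beta> - 1) = (real k powr ((\<alpha> + 1) * \<gamma>) * c powr p) * (c1 * real k powr - \<alpha> * (\<delta> * v / 2))"
          by (simp add: w_def)
        also have "\<dots> \<le> (2 powr (real j * \<gamma>) * c powr p) * (c1 * real k powr - \<alpha> * 2 powr - real j)"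
          using a j c v by (intro mult_mono mult_right_mono mult_left_mono) auto
        finally show ?thesis .
      qed
      then have "ennreal (w * real k powr (\<beta> - 1))
          \<le> ennreal ((2 powr (real j * \<gamma>) * c powr p) * (c1 * real k powr - \<alpha> * 2 powr - real j))"
        by (rule ennreal_leI)
      also have "\<dots> = ennreal (2 powr (real j * \<gamma>) * c powr p) * ennreal (c1 * real k powr - \<alpha> * 2 powr - real j)"
        using c by (intro ennreal_mult) auto
      also have "\<dots> \<le> ennreal (2 powr (real j * \<gamma>) * c powr p) * emeasure lborel A"
        using A(2) by (intro mult_left_mono) auto
      finally show ?thesis using A jv unfolding v_def by blast
    qed blast
  qed
  then obtain j A where
    A: "\<And>k. k0 \<le> k \<Longrightarrow> A k \<in> sets borel" and jk: "\<And>k. k0 \<le> k \<Longrightarrow> 2 powr - real (j k) \<le> real k powr (- \<alpha> - 1)" and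
    em: "\<And>k. k0 \<le> k \<Longrightarrow> ennreal (w * real k powr (\<beta> - 1)) \<le> ennreal (2 powr (real (j k) * \<gamma>) * c powr p) * emeasure lborel (A k)" and
    Ax: "\<And>k x. k0 \<le> k \<Longrightarrow> x \<in> A k \<Longrightarrow> c \<le> norm (convolution (resolution \<phi>\<^sub>0 \<phi> (j k)) ?T x) \<and>
          0 \<le> x $ 1 \<and> 0 \<le> x $ 2 \<and>
          (2 * pi * real k + 2) powr - \<alpha> < norm x \<and> norm x < (2 * pi * real k - 2) powr - \<alpha>"
    by metis
  \<comment> \<open>The windows for the norm at turns k < l are disjoint because 2\<pi> > 4. Each
    point thus belongs to at most one set, and no overlap has to be paid for.\<close>
  have disj: "k = l" if k: "k0 \<le> k" "x \<in> A k" and l: "k0 \<le> l" "x \<in> A l" for k l x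
  proof -
    have no: False if kl: "k < l" and k: "k0 \<le> k" "x \<in> A k" and l: "k0 \<le> l" "x \<in> A l" for k l
    proof -
      have "2 * pi * (real k + 1) \<le> 2 * pi * real l" using kl by (intro mult_left_mono) auto
      then have "2 * pi * real k + 2 \<le> 2 * pi * real l - 2" using two_pi_gt by (simp add: distrib_left) 
      moreover have "0 < 2 * pi * real k + 2" by (intro add_nonneg_pos) auto
      ultimately have "(2 * pi * real l - 2) powr - \<alpha> \<le> (2 * pi * real k + 2) powr - \<alpha>"
        using \<alpha> by (intro powr_mono2') auto
      then show False using Ax[OF k] Ax[OF l] by linarith
    qed
    show ?thesis using no[of k l] no[of l k] k l by (meson linorder_neqE_nat)
  qed
  \<comment> \<open>The density on a cube of side 2^(-J) counts only levels from J on. For K \<ge>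
    8^\<alpha> the width K^(-\<alpha>-1) is at most (8K)^(-\<alpha>), which is below that side, so
    the chosen levels are counted.\<close>
  define k1 where "k1 = max k0 (nat \<lceil>8 powr \<alpha>\<rceil>)"
  have k1: "k0 \<le> k1" "8 powr \<alpha> \<le> real k1" "1 \<le> k1" using c(5) by (auto simp: k1_def le_max_iff_disj) linarith
  define C where "C = (B + 1) * 2 powr (2 * \<tau> * p) / w"
  have C: "C > 0" using B w by (simp add: C_def)
  show thesis
  proof (rule that[OF C k1(3)])
    fix K L :: nat
    assume K: "k1 \<le> K"
    have K0: "k0 \<le> K" "2 \<le> K" using K k1 c by auto
    define d where "d = (2 * pi * real K - 2) powr - \<alpha>"
    have K1: "real K < 2 * pi * real K - 2" by (rule k_lt_two_pi_k[OF K0(2)])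
    have Kp: "1 < real K" using K0 by simp
    have d: "0 < d" "d < 1" "d \<le> real K powr - \<alpha>"
    proof -
      show "0 < d" using K1 Kp by (simp add: d_def)
      show le: "d \<le> real K powr - \<alpha>" unfolding d_def using K1 Kp \<alpha> by (intro powr_mono2') auto
      have "real K powr - \<alpha> < real K powr 0" using Kp \<alpha> by (intro powr_less_mono) auto
      moreover have "real K powr 0 = 1" using Kp by simp
      ultimately show "d < 1" using le by linarith
    qed
    obtain J where J: "d < 2 powr - real J" "2 powr - real J \<le> 2 * d"
      using dyadic_scale[OF d(1,2)] by blast
    let ?P = "dyadic_cube (int J) (0 :: int^2)"
    have inP: "x \<in> ?P" if "K \<le> k" "x \<in> A k" for k x
    proof -
      have k: "k0 \<le> k" using that K0 by simp
      have "2 * pi * real K \<le> 2 * pi * real k" using that by (intro mult_left_mono) auto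
      then have "(2 * pi * real k - 2) powr - \<alpha> \<le> d"
        unfolding d_def using K1 Kp \<alpha> by (intro powr_mono2') auto
      then have "norm x < 2 powr - real J" using Ax[OF k that(2)] J by linarith
      then show ?thesis using Ax[OF k that(2)] by (intro mem_dyadic_cube_origin) auto
    qed
    have jJ: "J \<le> j k" if "K \<le> k" for k
    proof -
      have "2 powr - real (j k) \<le> real k powr (- \<alpha> - 1)" using that K0 by (intro jk) simp
      also have "\<dots> \<le> real K powr (- \<alpha> - 1)" using that Kp \<alpha> by (intro powr_mono2') auto
      also have "\<dots> = real K powr - \<alpha> / real K" using Kp by (simp add: powr_diff)
      also have "\<dots> \<le> real K powr - \<alpha> / 8 powr \<alpha>"
        using K k1(2) Kp by (intro divide_left_mono) auto
      also have "\<dots> = (8 * real K) powr - \<alpha>" by (simp add: powr_mult powr_minus_divide)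
      also have "\<dots> \<le> d"
      proof -
        have "2 * pi * real K \<le> 8 * real K" using two_pi_gt by (intro mult_right_mono) auto
        then have "2 * pi * real K - 2 \<le> 8 * real K" by linarith
        then show ?thesis unfolding d_def using K1 Kp \<alpha> by (intro powr_mono2') simp_all
      qed
      also have "d < 2 powr - real J" by (rule J(1))
      finally show ?thesis by simp
    qed
    define f where "f k = 2 powr (real (j k) * \<gamma>) * c powr p" for k
    have pw: "(\<Sum>k=K..L. ennreal (f k) * indicator (A k) x) \<le> ?F (int J) x * indicator ?P x" for x
    proof (cases "\<exists>k\<in>{K..L}. x \<in> A k")
      case False
      then have "(\<Sum>k=K..L. ennreal (f k) * indicator (A k) x) = 0" by (intro sum.neutral) auto
      then show ?thesis by simp
    next
      case True
      then obtain k where k: "k \<in> {K..L}" "x \<in> A k" by blast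
      have kk: "k0 \<le> k" "K \<le> k" using k K0 by auto
      have "(\<Sum>l=K..L. ennreal (f l) * indicator (A l) x) = (\<Sum>l=K..L. if l = k then ennreal (f l) else 0)"
      proof (intro sum.cong refl)
        fix l assume "l \<in> {K..L}"
        then have l: "k0 \<le> l" using K0 by simp
        show "ennreal (f l) * indicator (A l) x = (if l = k then ennreal (f l) else 0)"
        proof (cases "x \<in> A l")
          case True
          then show ?thesis using disj[OF kk(1) k(2) l True] by simp
        next
          case False
          then show ?thesis using k(2) by auto
        qed
      qed
      also have "\<dots> = ennreal (f k)" using k(1) by simp
      also have "\<dots> \<le> ?F (int J) x"
        unfolding f_def \<gamma>_def using c Ax[OF kk(1) k(2)] jJ[OF kk(2)] by (intro density_lower[OF q p0]) auto
      also have "\<dots> = ?F (int J) x * indicator ?P x" using inP[OF kk(2) k(2)] by simp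
      finally show ?thesis .
    qed
    have "ennreal (w * (\<Sum>k=K..L. real k powr (\<beta> - 1))) = (\<Sum>k=K..L. ennreal (w * real k powr (\<beta> - 1)))"
      using w by (subst sum_ennreal) (auto simp: sum_distrib_left)
    also have "\<dots> \<le> (\<Sum>k=K..L. ennreal (f k) * emeasure lborel (A k))"
      unfolding f_def using K0 by (intro sum_mono em) auto
    also have "\<dots> = (\<Sum>k=K..L. \<integral>\<^sup>+x. ennreal (f k) * indicator (A k) x \<partial>lborel)"
      using A K0 by (intro sum.cong refl nn_integral_cmult_indicator[symmetric]) simp
    also have "\<dots> = (\<integral>\<^sup>+x. (\<Sum>k=K..L. ennreal (f k) * indicator (A k) x) \<partial>lborel)"
      using A K0 by (intro nn_integral_sum[symmetric] borel_measurable_times_ennreal borel_measurable_const borel_measurable_indicator) simp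
    also have "\<dots> \<le> (\<integral>\<^sup>+x\<in>?P. ?F (int J) x \<partial>lborel)" by (intro nn_integral_mono pw)
    also have "\<dots> \<le> ennreal (B * 2 powr (- real_of_int (int J) * real CARD(2) * \<tau> * p))" by (rule B')
    finally have "w * (\<Sum>k=K..L. real k powr (\<beta> - 1)) \<le> B * 2 powr (- real J * 2 * \<tau> * p)"
      using B by (simp add: ennreal_le_iff)
    also have "\<dots> \<le> (B + 1) * (2 powr (2 * \<tau> * p) * real K powr (- (2 * \<alpha> * \<tau> * p)))"
    proof (intro mult_mono)
      have "2 powr - real J \<le> 2 * real K powr - \<alpha>" using J d by linarith
      then have "(2 powr - real J) powr (2 * \<tau> * p) \<le> (2 * real K powr - \<alpha>) powr (2 * \<tau> * p)"
        using \<tau> p by (intro powr_mono2) auto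
      then show "2 powr (- real J * 2 * \<tau> * p) \<le> 2 powr (2 * \<tau> * p) * real K powr (- (2 * \<alpha> * \<tau> * p))"
        by (simp add: powr_mult powr_powr mult_ac)
    qed (use B in auto)
    finally have "(\<Sum>k=K..L. real k powr (\<beta> - 1)) \<le> C * real K powr (- (2 * \<alpha> * \<tau> * p))"
      using w by (simp add: C_def pos_le_divide_eq mult_ac)
    then show "(\<Sum>k=K..L. real k powr ((\<alpha> + 1) * (s * p) - 2 * \<alpha> - 1)) \<le> C * real K powr (- (2 * \<alpha> * \<tau> * p))"
      by (simp add: \<beta>_def \<gamma>_def)
  qed
qed

text \<open>If \<beta> \<ge> 0, the sums from k1 on dominate the harmonic series and are unbounded.
  For \<beta> < 0 the block from K to 2K alone is of order K^\<beta>, which would outgrow K^(-\<mu>)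
  if \<beta> > -\<mu>.\<close>

lemma powr_sum_bound_exponents:
  fixes \<beta> \<mu> C :: real
  assumes C: "0 < C" and \<mu>: "0 \<le> \<mu>" and k1: "1 \<le> (k1::nat)"
    and bd: "\<And>K L. k1 \<le> K \<Longrightarrow> (\<Sum>k=K..L. real k powr (\<beta> - 1)) \<le> C * real K powr (- \<mu>)"
  shows "\<beta> < 0" "\<beta> \<le> - \<mu>"
proof -
  show neg: "\<beta> < 0"
  proof (rule ccontr)
    assume "\<not> ?thesis"
    then have \<beta>: "0 \<le> \<beta>" by simp
    have "(\<Sum>k<n. 1 / real (Suc (k1 + k))) \<le> C * real k1 powr (- \<mu>)" for n
    proof -
      have "(\<Sum>k<n. 1 / real (Suc (k1 + k))) = (\<Sum>k\<in>{..<n}. 1 / real (k + Suc k1))" by (simp add: add.commute)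
      also have "\<dots> = (\<Sum>k=Suc k1..<n + Suc k1. 1 / real k)"
        using sum.shift_bounds_nat_ivl[of "\<lambda>k. 1 / real k" 0 "Suc k1" n] by (simp only: lessThan_atLeast0 add_0)
      also have "\<dots> \<le> (\<Sum>k=k1..n + k1. 1 / real k)" by (intro sum_mono2) auto
      also have "\<dots> \<le> (\<Sum>k=k1..n + k1. real k powr (\<beta> - 1))"
      proof (intro sum_mono)
        fix k assume "k \<in> {k1..n + k1}"
        then have k: "1 \<le> real k" using k1 by auto
        then have "real k powr - 1 \<le> real k powr (\<beta> - 1)" using \<beta> by (intro powr_mono) auto
        then show "1 / real k \<le> real k powr (\<beta> - 1)" using k by (simp add: powr_minus_divide)
      qed
      also have "\<dots> \<le> C * real k1 powr (- \<mu>)" by (rule bd) simp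
      finally show ?thesis .
    qed
    then have "(\<Sum>k\<le>n. 1 / real (Suc (k1 + k))) \<le> C * real k1 powr (- \<mu>)" for n
      unfolding lessThan_Suc_atMost[symmetric] .
    then have "summable (\<lambda>k. 1 / real (Suc (k1 + k)))"
      by (intro bounded_imp_summable) simp_all
    then have "summable (\<lambda>k. 1 / real (k + Suc k1))" by (simp add: add.commute)
    then have "summable (\<lambda>k. 1 / real k)" by (subst (asm) summable_iff_shift)
    then show False using not_summable_harmonic[where 'a=real] by (simp add: inverse_eq_divide)
  qed
  show "\<beta> \<le> - \<mu>"
  proof (rule ccontr)
    assume "\<not> ?thesis"
    then have e: "0 < \<beta> + \<mu>" by simp
    have K: "real K powr (\<beta> + \<mu>) \<le> C * 2 powr (1 - \<beta>)" if "k1 \<le> K" for K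
    proof -
      have Kp: "1 \<le> real K" using that k1 by simp
      have "real K * (2 * real K) powr (\<beta> - 1) \<le> (\<Sum>k=K..2 * K. (2 * real K) powr (\<beta> - 1))"
        by (simp add: of_nat_diff mult_right_mono)
      also have "\<dots> \<le> (\<Sum>k=K..2 * K. real k powr (\<beta> - 1))"
      proof (intro sum_mono)
        fix k assume "k \<in> {K..2 * K}"
        then have "1 \<le> real k" "real k \<le> 2 * real K" using Kp by auto
        then show "(2 * real K) powr (\<beta> - 1) \<le> real k powr (\<beta> - 1)"
          using neg by (intro powr_mono2') auto
      qed
      also have "\<dots> \<le> C * real K powr (- \<mu>)" by (rule bd[OF that])
      finally have le: "real K * (2 * real K) powr (\<beta> - 1) \<le> C * real K powr (- \<mu>)" .
      have "real K * (2 * real K) powr (\<beta> - 1) = 2 powr (\<beta> - 1) * real K powr \<beta>"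
        using Kp by (simp add: powr_mult powr_diff)
      then have "2 powr (\<beta> - 1) * real K powr \<beta> * (real K powr \<mu> * 2 powr (1 - \<beta>))
          \<le> C * real K powr (- \<mu>) * (real K powr \<mu> * 2 powr (1 - \<beta>))"
        using le by (intro mult_right_mono) auto
      moreover have "2 powr (\<beta> - 1) * real K powr \<beta> * (real K powr \<mu> * 2 powr (1 - \<beta>)) = real K powr (\<beta> + \<mu>)"
      proof -
        have "2 powr (\<beta> - 1) * 2 powr (1 - \<beta>) = 1" by (simp add: powr_add[symmetric])
        then show ?thesis by (simp add: powr_add)
      qed
      moreover have "C * real K powr (- \<mu>) * (real K powr \<mu> * 2 powr (1 - \<beta>)) = C * 2 powr (1 - \<beta>)"
      proof -
        have "real K powr (- \<mu>) * real K powr \<mu> = 1" using Kp by (simp add: powr_add[symmetric])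
        then show ?thesis by simp
      qed
      ultimately show ?thesis by simp
    qed
    define X where "X = (C * 2 powr (1 - \<beta>) + 1) powr (1 / (\<beta> + \<mu>))"
    obtain n :: nat where n: "X < real n" using reals_Archimedean2 by blast
    have "0 < C * 2 powr (1 - \<beta>) + 1" using C by (intro add_pos_pos) auto
    then have X: "0 < X" unfolding X_def by (simp only: powr_gt_zero less_imp_neq[symmetric] not_False_eq_True)
    define K where "K = max k1 n"
    have "X \<le> real K" using n by (simp add: K_def)
    then have "X powr (\<beta> + \<mu>) \<le> real K powr (\<beta> + \<mu>)" using X e by (intro powr_mono2) auto
    moreover have "X powr (\<beta> + \<mu>) = C * 2 powr (1 - \<beta>) + 1"
    proof -
      have "0 \<le> C * 2 powr (1 - \<beta>) + 1" using C by (intro add_nonneg_nonneg) auto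
      moreover have "1 / (\<beta> + \<mu>) * (\<beta> + \<mu>) = 1" using e by simp
      ultimately show ?thesis unfolding X_def powr_powr by (simp only: powr_one)
    qed
    ultimately show False using K[of K] by (simp add: K_def)
  qed
qed

text \<open>Multiplication by \<alpha>p turns the conditions into \<beta> \<le> -2\<alpha>\<tau>p
  and \<beta> < 0, where \<beta> - 1 is the exponent of the sum over the coils and -\<beta>/\<alpha>
  is the exponent \<kappa> of the sufficiency part. At \<tau> = 0 the strict inequality excludes
  exactly the harmonic series.\<close>

lemma spiral_TL_space_iff:
  assumes \<alpha>: "0 < \<alpha>" and ad: "admissible_pair \<phi>\<^sub>0 \<phi>" and p: "1 \<le> p" and q: "1 \<le> q" and s: "0 < s" "s \<le> 1"
    and \<tau>: "0 \<le> \<tau>" "\<tau> < 1 / p" and sp: "s < 1 / p"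
  shows "regular_distribution (indicator (spiral \<alpha>)) \<in> TL_space \<phi>\<^sub>0 \<phi> s \<tau> p q \<longleftrightarrow>
    2 * \<tau> + s * ((\<alpha> + 1) / \<alpha>) \<le> 2 / p \<and> s < 2 * \<alpha> / (\<alpha> + 1) * (1 / p)" (is "?L \<longleftrightarrow> ?R")
proof -
  define \<beta> where "\<beta> = (\<alpha> + 1) * (s * p) - 2 * \<alpha>"
  have p0: "0 < p" using p by simp
  have r1: "2 * \<tau> + s * ((\<alpha> + 1) / \<alpha>) \<le> 2 / p \<longleftrightarrow> \<beta> \<le> - (2 * \<alpha> * \<tau> * p)"
  proof -
    have "2 * \<tau> + s * ((\<alpha> + 1) / \<alpha>) \<le> 2 / p \<longleftrightarrow> (2 * \<tau> + s * ((\<alpha> + 1) / \<alpha>)) * (\<alpha> * p) \<le> 2 / p * (\<alpha> * p)"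
      using \<alpha> p0 by (intro mult_le_cancel_right_pos[symmetric]) auto
    also have "(2 * \<tau> + s * ((\<alpha> + 1) / \<alpha>)) * (\<alpha> * p) = 2 * \<alpha> * \<tau> * p + (\<alpha> + 1) * (s * p)"
      using \<alpha> by (simp add: field_simps)
    also have "2 / p * (\<alpha> * p) = 2 * \<alpha>" using p0 by simp
    finally show ?thesis unfolding \<beta>_def by linarith
  qed
  have r2: "s < 2 * \<alpha> / (\<alpha> + 1) * (1 / p) \<longleftrightarrow> \<beta> < 0"
  proof -
    have "s < 2 * \<alpha> / (\<alpha> + 1) * (1 / p) \<longleftrightarrow> s * ((\<alpha> + 1) * p) < 2 * \<alpha> / (\<alpha> + 1) * (1 / p) * ((\<alpha> + 1) * p)"
      using \<alpha> p0 by (intro mult_less_cancel_right_pos[symmetric]) auto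
    also have "2 * \<alpha> / (\<alpha> + 1) * (1 / p) * ((\<alpha> + 1) * p) = 2 * \<alpha>" using \<alpha> p0 by simp
    also have "s * ((\<alpha> + 1) * p) = (\<alpha> + 1) * (s * p)" by simp
    finally show ?thesis unfolding \<beta>_def by linarith
  qed
  show ?thesis
    unfolding r1 r2
  proof
    assume L: ?L
    obtain C k1 where C: "0 < C" "1 \<le> (k1::nat)"
      "\<And>K L. k1 \<le> K \<Longrightarrow> (\<Sum>k=K..L. real k powr ((\<alpha> + 1) * (s * p) - 2 * \<alpha> - 1)) \<le> C * real K powr (- (2 * \<alpha> * \<tau> * p))"
      by (rule spiral_TL_sum_bound[OF \<alpha> ad p q s(1) \<tau>(1) L]) blast
    have \<mu>: "0 \<le> 2 * \<alpha> * \<tau> * p" using \<alpha> \<tau> p by simp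
    show "\<beta> \<le> - (2 * \<alpha> * \<tau> * p) \<and> \<beta> < 0"
      using powr_sum_bound_exponents[OF C(1) \<mu> C(2), of \<beta>] C(3) unfolding \<beta>_def by blast
  next
    assume R: "\<beta> \<le> - (2 * \<alpha> * \<tau> * p) \<and> \<beta> < 0"
    have \<kappa>: "(2 - s * p * (1 + 1 / \<alpha>)) * \<alpha> = - \<beta>" using \<alpha> by (simp add: \<beta>_def field_simps)
    show ?L
    proof (rule spiral_TL_space[OF \<alpha> ad p q s \<tau>])
      show "s * p < 1" using sp p0 by (simp add: pos_less_divide_eq)
      have "0 < (2 - s * p * (1 + 1 / \<alpha>)) * \<alpha>" using \<kappa> R by simp
      then show "0 < 2 - s * p * (1 + 1 / \<alpha>)" using \<alpha> by (simp only: zero_less_mult_pos2)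
      have "(2 * \<tau> * p) * \<alpha> \<le> (2 - s * p * (1 + 1 / \<alpha>)) * \<alpha>" unfolding \<kappa> using R by (simp add: mult_ac)
      then show "2 * \<tau> * p \<le> 2 - s * p * (1 + 1 / \<alpha>)" using \<alpha> by (simp only: mult_le_cancel_right_pos)
    qed
  qed
qed

theorem theorem5p27:
  fixes p \<tau> s \<alpha> :: real and q :: ennreal and \<phi>\<^sub>0 \<phi> :: "real^2 \<Rightarrow> complex"
  assumes "admissible_pair \<phi>\<^sub>0 \<phi>"
    and "1 \<le> p" and "1 \<le> q" and "0 \<le> \<tau>" and "\<tau> < 1 / p"
    and "0 < s" and "s \<le> 1" and "0 < \<alpha>"
  shows "(bounded (interior (spiral \<alpha>)) \<and> thick (interior (spiral \<alpha>))) \<and>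
    regular_distribution (indicator (spiral \<alpha>)) \<notin> TL_space \<phi>\<^sub>0 \<phi> (1 / p) \<tau> p q \<and>
    (s < min (1 / p) (2 * (1 / p - \<tau>)) \<longrightarrow>
      (\<alpha> < 1 \<longrightarrow>
        (regular_distribution (indicator (spiral \<alpha>)) \<in> TL_space \<phi>\<^sub>0 \<phi> s \<tau> p q \<longleftrightarrow>
          2 * \<tau> + s * ((\<alpha> + 1) / \<alpha>) \<le> 2 / p \<and> s < 2 * \<alpha> / (\<alpha> + 1) * (1 / p))) \<and>
      (\<alpha> = 1 \<longrightarrow>
        (regular_distribution (indicator (spiral \<alpha>)) \<in> TL_space \<phi>\<^sub>0 \<phi> s \<tau> p q \<longleftrightarrow>
          \<tau> + s \<le> 1 / p \<and> s < 1 / p)) \<and>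
      (\<alpha> > 1 \<longrightarrow>
        (regular_distribution (indicator (spiral \<alpha>)) \<in> TL_space \<phi>\<^sub>0 \<phi> s \<tau> p q \<longleftrightarrow>
          2 * \<tau> + s * ((\<alpha> + 1) / \<alpha>) \<le> 2 / p \<and> s < 1 / p)))"
proof -
  \<comment> \<open>For \<alpha> \<ge> 1 the factor 2\<alpha>/(\<alpha>+1) is at least 1. This is
    how one criterion for all \<alpha> takes three different shapes.\<close>
  have large: "s < 2 * \<alpha> / (\<alpha> + 1) * (1 / p)" if "s < 1 / p" "1 \<le> \<alpha>"
  proof -
    have "1 \<le> 2 * \<alpha> / (\<alpha> + 1)" using that by (simp add: pos_le_divide_eq)
    then have "1 * (1 / p) \<le> 2 * \<alpha> / (\<alpha> + 1) * (1 / p)" using assms(2) by (intro mult_right_mono) auto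
    then show ?thesis using that by linarith
  qed
  have one: "(2 * \<tau> + s * ((1 + 1) / 1) \<le> 2 / p) \<longleftrightarrow> \<tau> + s \<le> 1 / p"
  proof -
    have "2 / p = 2 * (1 / p)" "s * ((1 + 1) / 1) = 2 * s" by simp_all
    then show ?thesis by linarith
  qed
  show ?thesis
  proof (intro conjI impI)
    show "bounded (interior (spiral \<alpha>))" "thick (interior (spiral \<alpha>))"
      using thick_interior_spiral[OF assms(8)] by blast+
    show "regular_distribution (indicator (spiral \<alpha>)) \<notin> TL_space \<phi>\<^sub>0 \<phi> (1 / p) \<tau> p q"
      by (rule spiral_not_TL_critical[OF assms(8,1-3)])
    assume "s < min (1 / p) (2 * (1 / p - \<tau>))"
    then have sp: "s < 1 / p" by simp
    note iff = spiral_TL_space_iff[OF assms(8,1-3,6,7,4,5) sp]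
    show "regular_distribution (indicator (spiral \<alpha>)) \<in> TL_space \<phi>\<^sub>0 \<phi> s \<tau> p q \<longleftrightarrow>
        2 * \<tau> + s * ((\<alpha> + 1) / \<alpha>) \<le> 2 / p \<and> s < 2 * \<alpha> / (\<alpha> + 1) * (1 / p)" by (rule iff)
    show "regular_distribution (indicator (spiral \<alpha>)) \<in> TL_space \<phi>\<^sub>0 \<phi> s \<tau> p q \<longleftrightarrow>
        \<tau> + s \<le> 1 / p \<and> s < 1 / p" if "\<alpha> = 1"
      using iff large[OF sp] sp one that by simp
    show "regular_distribution (indicator (spiral \<alpha>)) \<in> TL_space \<phi>\<^sub>0 \<phi> s \<tau> p q \<longleftrightarrow>
        2 * \<tau> + s * ((\<alpha> + 1) / \<alpha>) \<le> 2 / p \<and> s < 1 / p" if "\<alpha> > 1"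
      using iff large[OF sp] sp that by simp
  qed
qed

end
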